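(* (Hopf's formula for Hom-Lie algebras.) For any Hom-Lie algebra $(L,\alpha_L)$ over $\mathbb F$, there is an isomorphism of Hom-vector spaces $H_2^{\alpha}(L)\cong\mathcal M(L,\alpha_L)$, where $H_2^\alpha(L)$ is the second homology and $\mathcal M(L,\alpha_L)$ is the Schur multiplier of $(L,\alpha_L)$.
   Context: Fix a field $\mathbb F$. A Hom-vector space is a pair $(V,\alpha_V)$ of an $\mathbb F$-vector space and a linear map $\alpha_V:V\to V$; morphisms are linear maps commuting with these maps. A (multiplicative) Hom-Lie algebra $(L,\alpha_L)$ is a Hom-vector space with a bilinear product $[\,,]$ such that $[x,y]=-[y,x]$, $[\alpha_L(x),[y,z]]+[\alpha_L(y),[z,x]]+[\alpha_L(z),[x,y]]=0$ and $\alpha_L([x,y])=[\alpha_L(x),\alpha_L(y)]$. Homomorphisms are algebra homomorphisms commuting with the structure maps. An ideal is an $\alpha_L$-invariant subspace $H$ with $[H,L]\subseteq H$; for ideals $H,K$, $[H,K]$ is the span of all $[h,k]$, $h\in H$, $k\in K$. Homology (trivial coefficients): let $C_n^\alpha(L)=L^{\wedge n}$ (exterior power, $L^{\wedge 0}=\mathbb F$) with map $\alpha_L^{\wedge n}$, and let $d_n:C_n^\alpha(L)\to C_{n-1}^\alpha(L)$ be $d_n(x_1\wedge\dots\wedge x_n)=\sum_{i<j}(-1)^{i+j}[x_i,x_j]\wedge\alpha_L(x_1)\wedge\dots\wedge\widehat{\alpha_L(x_i)}\wedge\dots\wedge\widehat{\alpha_L(x_j)}\wedge\dots\wedge\alpha_L(x_n)$.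 Then $H_n^\alpha(L)=\ker(d_n)/\mathrm{Im}(d_{n+1})$, a Hom-vector space with the map induced by $\alpha_L^{\wedge n}$. Free presentation: a Hom-set is a set $X$ with a self-map $\alpha_X$. The free Hom-Lie algebra on $(X,\alpha_X)$ is $(A_X/I,\bar\alpha_A)$, where $A_X$ is the free non-associative $\mathbb F$-algebra on $X$ (the algebra of the free magma on $X$), $\alpha_A$ the endomorphism induced by $\alpha_X$, and $I$ the two-sided ideal generated by all $ab+ba$ and $\alpha_A(a)(bc)+\alpha_A(b)(ca)+\alpha_A(c)(ab)$, $a,b,c\in A_X$. A free presentation of $(L,\alpha_L)$ is a short exact sequence of Hom-Lie algebras $(R,\alpha_R)\rightarrowtail(F,\alpha_F)\twoheadrightarrow(L,\alpha_L)$ with $(F,\alpha_F)$ free and $R$ an ideal of $F$. The Schur multiplier is the abelian Hom-Lie algebra $\mathcal M(L,\alpha_L)=(R\cap[F,F])/[F,R]$ with the map induced by $\alpha_F$; it is independent of the chosen free presentation.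
   Formalization: The exterior power is taken modulo x∧y = -y∧x instead of x∧x = 0; these agree unless the characteristic is 2, where with the usual exterior power d_2 may be ill-defined and the formula fails (L one-dimensional abelian, α the identity). *)

theory Defs
  imports "HOL-Algebra.Module" "HOL-Algebra.QuotRing"
begin

text \<open>
  Vector spaces are \<^locale>\<open>module\<close>s over a \<^locale>\<open>field\<close>. The fields \<^const>\<open>mult\<close> and
  \<^const>\<open>one\<close>, which every record of this kind carries, are ignored by \<^locale>\<open>module\<close>:
  \<^const>\<open>mult\<close> serves as the (nonassociative) product of an algebra, hence as the bracket of a
  Hom-Lie algebra, and \<^const>\<open>one\<close> has no meaning anywhere below.
\<close>

section \<open>Hom-vector spaces and Hom-Lie algebras\<close>

record ('k, 'v) hom_module = "('k, 'v) module" +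
  twist :: "'v \<Rightarrow> 'v"

definition linear_maps ::
  "('k, 'r) ring_scheme \<Rightarrow> ('k, 'v, 'm) module_scheme \<Rightarrow> ('k, 'w, 'n) module_scheme \<Rightarrow> ('v \<Rightarrow> 'w) set"
  where "linear_maps R V W =
    {f \<in> hom (add_monoid V) (add_monoid W).
       \<forall>c\<in>carrier R. \<forall>x\<in>carrier V. f (c \<odot>\<^bsub>V\<^esub> x) = c \<odot>\<^bsub>W\<^esub> f x}"

locale hom_vector_space = field R + module R V
  for R :: "('k, 'r) ring_scheme" (structure) and V :: "('k, 'v, 'm) hom_module_scheme" (structure) +
  assumes twist_linear: "twist V \<in> linear_maps R V V"

definition hom_space_morphisms ::
  "('k, 'r) ring_scheme \<Rightarrow> ('k, 'v, 'm) hom_module_scheme \<Rightarrow> ('k, 'w, 'n) hom_module_scheme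
    \<Rightarrow> ('v \<Rightarrow> 'w) set"
  where "hom_space_morphisms R V W =
    {f \<in> linear_maps R V W. \<forall>x\<in>carrier V. f (twist V x) = twist W (f x)}"

definition hom_space_iso ::
  "('k, 'r) ring_scheme \<Rightarrow> ('k, 'v, 'm) hom_module_scheme \<Rightarrow> ('k, 'w, 'n) hom_module_scheme \<Rightarrow> bool"
  where "hom_space_iso R V W \<longleftrightarrow>
    (\<exists>f\<in>hom_space_morphisms R V W. bij_betw f (carrier V) (carrier W))"

locale hom_lie_algebra = hom_vector_space R L
  for R :: "('k, 'r) ring_scheme" (structure) and L :: "('k, 'v, 'm) hom_module_scheme" (structure) +
  assumes bracket_closed: "\<lbrakk>x \<in> carrier L; y \<in> carrier L\<rbrakk> \<Longrightarrow> x \<otimes>\<^bsub>L\<^esub> y \<in> carrier L"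
    and bracket_add_left: "\<lbrakk>x \<in> carrier L; y \<in> carrier L; z \<in> carrier L\<rbrakk>
      \<Longrightarrow> (x \<oplus>\<^bsub>L\<^esub> y) \<otimes>\<^bsub>L\<^esub> z = x \<otimes>\<^bsub>L\<^esub> z \<oplus>\<^bsub>L\<^esub> y \<otimes>\<^bsub>L\<^esub> z"
    and bracket_add_right: "\<lbrakk>x \<in> carrier L; y \<in> carrier L; z \<in> carrier L\<rbrakk>
      \<Longrightarrow> z \<otimes>\<^bsub>L\<^esub> (x \<oplus>\<^bsub>L\<^esub> y) = z \<otimes>\<^bsub>L\<^esub> x \<oplus>\<^bsub>L\<^esub> z \<otimes>\<^bsub>L\<^esub> y"
    and bracket_smult_left: "\<lbrakk>c \<in> carrier R; x \<in> carrier L; y \<in> carrier L\<rbrakk>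
      \<Longrightarrow> (c \<odot>\<^bsub>L\<^esub> x) \<otimes>\<^bsub>L\<^esub> y = c \<odot>\<^bsub>L\<^esub> (x \<otimes>\<^bsub>L\<^esub> y)"
    and bracket_smult_right: "\<lbrakk>c \<in> carrier R; x \<in> carrier L; y \<in> carrier L\<rbrakk>
      \<Longrightarrow> x \<otimes>\<^bsub>L\<^esub> (c \<odot>\<^bsub>L\<^esub> y) = c \<odot>\<^bsub>L\<^esub> (x \<otimes>\<^bsub>L\<^esub> y)"
    and bracket_skew: "\<lbrakk>x \<in> carrier L; y \<in> carrier L\<rbrakk> \<Longrightarrow> x \<otimes>\<^bsub>L\<^esub> y = \<ominus>\<^bsub>L\<^esub> (y \<otimes>\<^bsub>L\<^esub> x)"
    and hom_jacobi: "\<lbrakk>x \<in> carrier L; y \<in> carrier L; z \<in> carrier L\<rbrakk> \<Longrightarrow>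
      twist L x \<otimes>\<^bsub>L\<^esub> (y \<otimes>\<^bsub>L\<^esub> z) \<oplus>\<^bsub>L\<^esub> twist L y \<otimes>\<^bsub>L\<^esub> (z \<otimes>\<^bsub>L\<^esub> x) \<oplus>\<^bsub>L\<^esub> twist L z \<otimes>\<^bsub>L\<^esub> (x \<otimes>\<^bsub>L\<^esub> y)
        = \<zero>\<^bsub>L\<^esub>"
    and twist_bracket: "\<lbrakk>x \<in> carrier L; y \<in> carrier L\<rbrakk>
      \<Longrightarrow> twist L (x \<otimes>\<^bsub>L\<^esub> y) = twist L x \<otimes>\<^bsub>L\<^esub> twist L y"

definition hom_lie_morphisms ::
  "('k, 'r) ring_scheme \<Rightarrow> ('k, 'v, 'm) hom_module_scheme \<Rightarrow> ('k, 'w, 'n) hom_module_scheme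
    \<Rightarrow> ('v \<Rightarrow> 'w) set"
  where "hom_lie_morphisms R L M =
    {f \<in> hom_space_morphisms R L M.
       \<forall>x\<in>carrier L. \<forall>y\<in>carrier L. f (x \<otimes>\<^bsub>L\<^esub> y) = f x \<otimes>\<^bsub>M\<^esub> f y}"

definition hom_lie_iso ::
  "('k, 'r) ring_scheme \<Rightarrow> ('k, 'v, 'm) hom_module_scheme \<Rightarrow> ('k, 'w, 'n) hom_module_scheme \<Rightarrow> bool"
  where "hom_lie_iso R L M \<longleftrightarrow>
    (\<exists>f\<in>hom_lie_morphisms R L M. bij_betw f (carrier L) (carrier M))"

locale hom_lie_ideal = submodule H R L
  for H :: "'v set" and R :: "('k, 'r) ring_scheme"
    and L :: "('k, 'v, 'm) hom_module_scheme" (structure) +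
  assumes twist_ideal: "h \<in> H \<Longrightarrow> twist L h \<in> H"
    and bracket_ideal: "\<lbrakk>h \<in> H; x \<in> carrier L\<rbrakk> \<Longrightarrow> h \<otimes>\<^bsub>L\<^esub> x \<in> H"

definition linear_span ::
  "('k, 'r) ring_scheme \<Rightarrow> ('k, 'v, 'm) module_scheme \<Rightarrow> 'v set \<Rightarrow> 'v set"
  where "linear_span R V S = \<Inter>{U. submodule U R V \<and> S \<subseteq> U}"

definition bracket_span ::
  "('k, 'r) ring_scheme \<Rightarrow> ('k, 'v, 'm) module_scheme \<Rightarrow> 'v set \<Rightarrow> 'v set \<Rightarrow> 'v set"
  where "bracket_span R L H K = linear_span R L {h \<otimes>\<^bsub>L\<^esub> k | h k. h \<in> H \<and> k \<in> K}"

section \<open>Quotients\<close>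

text \<open>
  The map on cosets induced by \<open>g\<close>, with values in the cosets of \<open>N\<close> in \<open>W\<close>. The union is over a
  constant family, i.e. equals \<open>N +> g a\<close> for any \<open>a \<in> A\<close>, whenever \<open>g\<close> descends to the
  quotients; this is the pattern of \<^const>\<open>rcoset_mult\<close>.
\<close>

definition coset_map :: "('w, 'm) ring_scheme \<Rightarrow> 'w set \<Rightarrow> ('v \<Rightarrow> 'w) \<Rightarrow> 'v set \<Rightarrow> 'w set"
  where "coset_map W N g A = (\<Union>a\<in>A. N +>\<^bsub>W\<^esub> g a)"

definition hom_quotient ::
  "('k, 'v, 'm) hom_module_scheme \<Rightarrow> 'v set \<Rightarrow> ('k, 'v set) hom_module"
  where "hom_quotient V N =
    \<lparr>carrier = a_rcosets\<^bsub>V\<^esub> N, mult = rcoset_mult V N, one = N +>\<^bsub>V\<^esub> \<one>\<^bsub>V\<^esub>,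
     zero = N, add = set_add V,
     smult = (\<lambda>c. coset_map V N (\<lambda>a. c \<odot>\<^bsub>V\<^esub> a)),
     twist = coset_map V N (twist V)\<rparr>"

section \<open>Free Hom-vector spaces\<close>

text \<open>
  The vector space of finitely supported functions on a Hom-set \<open>(S, \<sigma>)\<close>. Its twist extends \<open>\<sigma>\<close>
  linearly, i.e. sends \<open>\<Sum>s. f s \<cdot> s\<close> to \<open>\<Sum>s. f s \<cdot> \<sigma> s\<close>.
\<close>

definition free_hom_space ::
  "('k, 'r) ring_scheme \<Rightarrow> 's set \<Rightarrow> ('s \<Rightarrow> 's) \<Rightarrow> ('k, 's \<Rightarrow> 'k) hom_module"
  where "free_hom_space R S \<sigma> =
    \<lparr>carrier = {f. range f \<subseteq> carrier R \<and> finite {s. f s \<noteq> \<zero>\<^bsub>R\<^esub>} \<and> {s. f s \<noteq> \<zero>\<^bsub>R\<^esub>} \<subseteq> S},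
     mult = (\<lambda>f g s. \<zero>\<^bsub>R\<^esub>), one = (\<lambda>s. \<zero>\<^bsub>R\<^esub>),
     zero = (\<lambda>s. \<zero>\<^bsub>R\<^esub>), add = (\<lambda>f g s. f s \<oplus>\<^bsub>R\<^esub> g s),
     smult = (\<lambda>c f s. c \<otimes>\<^bsub>R\<^esub> f s),
     twist = (\<lambda>f t. \<Oplus>\<^bsub>R\<^esub>s\<in>{s. f s \<noteq> \<zero>\<^bsub>R\<^esub> \<and> \<sigma> s = t}. f s)\<rparr>"

definition basis_vector :: "('k, 'r) ring_scheme \<Rightarrow> 's \<Rightarrow> 's \<Rightarrow> 'k"
  where "basis_vector R s = (\<lambda>t. if t = s then \<one>\<^bsub>R\<^esub> else \<zero>\<^bsub>R\<^esub>)"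

definition linear_extension ::
  "('k, 'r) ring_scheme \<Rightarrow> ('k, 'v, 'm) module_scheme \<Rightarrow> ('s \<Rightarrow> 'v) \<Rightarrow> ('s \<Rightarrow> 'k) \<Rightarrow> 'v"
  where "linear_extension R V g f = (\<Oplus>\<^bsub>V\<^esub>s\<in>{s. f s \<noteq> \<zero>\<^bsub>R\<^esub>}. f s \<odot>\<^bsub>V\<^esub> g s)"

section \<open>Homology with trivial coefficients\<close>

definition tuple_space ::
  "('k, 'r) ring_scheme \<Rightarrow> ('k, 'v, 'm) hom_module_scheme \<Rightarrow> nat \<Rightarrow> ('k, 'v list \<Rightarrow> 'k) hom_module"
  where "tuple_space R L n =
    free_hom_space R {xs. length xs = n \<and> set xs \<subseteq> carrier L} (map (twist L))"

definition multilinear_relations ::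
  "('k, 'r) ring_scheme \<Rightarrow> ('k, 'v, 'm) hom_module_scheme \<Rightarrow> nat \<Rightarrow> ('v list \<Rightarrow> 'k) set"
  where "multilinear_relations R L n =
    {basis_vector R (xs[i := a \<oplus>\<^bsub>L\<^esub> b]) \<ominus>\<^bsub>tuple_space R L n\<^esub>
       (basis_vector R (xs[i := a]) \<oplus>\<^bsub>tuple_space R L n\<^esub> basis_vector R (xs[i := b]))
      | xs i a b. length xs = n \<and> set xs \<subseteq> carrier L \<and> i < n \<and> a \<in> carrier L \<and> b \<in> carrier L} \<union>
    {basis_vector R (xs[i := c \<odot>\<^bsub>L\<^esub> a]) \<ominus>\<^bsub>tuple_space R L n\<^esub>
       (c \<odot>\<^bsub>tuple_space R L n\<^esub> basis_vector R (xs[i := a]))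
      | xs i c a. length xs = n \<and> set xs \<subseteq> carrier L \<and> i < n \<and> c \<in> carrier R \<and> a \<in> carrier L}"

definition skew_relations ::
  "('k, 'r) ring_scheme \<Rightarrow> ('k, 'v, 'm) hom_module_scheme \<Rightarrow> nat \<Rightarrow> ('v list \<Rightarrow> 'k) set"
  where "skew_relations R L n =
    {basis_vector R xs \<oplus>\<^bsub>tuple_space R L n\<^esub> basis_vector R (xs[i := xs ! j, j := xs ! i])
      | xs i j. length xs = n \<and> set xs \<subseteq> carrier L \<and> i < j \<and> j < n}"

text \<open>
  The exterior power is presented by multilinearity and antisymmetry. In characteristic other than 2
  this is the same as imposing that tuples with a repeated entry vanish
  (\<open>exterior_relations_eq_alternating\<close> below). In characteristic 2 the latter would be too much:
  a bracket that is only assumed to be antisymmetric need not satisfy \<open>[x,x] = 0\<close>, so the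
  boundary map \<open>x \<and> y \<mapsto> -[x,y]\<close> is well defined only on the antisymmetric power.
\<close>

definition exterior_relations ::
  "('k, 'r) ring_scheme \<Rightarrow> ('k, 'v, 'm) hom_module_scheme \<Rightarrow> nat \<Rightarrow> ('v list \<Rightarrow> 'k) set"
  where "exterior_relations R L n =
    linear_span R (tuple_space R L n) (multilinear_relations R L n \<union> skew_relations R L n)"

definition exterior_power ::
  "('k, 'r) ring_scheme \<Rightarrow> ('k, 'v, 'm) hom_module_scheme \<Rightarrow> nat \<Rightarrow> ('k, ('v list \<Rightarrow> 'k) set) hom_module"
  where "exterior_power R L n = hom_quotient (tuple_space R L n) (exterior_relations R L n)"

text \<open>
  Positions are counted from 0 here, which does not affect the parity of \<open>i + j\<close>. For \<open>n \<le> 1\<close> there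
  are no pairs \<open>i < j\<close>, so the boundary map is zero (for \<open>n = 0\<close> with the irrelevant codomain
  \<open>exterior_power R L 0\<close>).
\<close>

definition tuple_boundary ::
  "('k, 'r) ring_scheme \<Rightarrow> ('k, 'v, 'm) hom_module_scheme \<Rightarrow> nat \<Rightarrow> 'v list \<Rightarrow> ('v list \<Rightarrow> 'k)"
  where "tuple_boundary R L n xs =
    finsum (tuple_space R L (n - 1))
      (\<lambda>(i, j). ((\<ominus>\<^bsub>R\<^esub> \<one>\<^bsub>R\<^esub>) [^]\<^bsub>R\<^esub> (i + j)) \<odot>\<^bsub>tuple_space R L (n - 1)\<^esub>
         basis_vector R ((xs ! i \<otimes>\<^bsub>L\<^esub> xs ! j) # map (twist L) (nths xs (- {i, j}))))
      {(i, j). i < j \<and> j < n}"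

definition boundary_map ::
  "('k, 'r) ring_scheme \<Rightarrow> ('k, 'v, 'm) hom_module_scheme \<Rightarrow> nat
    \<Rightarrow> ('v list \<Rightarrow> 'k) set \<Rightarrow> ('v list \<Rightarrow> 'k) set"
  where "boundary_map R L n =
    coset_map (tuple_space R L (n - 1)) (exterior_relations R L (n - 1))
      (linear_extension R (tuple_space R L (n - 1)) (tuple_boundary R L n))"

definition homology ::
  "('k, 'r) ring_scheme \<Rightarrow> ('k, 'v, 'm) hom_module_scheme \<Rightarrow> nat
    \<Rightarrow> ('k, ('v list \<Rightarrow> 'k) set set) hom_module"
  where "homology R L n =
    hom_quotient
      ((exterior_power R L n)\<lparr>carrier :=
          a_kernel (exterior_power R L n) (exterior_power R L (n - 1)) (boundary_map R L n)\<rparr>)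
      (boundary_map R L (n + 1) ` carrier (exterior_power R L (n + 1)))"

section \<open>Free Hom-Lie algebras and the Schur multiplier\<close>

datatype 'x magma = Gen 'x | Mul "'x magma" "'x magma"

text \<open>
  The product extends \<open>u \<cdot> v = Mul u v\<close> bilinearly: the coefficient of \<open>Mul u v\<close> in \<open>f \<cdot> g\<close> is
  \<open>f u \<cdot> g v\<close>, and generators do not occur in products.
\<close>

definition free_nonassoc_algebra ::
  "('k, 'r) ring_scheme \<Rightarrow> 'x set \<Rightarrow> ('x \<Rightarrow> 'x) \<Rightarrow> ('k, 'x magma \<Rightarrow> 'k) hom_module"
  where "free_nonassoc_algebra R X \<sigma> =
    (free_hom_space R {w. set_magma w \<subseteq> X} (map_magma \<sigma>))
      \<lparr>mult := (\<lambda>f g w. case w of Gen x \<Rightarrow> \<zero>\<^bsub>R\<^esub> | Mul u v \<Rightarrow> f u \<otimes>\<^bsub>R\<^esub> g v)\<rparr>"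

text \<open>\<^const>\<open>genideal\<close> is not applicable, since the algebra is neither associative nor unital.\<close>

definition generated_ideal ::
  "('k, 'r) ring_scheme \<Rightarrow> ('k, 'v, 'm) module_scheme \<Rightarrow> 'v set \<Rightarrow> 'v set"
  where "generated_ideal R A S =
    \<Inter>{J. submodule J R A \<and> (\<forall>a\<in>carrier A. \<forall>x\<in>J. a \<otimes>\<^bsub>A\<^esub> x \<in> J \<and> x \<otimes>\<^bsub>A\<^esub> a \<in> J) \<and> S \<subseteq> J}"

definition hom_lie_relations :: "('k, 'v, 'm) hom_module_scheme \<Rightarrow> 'v set"
  where "hom_lie_relations A =
    {a \<otimes>\<^bsub>A\<^esub> b \<oplus>\<^bsub>A\<^esub> b \<otimes>\<^bsub>A\<^esub> a | a b. a \<in> carrier A \<and> b \<in> carrier A} \<union>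
    {twist A a \<otimes>\<^bsub>A\<^esub> (b \<otimes>\<^bsub>A\<^esub> c) \<oplus>\<^bsub>A\<^esub> twist A b \<otimes>\<^bsub>A\<^esub> (c \<otimes>\<^bsub>A\<^esub> a) \<oplus>\<^bsub>A\<^esub> twist A c \<otimes>\<^bsub>A\<^esub> (a \<otimes>\<^bsub>A\<^esub> b)
      | a b c. a \<in> carrier A \<and> b \<in> carrier A \<and> c \<in> carrier A}"

definition free_hom_lie_algebra ::
  "('k, 'r) ring_scheme \<Rightarrow> 'x set \<Rightarrow> ('x \<Rightarrow> 'x) \<Rightarrow> ('k, ('x magma \<Rightarrow> 'k) set) hom_module"
  where "free_hom_lie_algebra R X \<sigma> =
    hom_quotient (free_nonassoc_algebra R X \<sigma>)
      (generated_ideal R (free_nonassoc_algebra R X \<sigma>)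
        (hom_lie_relations (free_nonassoc_algebra R X \<sigma>)))"

text \<open>
  A free presentation \<open>K \<rightarrow> F \<rightarrow> L\<close>, where \<open>K\<close> is an ideal of \<open>F\<close>, the first map is the inclusion,
  the second map is \<open>p\<close>, and \<open>F\<close> is free on the Hom-set \<open>(X, \<sigma>)\<close>.
\<close>

locale free_presentation =
  F: hom_lie_algebra R F + L: hom_lie_algebra R L + K: hom_lie_ideal K R F
  for R :: "('k, 'r) ring_scheme"
    and X :: "'x set" and \<sigma> :: "'x \<Rightarrow> 'x"
    and K :: "'f set" and F :: "('k, 'f, 'm) hom_module_scheme"
    and p :: "'f \<Rightarrow> 'l" and L :: "('k, 'l, 'n) hom_module_scheme" +
  assumes hom_set: "\<sigma> \<in> X \<rightarrow> X"
    and free: "hom_lie_iso R F (free_hom_lie_algebra R X \<sigma>)"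
    and morphism: "p \<in> hom_lie_morphisms R F L"
    and surjective: "p ` carrier F = carrier L"
    and exact: "a_kernel F L p = K"

definition schur_multiplier ::
  "('k, 'r) ring_scheme \<Rightarrow> 'f set \<Rightarrow> ('k, 'f, 'm) hom_module_scheme \<Rightarrow> ('k, 'f set) hom_module"
  where "schur_multiplier R K F =
    hom_quotient (F\<lparr>carrier := K \<inter> bracket_span R F (carrier F) (carrier F)\<rparr>)
      (bracket_span R F (carrier F) K)"

section \<open>The exterior power in characteristic other than 2\<close>

definition alternating_relations ::
  "('k, 'r) ring_scheme \<Rightarrow> ('k, 'v, 'm) hom_module_scheme \<Rightarrow> nat \<Rightarrow> ('v list \<Rightarrow> 'k) set"
  where "alternating_relations R L n =
    {basis_vector R xs
      | xs i j. length xs = n \<and> set xs \<subseteq> carrier L \<and> i < j \<and> j < n \<and> xs ! i = xs ! j}"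

lemma free_hom_space_module:
  fixes R (structure)
  assumes "field R"
  shows "module R (free_hom_space R S \<sigma>)"
proof -
  interpret field R by fact
  let ?V = "free_hom_space R S \<sigma>"
  have val: "f s \<in> carrier R" if "f \<in> carrier ?V" for f s
    using that by (auto simp: free_hom_space_def)
  have supp: "h \<in> carrier ?V"
    if "f \<in> carrier ?V" "g \<in> carrier ?V" "\<And>s. h s \<in> carrier R"
      "\<And>s. f s = \<zero> \<Longrightarrow> g s = \<zero> \<Longrightarrow> h s = \<zero>" for f g h
  proof -
    have sub: "{s. h s \<noteq> \<zero>} \<subseteq> {s. f s \<noteq> \<zero>} \<union> {s. g s \<noteq> \<zero>}"
      using that(4) by blast
    then have "finite {s. h s \<noteq> \<zero>}"
      using that(1,2) by (auto simp: free_hom_space_def intro: finite_subset)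
    then show ?thesis
      using that(1-3) sub by (auto simp: free_hom_space_def)
  qed
  have ops: "\<zero>\<^bsub>?V\<^esub> = (\<lambda>s. \<zero>)" "f \<oplus>\<^bsub>?V\<^esub> g = (\<lambda>s. f s \<oplus> g s)" "c \<odot>\<^bsub>?V\<^esub> f = (\<lambda>s. c \<otimes> f s)"
    for f g c by (simp_all add: free_hom_space_def)
  have zero: "\<zero>\<^bsub>?V\<^esub> \<in> carrier ?V"
    by (simp add: free_hom_space_def)
  have add: "f \<oplus>\<^bsub>?V\<^esub> g \<in> carrier ?V" if "f \<in> carrier ?V" "g \<in> carrier ?V" for f g
    by (rule supp[OF that]) (use that in \<open>auto simp: ops val\<close>)
  have neg: "(\<lambda>s. \<ominus> f s) \<in> carrier ?V" if "f \<in> carrier ?V" for f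
    by (rule supp[OF that that]) (use that in \<open>auto simp: val\<close>)
  have scal: "c \<odot>\<^bsub>?V\<^esub> f \<in> carrier ?V" if "c \<in> carrier R" "f \<in> carrier ?V" for c f
    by (rule supp[OF that(2) that(2)]) (use that in \<open>auto simp: ops val\<close>)
  have "abelian_group ?V"
  proof (rule abelian_groupI)
    fix f assume "f \<in> carrier ?V"
    then show "\<exists>g\<in>carrier ?V. g \<oplus>\<^bsub>?V\<^esub> f = \<zero>\<^bsub>?V\<^esub>"
      by (intro bexI[OF _ neg]) (auto simp: ops val l_neg)
  qed (use zero add in \<open>auto simp: ops val a_ac\<close>)
  then show ?thesis
    by (rule moduleI[OF is_cring])
      (use scal in \<open>auto simp: ops val l_distr r_distr m_assoc\<close>)
qed

lemma linear_span_superset: "S \<subseteq> linear_span R V S"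
  by (auto simp: linear_span_def)

lemma linear_span_minimal: "submodule U R V \<Longrightarrow> S \<subseteq> U \<Longrightarrow> linear_span R V S \<subseteq> U"
  by (auto simp: linear_span_def)

lemma submodule_linear_span:
  assumes "module R V" "S \<subseteq> carrier V"
  shows "submodule (linear_span R V S) R V"
proof -
  interpret module R V by fact
  have car: "linear_span R V S \<subseteq> carrier V"
    by (rule linear_span_minimal[OF carrier_is_submodule assms(2)])
  show ?thesis
  proof (rule submoduleI[OF car])
    show "\<zero>\<^bsub>V\<^esub> \<in> linear_span R V S"
      using submodule.axioms(1) subgroup.one_closed by (fastforce simp: linear_span_def)
  qed (auto simp: linear_span_def dest: submoduleE)
qed

lemma exterior_relations_eq_alternating:
  fixes R (structure)
  assumes "field R" and "hom_vector_space R L" and two: "\<one> \<oplus> \<one> \<noteq> \<zero>"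
  shows "exterior_relations R L n =
    linear_span R (tuple_space R L n) (multilinear_relations R L n \<union> alternating_relations R L n)"
proof -
  interpret field R by fact
  interpret L: hom_vector_space R L by fact
  define T where "T = tuple_space R L n"
  interpret T: module R T
    unfolding T_def tuple_space_def by (rule free_hom_space_module) fact
  define b :: "'c list \<Rightarrow> 'c list \<Rightarrow> 'a" where "b = basis_vector R"
  have b: "b xs \<in> carrier T" if "length xs = n" "set xs \<subseteq> carrier L" for xs
    using that by (auto simp: b_def basis_vector_def T_def tuple_space_def free_hom_space_def)
  have upd: "set (xs[i := a]) \<subseteq> carrier L" if "set xs \<subseteq> carrier L" "a \<in> carrier L" for xs i a
    using that set_update_subset_insert by fastforce
  have upd2: "set (xs[i := xs ! j, j := xs ! i]) \<subseteq> carrier L"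
    if "set xs \<subseteq> carrier L" "length xs = n" "i < j" "j < n" for xs i j
    using that by (intro upd) auto
  let ?M = "multilinear_relations R L n" and ?S = "skew_relations R L n"
    and ?A = "alternating_relations R L n"
  have M: "?M \<subseteq> carrier T"
    unfolding multilinear_relations_def b_def[symmetric] T_def[symmetric]
    by (auto intro!: T.M.minus_closed T.M.a_closed T.smult_closed b elim!: upd[THEN subsetD, rotated 2])
  have S: "?S \<subseteq> carrier T"
    unfolding skew_relations_def b_def[symmetric] T_def[symmetric]
    by (auto intro!: T.M.a_closed b elim!: upd2[THEN subsetD, rotated 4])
  have A: "?A \<subseteq> carrier T"
    unfolding alternating_relations_def b_def[symmetric] T_def[symmetric] by (auto intro: b)
  have N: "submodule (linear_span R T (?M \<union> ?S)) R T"
    and N': "submodule (linear_span R T (?M \<union> ?A)) R T"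
    using M S A by (auto intro!: submodule_linear_span T.module_axioms)
  have "?A \<subseteq> linear_span R T (?M \<union> ?S)"
  proof
    fix f assume "f \<in> ?A"
    then obtain xs i j where f: "f = b xs" and xs: "length xs = n" "set xs \<subseteq> carrier L"
      and ij: "i < j" "j < n" "xs ! i = xs ! j"
      by (auto simp: alternating_relations_def b_def)
    have fT: "f \<in> carrier T" using f b xs by simp
    have "xs[i := xs ! j, j := xs ! i] = xs"
      using ij by (metis list_update_id)
    then have "f \<oplus>\<^bsub>T\<^esub> f = basis_vector R xs \<oplus>\<^bsub>T\<^esub> basis_vector R (xs[i := xs ! j, j := xs ! i])"
      by (simp only: f b_def)
    then have "f \<oplus>\<^bsub>T\<^esub> f \<in> ?S"
      unfolding skew_relations_def T_def using xs ij(1,2) by blast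
    then have ff: "f \<oplus>\<^bsub>T\<^esub> f \<in> linear_span R T (?M \<union> ?S)"
      by (auto intro: linear_span_superset[THEN subsetD])
    have unit: "\<one> \<oplus> \<one> \<in> Units R"
      using two by (simp add: field_Units)
    then have inv2: "inv (\<one> \<oplus> \<one>) \<in> carrier R"
      by (rule Units_inv_closed)
    have "f \<oplus>\<^bsub>T\<^esub> f = (\<one> \<oplus> \<one>) \<odot>\<^bsub>T\<^esub> f"
      using T.smult_l_distr[OF one_closed one_closed fT] T.smult_one[OF fT] by simp
    then have "inv (\<one> \<oplus> \<one>) \<odot>\<^bsub>T\<^esub> (f \<oplus>\<^bsub>T\<^esub> f) = f"
      using T.smult_assoc1[OF inv2 _ fT, of "\<one> \<oplus> \<one>"] Units_l_inv[OF unit] T.smult_one[OF fT]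
      by simp
    then show "f \<in> linear_span R T (?M \<union> ?S)"
      using submodule.smult_closed[OF N inv2 ff] by simp
  qed
  moreover have "?S \<subseteq> linear_span R T (?M \<union> ?A)"
  proof
    fix f assume "f \<in> ?S"
    then obtain xs i j where f: "f = b xs \<oplus>\<^bsub>T\<^esub> b (xs[i := xs ! j, j := xs ! i])"
      and xs: "length xs = n" "set xs \<subseteq> carrier L" and ij: "i < j" "j < n"
      by (auto simp: skew_relations_def b_def T_def)
    define u v where "u = xs ! i" and "v = xs ! j"
    have "u \<in> set xs" "v \<in> set xs"
      using xs ij by (auto simp: u_def v_def)
    then have uv: "u \<in> carrier L" "v \<in> carrier L" "u \<oplus>\<^bsub>L\<^esub> v \<in> carrier L"
      using xs by (auto intro!: L.M.a_closed)
    define e where "e = (\<lambda>y z. b (xs[i := y, j := z]))"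
    let ?N = "linear_span R T (?M \<union> ?A)"
    have e: "e y z \<in> carrier T" if "y \<in> carrier L" "z \<in> carrier L" for y z
      unfolding e_def using that xs by (intro b upd) auto
    have alt: "e y y \<in> ?N" if "y \<in> carrier L" for y
    proof -
      define ys where "ys = xs[i := y, j := y]"
      have ys: "length ys = n" "ys ! i = ys ! j"
        using xs ij by (simp_all add: ys_def nth_list_update)
      have ys': "set ys \<subseteq> carrier L"
        unfolding ys_def using that xs by (intro upd)
      have "basis_vector R ys \<in> ?A"
        unfolding alternating_relations_def using ys ys' ij by blast
      then have "e y y \<in> ?A"
        by (simp add: e_def b_def ys_def)
      then show ?thesis by (auto intro: linear_span_superset[THEN subsetD])
    qed
    have add1: "e (y \<oplus>\<^bsub>L\<^esub> y') z \<ominus>\<^bsub>T\<^esub> (e y z \<oplus>\<^bsub>T\<^esub> e y' z) \<in> ?N"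
      if "y \<in> carrier L" "y' \<in> carrier L" "z \<in> carrier L" for y y' z
    proof -
      have "e (y \<oplus>\<^bsub>L\<^esub> y') z \<ominus>\<^bsub>T\<^esub> (e y z \<oplus>\<^bsub>T\<^esub> e y' z) \<in> ?M"
        unfolding multilinear_relations_def e_def b_def T_def
        using that xs ij upd[OF xs(2) that(3), of j]
        by (intro UnI1 CollectI exI[of _ "xs[j := z]"] exI[of _ i] exI[of _ y] exI[of _ y'])
          (auto simp: list_update_swap)
      then show ?thesis by (auto intro: linear_span_superset[THEN subsetD])
    qed
    have add2: "e z (y \<oplus>\<^bsub>L\<^esub> y') \<ominus>\<^bsub>T\<^esub> (e z y \<oplus>\<^bsub>T\<^esub> e z y') \<in> ?N"
      if "y \<in> carrier L" "y' \<in> carrier L" "z \<in> carrier L" for y y' z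
    proof -
      have "e z (y \<oplus>\<^bsub>L\<^esub> y') \<ominus>\<^bsub>T\<^esub> (e z y \<oplus>\<^bsub>T\<^esub> e z y') \<in> ?M"
        unfolding multilinear_relations_def e_def b_def T_def
        using that xs ij upd[OF xs(2) that(3), of i]
        by (intro UnI1 CollectI exI[of _ "xs[i := z]"] exI[of _ j] exI[of _ y] exI[of _ y']) auto
      then show ?thesis by (auto intro: linear_span_superset[THEN subsetD])
    qed
    let ?w = "u \<oplus>\<^bsub>L\<^esub> v"
    note cl = T.submoduleE(5)[OF N'] T.submoduleE(3)[OF N']
    have r: "e ?w ?w \<in> ?N" "e ?w ?w \<ominus>\<^bsub>T\<^esub> (e u ?w \<oplus>\<^bsub>T\<^esub> e v ?w) \<in> ?N"
      "e u ?w \<ominus>\<^bsub>T\<^esub> (e u u \<oplus>\<^bsub>T\<^esub> e u v) \<in> ?N" "e v ?w \<ominus>\<^bsub>T\<^esub> (e v u \<oplus>\<^bsub>T\<^esub> e v v) \<in> ?N"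
      "e u u \<in> ?N" "e v v \<in> ?N"
      using uv by (auto intro: alt add1 add2)
    have c: "e ?w ?w \<in> carrier T" "e u ?w \<in> carrier T" "e v ?w \<in> carrier T" "e u v \<in> carrier T"
      "e v u \<in> carrier T" "e u u \<in> carrier T" "e v v \<in> carrier T"
      using uv by (auto intro: e)
    have diff: "x \<in> ?N" if "y \<ominus>\<^bsub>T\<^esub> x \<in> ?N" "y \<in> ?N" "x \<in> carrier T" "y \<in> carrier T" for x y
    proof -
      have "\<ominus>\<^bsub>T\<^esub> (y \<ominus>\<^bsub>T\<^esub> x) \<oplus>\<^bsub>T\<^esub> y = x \<oplus>\<^bsub>T\<^esub> (\<ominus>\<^bsub>T\<^esub> y \<oplus>\<^bsub>T\<^esub> y)"
        using that(3,4) by (simp add: T.M.minus_eq T.M.minus_add T.M.a_ac)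
      also have "\<dots> = x"
        using that(3,4) by (simp add: T.M.l_neg)
      finally show ?thesis using cl(1)[OF cl(2)[OF that(1)] that(2)] by simp
    qed
    have s: "e u ?w \<oplus>\<^bsub>T\<^esub> e v ?w \<in> ?N"
      by (rule diff[OF r(2,1)]) (use c in simp_all)
    have "(e u ?w \<oplus>\<^bsub>T\<^esub> e v ?w) \<ominus>\<^bsub>T\<^esub> ((e u u \<oplus>\<^bsub>T\<^esub> e u v) \<oplus>\<^bsub>T\<^esub> (e v u \<oplus>\<^bsub>T\<^esub> e v v))
      = (e u ?w \<ominus>\<^bsub>T\<^esub> (e u u \<oplus>\<^bsub>T\<^esub> e u v)) \<oplus>\<^bsub>T\<^esub> (e v ?w \<ominus>\<^bsub>T\<^esub> (e v u \<oplus>\<^bsub>T\<^esub> e v v))"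
      using c by (simp add: T.M.minus_eq T.M.minus_add T.M.a_ac)
    then have d: "(e u ?w \<oplus>\<^bsub>T\<^esub> e v ?w) \<ominus>\<^bsub>T\<^esub> ((e u u \<oplus>\<^bsub>T\<^esub> e u v) \<oplus>\<^bsub>T\<^esub> (e v u \<oplus>\<^bsub>T\<^esub> e v v)) \<in> ?N"
      using cl(1)[OF r(3,4)] by simp
    have t: "(e u u \<oplus>\<^bsub>T\<^esub> e u v) \<oplus>\<^bsub>T\<^esub> (e v u \<oplus>\<^bsub>T\<^esub> e v v) \<in> ?N"
      by (rule diff[OF d s]) (use c in simp_all)
    have "e u v \<oplus>\<^bsub>T\<^esub> e v u = ((e u u \<oplus>\<^bsub>T\<^esub> e u v) \<oplus>\<^bsub>T\<^esub> (e v u \<oplus>\<^bsub>T\<^esub> e v v))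
        \<oplus>\<^bsub>T\<^esub> (\<ominus>\<^bsub>T\<^esub> e u u \<oplus>\<^bsub>T\<^esub> \<ominus>\<^bsub>T\<^esub> e v v)"
    proof -
      have "((e u u \<oplus>\<^bsub>T\<^esub> e u v) \<oplus>\<^bsub>T\<^esub> (e v u \<oplus>\<^bsub>T\<^esub> e v v))
          \<oplus>\<^bsub>T\<^esub> (\<ominus>\<^bsub>T\<^esub> e u u \<oplus>\<^bsub>T\<^esub> \<ominus>\<^bsub>T\<^esub> e v v)
        = (e u v \<oplus>\<^bsub>T\<^esub> e v u) \<oplus>\<^bsub>T\<^esub> ((e u u \<oplus>\<^bsub>T\<^esub> \<ominus>\<^bsub>T\<^esub> e u u) \<oplus>\<^bsub>T\<^esub> (e v v \<oplus>\<^bsub>T\<^esub> \<ominus>\<^bsub>T\<^esub> e v v))"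
        using c by (simp only: T.M.a_ac T.M.a_closed T.M.a_inv_closed)
      then show ?thesis using c by (simp add: T.M.r_neg)
    qed
    also have "\<dots> \<in> ?N"
      by (rule cl(1)[OF t cl(1)[OF cl(2)[OF r(5)] cl(2)[OF r(6)]]])
    finally have "e u v \<oplus>\<^bsub>T\<^esub> e v u \<in> ?N" .
    moreover have "e u v = b xs" "e v u = b (xs[i := xs ! j, j := xs ! i])"
      by (simp_all add: e_def u_def v_def)
    ultimately show "f \<in> ?N"
      by (simp add: f)
  qed
  ultimately have "linear_span R T (?M \<union> ?S) = linear_span R T (?M \<union> ?A)"
    using linear_span_superset[of "?M \<union> ?S" R T] linear_span_superset[of "?M \<union> ?A" R T]
    by (intro subset_antisym linear_span_minimal N N') auto
  then show ?thesis
    by (simp add: exterior_relations_def T_def)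
qed

end

theory Submission
  imports Defs
begin

text \<open>
  Write \<open>L = F / K\<close> with \<open>F\<close> free. Every element of \<open>L \<and> L\<close> has the form \<open>\<Sum> p a \<and> p b\<close>, and
  \<open>p a \<and> p b \<mapsto> [a, b]\<close> is a well-defined surjection of \<open>L \<and> L\<close> modulo boundaries onto
  \<open>[F, F] / [F, K]\<close>: the Hom-Jacobi identity of \<open>F\<close> kills the image of \<open>d\<^sub>3\<close>. The cycles are exactly
  the elements that are sent into \<open>K\<close>, so it remains to see that the map is injective. This is where
  freeness enters. In the free nonassociative algebra \<open>A\<close> products factor uniquely, so
  \<open>u v \<mapsto> p u \<and> p v\<close> defines a linear map on \<open>A\<close>; modulo boundaries it respects the defining relations
  of \<open>F = A / I\<close> and hence gives a map \<open>[a, b] \<mapsto> p a \<and> p b\<close> on \<open>F\<close>, which vanishes on \<open>[F, K]\<close> and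
  inverts the map above.
\<close>

section \<open>Linear maps\<close>

text \<open>Both sides of the formula are quotients of quotients, and no map between them is written
  down directly. Each is exhibited as an image of one module, the formal combinations of pairs whose
  bracket in L vanishes. The isomorphism then amounts to the equality of two kernels, and all
  computations use representatives instead of cosets of cosets.

  The obstacle is that p has no preferred section: an arbitrary set-theoretic right inverse need be
  neither linear nor compatible with the twists. It still suffices, because modulo [F, K] a bracket
  depends only on the images of its two factors in L.

  On A only the values on products are prescribed, and the kernel of the resulting map need not be
  an ideal of A. This is why its vanishing on I is proved for the part of the kernel that lies in I.

  All arguments use antisymmetry and never the vanishing of x wedge x, so characteristic 2 needs no
  separate treatment.\<close>

lemma (in abelian_group) minus_eq_zero_iff:
  assumes "x \<in> carrier G" "y \<in> carrier G"
  shows "x \<ominus> y = \<zero> \<longleftrightarrow> x = y"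
  using assms minus_equality[of x "\<ominus> y"] by (auto simp: minus_eq r_neg)

lemma linear_mapsI:
  assumes "\<And>x. x \<in> carrier V \<Longrightarrow> f x \<in> carrier W"
    and "\<And>x y. x \<in> carrier V \<Longrightarrow> y \<in> carrier V \<Longrightarrow> f (x \<oplus>\<^bsub>V\<^esub> y) = f x \<oplus>\<^bsub>W\<^esub> f y"
    and "\<And>c x. c \<in> carrier R \<Longrightarrow> x \<in> carrier V \<Longrightarrow> f (c \<odot>\<^bsub>V\<^esub> x) = c \<odot>\<^bsub>W\<^esub> f x"
  shows "f \<in> linear_maps R V W"
  using assms by (auto simp: linear_maps_def hom_def)

lemma
  assumes "f \<in> linear_maps R V W"
  shows linear_maps_closed: "x \<in> carrier V \<Longrightarrow> f x \<in> carrier W"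
    and linear_maps_add:
      "x \<in> carrier V \<Longrightarrow> y \<in> carrier V \<Longrightarrow> f (x \<oplus>\<^bsub>V\<^esub> y) = f x \<oplus>\<^bsub>W\<^esub> f y"
    and linear_maps_smult:
      "c \<in> carrier R \<Longrightarrow> x \<in> carrier V \<Longrightarrow> f (c \<odot>\<^bsub>V\<^esub> x) = c \<odot>\<^bsub>W\<^esub> f x"
  using assms by (auto simp: linear_maps_def hom_def)

lemma linear_maps_zero:
  assumes "module R V" "module R W" "f \<in> linear_maps R V W"
  shows "f \<zero>\<^bsub>V\<^esub> = \<zero>\<^bsub>W\<^esub>"
proof -
  interpret V: module R V by fact
  interpret W: module R W by fact
  have "f (\<zero>\<^bsub>R\<^esub> \<odot>\<^bsub>V\<^esub> \<zero>\<^bsub>V\<^esub>) = \<zero>\<^bsub>R\<^esub> \<odot>\<^bsub>W\<^esub> f \<zero>\<^bsub>V\<^esub>"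
    using assms(3) by (intro linear_maps_smult) auto
  then show ?thesis
    using linear_maps_closed[OF assms(3)] by simp
qed

lemma linear_maps_neg:
  assumes "module R V" "module R W" "f \<in> linear_maps R V W" "x \<in> carrier V"
  shows "f (\<ominus>\<^bsub>V\<^esub> x) = \<ominus>\<^bsub>W\<^esub> f x"
proof -
  interpret V: module R V by fact
  interpret W: module R W by fact
  have "f (\<ominus>\<^bsub>V\<^esub> x) \<oplus>\<^bsub>W\<^esub> f x = \<zero>\<^bsub>W\<^esub>"
    using linear_maps_add[OF assms(3), of "\<ominus>\<^bsub>V\<^esub> x" x] assms(4)
      linear_maps_zero[OF assms(1-3)] by (simp add: V.M.l_neg)
  then show ?thesis
    using assms(4) linear_maps_closed[OF assms(3)] by (simp add: W.M.minus_equality)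
qed

lemma linear_maps_minus:
  assumes "module R V" "module R W" "f \<in> linear_maps R V W" "x \<in> carrier V" "y \<in> carrier V"
  shows "f (x \<ominus>\<^bsub>V\<^esub> y) = f x \<ominus>\<^bsub>W\<^esub> f y"
proof -
  interpret V: module R V by fact
  show ?thesis
    using assms linear_maps_add[OF assms(3), of x "\<ominus>\<^bsub>V\<^esub> y"]
    by (simp add: a_minus_def linear_maps_neg)
qed

lemma linear_maps_comp:
  "f \<in> linear_maps R U V \<Longrightarrow> g \<in> linear_maps R V W \<Longrightarrow> (\<lambda>x. g (f x)) \<in> linear_maps R U W"
  by (auto intro!: linear_mapsI simp: linear_maps_closed linear_maps_add linear_maps_smult)

lemma linear_maps_uminus:
  assumes "module R V" "module R W" "f \<in> linear_maps R V W"
  shows "(\<lambda>x. \<ominus>\<^bsub>W\<^esub> f x) \<in> linear_maps R V W"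
proof -
  interpret W: module R W by fact
  show ?thesis
    by (rule linear_mapsI)
      (use assms(3) in \<open>simp_all add: linear_maps_closed linear_maps_add linear_maps_smult
        W.M.minus_add W.smult_r_minus\<close>)
qed

lemma linear_maps_homothety:
  assumes "module R V" "c \<in> carrier R"
  shows "(\<lambda>x. c \<odot>\<^bsub>V\<^esub> x) \<in> linear_maps R V V"
proof -
  interpret V: module R V by fact
  show ?thesis
    by (rule linear_mapsI)
      (use assms(2) in \<open>simp_all add: V.smult_r_distr V.smult_assoc1[symmetric] V.R.m_comm\<close>)
qed

text \<open>Statements about all elements of a span or of a generated ideal are proved by showing
  that the elements with the desired property form a submodule. This lemma and the versions for
  kernels, equalizers, intersections and images provide such submodules.\<close>

lemma submodule_vimage:
  assumes "module R V" "module R W" "f \<in> linear_maps R V W" "submodule M R W"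
  shows "submodule {x \<in> carrier V. f x \<in> M} R V"
proof -
  interpret V: module R V by fact
  interpret W: module R W by fact
  interpret M: submodule M R W by fact
  show ?thesis
    by (rule V.submoduleI)
      (use assms M.one_closed in \<open>auto simp: linear_maps_zero linear_maps_neg linear_maps_add
        linear_maps_smult W.submoduleE\<close>)
qed

lemma submodule_zero:
  assumes "module R V" shows "submodule {\<zero>\<^bsub>V\<^esub>} R V"
proof -
  interpret V: module R V by fact
  show ?thesis by (rule V.submoduleI) auto
qed

lemma submodule_kernel:
  assumes "module R V" "module R W" "f \<in> linear_maps R V W"
  shows "submodule {x \<in> carrier V. f x = \<zero>\<^bsub>W\<^esub>} R V"
  using submodule_vimage[OF assms submodule_zero[OF assms(2)]] by simp

lemma submodule_equalizer:
  assumes "module R V" "module R W" "f \<in> linear_maps R V W" "g \<in> linear_maps R V W"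
  shows "submodule {x \<in> carrier V. f x = g x} R V"
proof -
  interpret V: module R V by fact
  interpret W: module R W by fact
  show ?thesis
    by (rule V.submoduleI)
      (use assms in \<open>auto simp: linear_maps_zero linear_maps_neg linear_maps_add
        linear_maps_smult\<close>)
qed

lemma submodule_Int:
  assumes "module R V" "submodule M R V" "submodule N R V"
  shows "submodule (M \<inter> N) R V"
proof -
  interpret V: module R V by fact
  interpret M: submodule M R V by fact
  interpret N: submodule N R V by fact
  show ?thesis
    by (rule V.submoduleI)
      (use assms M.subset M.one_closed N.one_closed in \<open>auto simp: V.submoduleE subset_iff\<close>)
qed

lemma submodule_image:
  assumes "module R V" "module R W" "f \<in> linear_maps R V W" "submodule N R V"
  shows "submodule (f ` N) R W"
proof -
  interpret V: module R V by fact
  interpret W: module R W by fact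
  interpret N: submodule N R V by fact
  note N = V.submoduleE[OF assms(4)]
  show ?thesis
  proof (rule W.submoduleI)
    show "f ` N \<subseteq> carrier W"
      using N(1) linear_maps_closed[OF assms(3)] by blast
    show "\<zero>\<^bsub>W\<^esub> \<in> f ` N"
      using N.one_closed linear_maps_zero[OF assms(1-3)] by force
    show "\<ominus>\<^bsub>W\<^esub> a \<in> f ` N" if "a \<in> f ` N" for a
      using that N(1,3) linear_maps_neg[OF assms(1-3), symmetric] by (auto simp: subset_iff)
    show "a \<oplus>\<^bsub>W\<^esub> b \<in> f ` N" if "a \<in> f ` N" "b \<in> f ` N" for a b
      using that N(1,5) linear_maps_add[OF assms(3), symmetric] by (auto simp: subset_iff)
    show "c \<odot>\<^bsub>W\<^esub> a \<in> f ` N" if "c \<in> carrier R" "a \<in> f ` N" for c a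
      using that N(1,4) linear_maps_smult[OF assms(3), symmetric] by (auto simp: subset_iff)
  qed
qed

lemma linear_maps_inv_into:
  assumes "module R V" "f \<in> linear_maps R V W" "bij_betw f (carrier V) (carrier W)"
  shows "inv_into (carrier V) f \<in> linear_maps R W V"
proof -
  interpret V: module R V by fact
  let ?g = "inv_into (carrier V) f"
  have g: "?g y \<in> carrier V" "f (?g y) = y" if "y \<in> carrier W" for y
    using that assms(3) by (auto simp: bij_betw_def inv_into_into f_inv_into_f)
  have gf: "?g y = x" if "x \<in> carrier V" "y = f x" for x y
    using that assms(3) by (simp add: bij_betw_inv_into_left)
  show ?thesis
    by (rule linear_mapsI; (rule gf)?)
      (use g in \<open>auto simp: linear_maps_add[OF assms(2)] linear_maps_smult[OF assms(2)]\<close>)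
qed

text \<open>The representatives of cycles, the cycles and the numerator of the Schur multiplier are
  modules in which only the carrier has been replaced. The equations for \<open>f\<close> carry
  over, and just the two carriers need attention.\<close>

lemma linear_maps_restrict_carrier:
  "f \<in> linear_maps R V W \<Longrightarrow> U \<subseteq> carrier V \<Longrightarrow> (\<And>x. x \<in> U \<Longrightarrow> f x \<in> U')
    \<Longrightarrow> f \<in> linear_maps R (V\<lparr>carrier := U\<rparr>) (W\<lparr>carrier := U'\<rparr>)"
  by (rule linear_mapsI) (auto intro: linear_maps_add linear_maps_smult)

text \<open>\<open>h\<close> is evaluated at an arbitrary preimage. Two preimages under
  \<open>f\<close> differ by an element of its kernel, which \<open>g\<close> kills. This
  independence of the choice is also what makes \<open>h\<close> linear.\<close>

lemma factor_through_surjection: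
  assumes U: "module R U" and A: "module R A" and B: "module R B"
    and f: "f \<in> linear_maps R U A" and surj: "f ` carrier U = carrier A"
    and g: "g \<in> linear_maps R U B"
    and ker: "\<And>x. x \<in> carrier U \<Longrightarrow> f x = \<zero>\<^bsub>A\<^esub> \<Longrightarrow> g x = \<zero>\<^bsub>B\<^esub>"
  obtains h where "h \<in> linear_maps R A B" "\<And>x. x \<in> carrier U \<Longrightarrow> h (f x) = g x"
proof -
  interpret U: module R U by fact
  interpret A: module R A by fact
  interpret B: module R B by fact
  define h where "h y = g (inv_into (carrier U) f y)" for y
  have hf: "h (f x) = g x" if x: "x \<in> carrier U" for x
  proof -
    let ?x' = "inv_into (carrier U) f (f x)"
    have x': "?x' \<in> carrier U" "f ?x' = f x"
      using x by (auto intro: inv_into_into f_inv_into_f)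
    have "g (?x' \<ominus>\<^bsub>U\<^esub> x) = \<zero>\<^bsub>B\<^esub>"
      using x x' linear_maps_closed[OF f]
      by (intro ker) (auto simp: linear_maps_minus[OF U A f] A.M.minus_eq A.M.r_neg)
    then have "g ?x' \<ominus>\<^bsub>B\<^esub> g x = \<zero>\<^bsub>B\<^esub>"
      using x x' by (simp add: linear_maps_minus[OF U B g])
    then show ?thesis
      using x x' linear_maps_closed[OF g] by (simp add: h_def B.M.minus_eq_zero_iff)
  qed
  have "h \<in> linear_maps R A B"
  proof (rule linear_mapsI)
    fix x y assume "x \<in> carrier A" "y \<in> carrier A"
    then obtain x' y' where "x' \<in> carrier U" "y' \<in> carrier U" "x = f x'" "y = f y'"
      unfolding surj[symmetric] by blast
    then show "h (x \<oplus>\<^bsub>A\<^esub> y) = h x \<oplus>\<^bsub>B\<^esub> h y"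
      using hf[of "x' \<oplus>\<^bsub>U\<^esub> y'"] linear_maps_add[OF f] linear_maps_add[OF g] by (simp add: hf)
  next
    fix x assume "x \<in> carrier A"
    then show "h x \<in> carrier B"
      unfolding surj[symmetric] by (auto simp: hf linear_maps_closed[OF g])
  next
    fix c x assume "c \<in> carrier R" "x \<in> carrier A"
    then obtain x' where "x' \<in> carrier U" "x = f x'"
      unfolding surj[symmetric] by blast
    then show "h (c \<odot>\<^bsub>A\<^esub> x) = c \<odot>\<^bsub>B\<^esub> h x"
      using hf[of "c \<odot>\<^bsub>U\<^esub> x'"] \<open>c \<in> carrier R\<close> linear_maps_smult[OF f] linear_maps_smult[OF g]
      by (simp add: hf)
  qed
  with hf show thesis by (rule that[rotated])
qed

text \<open>Each of the two maps factors through the other because their kernels agree, and the two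
  factors are mutually inverse. Stability of \<open>carrier U\<close> under the twist allows the
  comparison map to be evaluated at the twist of a representative.\<close>

lemma hom_space_iso_of_common_cover:
  assumes U: "module R U" and A: "module R A" and B: "module R B"
    and f: "f \<in> hom_space_morphisms R U A" and f_surj: "f ` carrier U = carrier A"
    and g: "g \<in> hom_space_morphisms R U B" and g_surj: "g ` carrier U = carrier B"
    and ker: "\<And>x. x \<in> carrier U \<Longrightarrow> f x = \<zero>\<^bsub>A\<^esub> \<longleftrightarrow> g x = \<zero>\<^bsub>B\<^esub>"
    and twist: "twist U ` carrier U \<subseteq> carrier U"
  shows "hom_space_iso R A B"
proof -
  interpret U: module R U by fact
  interpret A: module R A by fact
  have f': "f \<in> linear_maps R U A" and g': "g \<in> linear_maps R U B"
    using f g by (auto simp: hom_space_morphisms_def)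
  obtain h where h: "h \<in> linear_maps R A B" and hf: "\<And>x. x \<in> carrier U \<Longrightarrow> h (f x) = g x"
    using factor_through_surjection[OF U A B f' f_surj g'] ker by blast
  obtain k where k: "k \<in> linear_maps R B A" and kg: "\<And>x. x \<in> carrier U \<Longrightarrow> k (g x) = f x"
    using factor_through_surjection[OF U B A g' g_surj f'] ker by blast
  have "h (twist A x) = twist B (h x)" if "x \<in> carrier A" for x
  proof -
    obtain u where u: "u \<in> carrier U" "x = f u"
      using \<open>x \<in> carrier A\<close> unfolding f_surj[symmetric] by blast
    have "twist A x = f (twist U u)" "twist B (g u) = g (twist U u)" "twist U u \<in> carrier U"
      using u f g twist by (auto simp: hom_space_morphisms_def)
    then show ?thesis using u by (simp add: hf)
  qed
  moreover have "bij_betw h (carrier A) (carrier B)"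
    by (rule bij_betw_byWitness[where f' = k])
      (use linear_maps_closed[OF h] linear_maps_closed[OF k] hf kg in
        \<open>auto simp: f_surj[symmetric] g_surj[symmetric]\<close>)
  ultimately show ?thesis
    unfolding hom_space_iso_def hom_space_morphisms_def using h by blast
qed

section \<open>Quotients\<close>

lemma submodule_abelian_subgroup:
  assumes "module R V" "submodule N R V"
  shows "abelian_subgroup N V"
  using assms by (auto intro!: abelian_subgroupI3 additive_subgroupI simp: module_def submodule_def)

lemma coset_eq_iff:
  assumes "module R V" "submodule N R V" "a \<in> carrier V" "b \<in> carrier V"
  shows "N +>\<^bsub>V\<^esub> a = N +>\<^bsub>V\<^esub> b \<longleftrightarrow> a \<ominus>\<^bsub>V\<^esub> b \<in> N"
proof -
  interpret N: abelian_subgroup N V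
    by (rule submodule_abelian_subgroup) fact+
  show ?thesis
    unfolding a_minus_def using assms(3,4) N.a_rcos_module[of b a]
    by (metis N.a_repr_independence' N.a_repr_independenceD)
qed

lemma coset_eq_zero_iff:
  assumes "module R V" "submodule N R V" "a \<in> carrier V"
  shows "N +>\<^bsub>V\<^esub> a = N \<longleftrightarrow> a \<in> N"
proof -
  interpret N: abelian_subgroup N V
    by (rule submodule_abelian_subgroup) fact+
  show ?thesis
    using assms(3) by (metis N.a_rcos_const N.a_rcos_self)
qed

text \<open>By linearity, independence of the representative reduces to \<open>g\<close> mapping
  \<open>N\<close> into \<open>M\<close>; the union in \<open>coset_map\<close> then ranges over
  equal cosets.\<close>

lemma coset_map_coset:
  assumes V: "module R V" and W: "module R W" and N: "submodule N R V" and M: "submodule M R W"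
    and g: "g \<in> linear_maps R V W" and sub: "\<And>x. x \<in> N \<Longrightarrow> g x \<in> M" and a: "a \<in> carrier V"
  shows "coset_map W M g (N +>\<^bsub>V\<^esub> a) = M +>\<^bsub>W\<^esub> g a"
proof -
  interpret N: abelian_subgroup N V by (rule submodule_abelian_subgroup) fact+
  have "M +>\<^bsub>W\<^esub> g b = M +>\<^bsub>W\<^esub> g a" if "b \<in> N +>\<^bsub>V\<^esub> a" for b
  proof -
    have b: "b \<in> carrier V" "b \<ominus>\<^bsub>V\<^esub> a \<in> N"
      using that a N.a_elemrcos_carrier N.a_rcos_module_imp by (auto simp: a_minus_def)
    then have "g b \<ominus>\<^bsub>W\<^esub> g a \<in> M"
      using sub[OF b(2)] a by (simp add: linear_maps_minus[OF V W g])
    then show ?thesis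
      using a b linear_maps_closed[OF g] by (simp add: coset_eq_iff[OF W M])
  qed
  then show ?thesis
    unfolding coset_map_def using N.a_rcos_self[OF a] by blast
qed

lemma hom_quotient_simps:
  "carrier (hom_quotient V N) = (\<lambda>a. N +>\<^bsub>V\<^esub> a) ` carrier V"
  "zero (hom_quotient V N) = N"
  "mult (hom_quotient V N) = rcoset_mult V N"
  "add (hom_quotient V N) = set_add V"
  "smult (hom_quotient V N) c = coset_map V N (\<lambda>a. c \<odot>\<^bsub>V\<^esub> a)"
  "twist (hom_quotient V N) = coset_map V N (twist V)"
  by (auto simp: hom_quotient_def A_RCOSETS_def' a_r_coset_def')

lemma coset_linear:
  assumes "module R V" "submodule N R V"
  shows "(\<lambda>a. N +>\<^bsub>V\<^esub> a) \<in> linear_maps R V (hom_quotient V N)"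
proof -
  interpret V: module R V by fact
  interpret N: abelian_subgroup N V by (rule submodule_abelian_subgroup) fact+
  have "coset_map V N (\<lambda>a. c \<odot>\<^bsub>V\<^esub> a) (N +>\<^bsub>V\<^esub> a) = N +>\<^bsub>V\<^esub> (c \<odot>\<^bsub>V\<^esub> a)"
    if "c \<in> carrier R" "a \<in> carrier V" for c a
    using assms that V.submoduleE(4)[OF assms(2)]
    by (intro coset_map_coset linear_maps_homothety)
  then show ?thesis
    by (intro linear_mapsI) (auto simp: hom_quotient_simps N.a_rcos_sum)
qed

lemma hom_quotient_module:
  assumes "module R V" "submodule N R V"
  shows "module R (hom_quotient V N)"
proof -
  interpret V: module R V by fact
  interpret N: abelian_subgroup N V by (rule submodule_abelian_subgroup) fact+
  let ?Q = "hom_quotient V N" and ?p = "\<lambda>a. N +>\<^bsub>V\<^esub> a"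
  note p = coset_linear[OF assms]
  \<comment> \<open>Read from right to left, linearity of the projection pulls every operation on
    cosets back to representatives, so the module axioms are inherited from
    \<open>V\<close>.\<close>
  note ops = linear_maps_add[OF p, symmetric] linear_maps_smult[OF p, symmetric]
  have z: "\<zero>\<^bsub>?Q\<^esub> = ?p \<zero>\<^bsub>V\<^esub>"
    using N.a_rcos_const[OF N.zero_closed] by (simp add: hom_quotient_simps)
  have car: "carrier ?Q = ?p ` carrier V"
    by (simp add: hom_quotient_simps)
  have "abelian_group ?Q"
  proof (rule abelian_groupI)
    fix A assume "A \<in> carrier ?Q"
    then obtain a where a: "a \<in> carrier V" "A = ?p a" by (auto simp: car)
    then have "?p (\<ominus>\<^bsub>V\<^esub> a) \<oplus>\<^bsub>?Q\<^esub> A = \<zero>\<^bsub>?Q\<^esub>"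
      by (simp add: ops z V.M.l_neg)
    then show "\<exists>B\<in>carrier ?Q. B \<oplus>\<^bsub>?Q\<^esub> A = \<zero>\<^bsub>?Q\<^esub>"
      using a by (auto simp: car)
  qed (auto simp: car ops z V.M.a_ac)
  then show ?thesis
    by (rule moduleI[OF V.R.is_cring])
      (auto simp: car ops V.smult_l_distr V.smult_r_distr V.smult_assoc1)
qed

lemma hom_quotient_twist:
  assumes "module R V" "submodule N R V" "twist V \<in> linear_maps R V V"
    and "\<And>x. x \<in> N \<Longrightarrow> twist V x \<in> N" "a \<in> carrier V"
  shows "twist (hom_quotient V N) (N +>\<^bsub>V\<^esub> a) = N +>\<^bsub>V\<^esub> twist V a"
  unfolding hom_quotient_simps by (rule coset_map_coset) (use assms in auto)

text \<open>A coset is built from the addition alone, which a change of carrier leaves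
  untouched.\<close>

lemma coset_restrict_carrier: "N +>\<^bsub>V\<lparr>carrier := U\<rparr>\<^esub> a = N +>\<^bsub>V\<^esub> a"
  by (simp add: a_r_coset_def')

lemma submodule_restrict_carrier:
  assumes "module R V" "submodule U R V" "submodule N R V" "N \<subseteq> U"
  shows "submodule N R (V\<lparr>carrier := U\<rparr>)"
proof -
  interpret V: module R V by fact
  interpret VU: module R "V\<lparr>carrier := U\<rparr>"
    using submodule.submodule_is_module[OF assms(2,1)] .
  have "module R (V\<lparr>carrier := N\<rparr>)"
    using submodule.submodule_is_module[OF assms(3,1)] .
  then show ?thesis
    using assms(4) by (intro VU.module_incl_imp_submodule) auto
qed

section \<open>Free Hom-vector spaces\<close>

lemma free_hom_space_simps:
  "zero (free_hom_space R S \<sigma>) = (\<lambda>s. \<zero>\<^bsub>R\<^esub>)"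
  "add (free_hom_space R S \<sigma>) f g = (\<lambda>s. f s \<oplus>\<^bsub>R\<^esub> g s)"
  "smult (free_hom_space R S \<sigma>) c f = (\<lambda>s. c \<otimes>\<^bsub>R\<^esub> f s)"
  "twist (free_hom_space R S \<sigma>) f = (\<lambda>t. finsum R f {s. f s \<noteq> \<zero>\<^bsub>R\<^esub> \<and> \<sigma> s = t})"
  by (simp_all add: free_hom_space_def)

lemma free_hom_space_carrier_iff:
  "f \<in> carrier (free_hom_space R S \<sigma>) \<longleftrightarrow>
    (\<forall>s. f s \<in> carrier R) \<and> finite {s. f s \<noteq> \<zero>\<^bsub>R\<^esub>} \<and> (\<forall>s. f s \<noteq> \<zero>\<^bsub>R\<^esub> \<longrightarrow> s \<in> S)"
  by (auto simp: free_hom_space_def)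

lemma basis_vector_closed:
  assumes "field R" "s \<in> S"
  shows "basis_vector R s \<in> carrier (free_hom_space R S \<sigma>)"
proof -
  interpret field R by fact
  have "finite {t. basis_vector R s t \<noteq> \<zero>\<^bsub>R\<^esub>}"
    by (rule finite_subset[of _ "{s}"]) (auto simp: basis_vector_def)
  then show ?thesis
    using assms(2) by (auto simp: free_hom_space_carrier_iff basis_vector_def)
qed

text \<open>Coefficients are split off one at a time, by induction on a finite set that contains the
  support.\<close>

lemma free_hom_space_spanned:
  assumes "field R" and U: "submodule U R (free_hom_space R S \<sigma>)"
    and basis: "\<And>s. s \<in> S \<Longrightarrow> basis_vector R s \<in> U"
    and f: "f \<in> carrier (free_hom_space R S \<sigma>)"
  shows "f \<in> U"
proof -
  interpret field R by fact
  let ?V = "free_hom_space R S \<sigma>"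
  interpret V: module R ?V by (rule free_hom_space_module) fact
  note Uc = V.submoduleE[OF U]
  have zero: "\<zero>\<^bsub>?V\<^esub> \<in> U"
    using subgroup.one_closed[OF submodule.axioms(1)[OF U]] by simp
  have "f \<in> U" if "finite B" "f \<in> carrier ?V" "{s. f s \<noteq> \<zero>\<^bsub>R\<^esub>} \<subseteq> B" for B f
    using that
  proof (induction B arbitrary: f)
    case empty
    then have "f = \<zero>\<^bsub>?V\<^esub>" by (auto simp: free_hom_space_simps)
    then show ?case using zero by simp
  next
    case (insert s B)
    let ?f' = "f(s := \<zero>\<^bsub>R\<^esub>)"
    have fR: "f t \<in> carrier R" for t
      using insert.prems by (simp add: free_hom_space_carrier_iff)
    have "finite {t. ?f' t \<noteq> \<zero>\<^bsub>R\<^esub>}"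
      by (rule finite_subset[OF _ insert.hyps(1)]) (use insert.prems in auto)
    then have "?f' \<in> U"
      using insert.prems by (intro insert.IH) (auto simp: free_hom_space_carrier_iff)
    show ?case
    proof (cases "s \<in> S")
      case True
      have "f = f s \<odot>\<^bsub>?V\<^esub> basis_vector R s \<oplus>\<^bsub>?V\<^esub> ?f'"
        using fR by (auto simp: free_hom_space_simps basis_vector_def)
      then show ?thesis
        using Uc(4)[OF fR basis[OF True]] Uc(5) \<open>?f' \<in> U\<close> by metis
    next
      \<comment> \<open>\<open>B\<close> may contain points outside \<open>S\<close>. There the
        coefficient of \<open>f\<close> is already zero, so resetting it changes nothing.\<close>
      case False
      then have "?f' = f"
        using insert.prems by (intro fun_upd_idem) (auto simp: free_hom_space_carrier_iff)
      then show ?thesis using \<open>?f' \<in> U\<close> by simp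
    qed
  qed
  from this[OF _ f order_refl] f show ?thesis
    by (simp add: free_hom_space_carrier_iff)
qed

lemma free_hom_space_maps_eqI:
  assumes "field R" "module R W" "g \<in> linear_maps R (free_hom_space R S \<sigma>) W"
    "h \<in> linear_maps R (free_hom_space R S \<sigma>) W"
    and "\<And>s. s \<in> S \<Longrightarrow> g (basis_vector R s) = h (basis_vector R s)"
    and "f \<in> carrier (free_hom_space R S \<sigma>)"
  shows "g f = h f"
  using free_hom_space_spanned[OF assms(1) submodule_equalizer[OF
      free_hom_space_module[OF assms(1)] assms(2-4)]] assms(6)
  by (simp add: assms(1,5) basis_vector_closed)

text \<open>The supports of two vectors and of their sum usually differ. A larger finite index set
  within \<open>S\<close> serves all three at once, and additivity becomes termwise.\<close>

lemma linear_extension_superset: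
  assumes "module R V" "g ` S \<subseteq> carrier V" "f \<in> carrier (free_hom_space R S \<sigma>)"
    and "finite B" "{s. f s \<noteq> \<zero>\<^bsub>R\<^esub>} \<subseteq> B" "B \<subseteq> S"
  shows "linear_extension R V g f = (\<Oplus>\<^bsub>V\<^esub>s\<in>B. f s \<odot>\<^bsub>V\<^esub> g s)"
proof -
  interpret V: module R V by fact
  show ?thesis
    unfolding linear_extension_def
    by (rule V.M.add.finprod_mono_neutral_cong_left)
      (use assms in \<open>auto simp: free_hom_space_carrier_iff subset_iff image_subset_iff\<close>)
qed

lemma linear_extension_linear:
  assumes R: "field R" and V: "module R V" and g: "g ` S \<subseteq> carrier V"
  shows "linear_extension R V g \<in> linear_maps R (free_hom_space R S \<sigma>) V"
proof -
  interpret field R by fact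
  interpret V: module R V by fact
  let ?F = "free_hom_space R S \<sigma>"
  interpret F: module R ?F by (rule free_hom_space_module) fact
  note ext = linear_extension_superset[OF V g, where \<sigma> = \<sigma>]
  have c: "(\<lambda>s. f s \<odot>\<^bsub>V\<^esub> g s) \<in> B \<rightarrow> carrier V" if "f \<in> carrier ?F" "B \<subseteq> S" for f B
    using that g by (auto simp: free_hom_space_carrier_iff)
  show ?thesis
  proof (rule linear_mapsI)
    fix f assume f: "f \<in> carrier ?F"
    then show "linear_extension R V g f \<in> carrier V"
      unfolding linear_extension_def
      by (intro V.M.finsum_closed c) (auto simp: free_hom_space_carrier_iff)
  next
    fix f h assume fh: "f \<in> carrier ?F" "h \<in> carrier ?F"
    let ?B = "{s. f s \<noteq> \<zero>\<^bsub>R\<^esub>} \<union> {s. h s \<noteq> \<zero>\<^bsub>R\<^esub>}"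
    have B: "finite ?B" "?B \<subseteq> S" "{s. (f \<oplus>\<^bsub>?F\<^esub> h) s \<noteq> \<zero>\<^bsub>R\<^esub>} \<subseteq> ?B"
      using fh by (auto simp: free_hom_space_carrier_iff free_hom_space_simps)
    have "(\<Oplus>\<^bsub>V\<^esub>s\<in>?B. (f \<oplus>\<^bsub>?F\<^esub> h) s \<odot>\<^bsub>V\<^esub> g s) = (\<Oplus>\<^bsub>V\<^esub>s\<in>?B. f s \<odot>\<^bsub>V\<^esub> g s \<oplus>\<^bsub>V\<^esub> h s \<odot>\<^bsub>V\<^esub> g s)"
      by (rule V.M.finsum_cong')
        (use fh B g in \<open>auto simp: free_hom_space_carrier_iff free_hom_space_simps
          intro!: V.smult_l_distr V.M.a_closed V.smult_closed\<close>)
    also have "\<dots> = (\<Oplus>\<^bsub>V\<^esub>s\<in>?B. f s \<odot>\<^bsub>V\<^esub> g s) \<oplus>\<^bsub>V\<^esub> (\<Oplus>\<^bsub>V\<^esub>s\<in>?B. h s \<odot>\<^bsub>V\<^esub> g s)"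
      using fh B by (intro V.M.finsum_addf c)
    finally show "linear_extension R V g (f \<oplus>\<^bsub>?F\<^esub> h)
      = linear_extension R V g f \<oplus>\<^bsub>V\<^esub> linear_extension R V g h"
      using fh B by (simp add: ext[where B = ?B])
  next
    fix a f assume a: "a \<in> carrier R" and f: "f \<in> carrier ?F"
    let ?B = "{s. f s \<noteq> \<zero>\<^bsub>R\<^esub>}"
    have B: "finite ?B" "?B \<subseteq> S" "{s. (a \<odot>\<^bsub>?F\<^esub> f) s \<noteq> \<zero>\<^bsub>R\<^esub>} \<subseteq> ?B"
      using a f by (auto simp: free_hom_space_carrier_iff free_hom_space_simps)
    have "(\<Oplus>\<^bsub>V\<^esub>s\<in>?B. (a \<odot>\<^bsub>?F\<^esub> f) s \<odot>\<^bsub>V\<^esub> g s) = (\<Oplus>\<^bsub>V\<^esub>s\<in>?B. a \<odot>\<^bsub>V\<^esub> (f s \<odot>\<^bsub>V\<^esub> g s))"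
      by (rule V.M.finsum_cong')
        (use a f B g in \<open>auto simp: free_hom_space_carrier_iff free_hom_space_simps
          intro!: V.smult_assoc1 V.smult_closed\<close>)
    also have "\<dots> = a \<odot>\<^bsub>V\<^esub> (\<Oplus>\<^bsub>V\<^esub>s\<in>?B. f s \<odot>\<^bsub>V\<^esub> g s)"
      using a f B by (intro V.finsum_smult_ldistr[symmetric] c)
    finally show "linear_extension R V g (a \<odot>\<^bsub>?F\<^esub> f) = a \<odot>\<^bsub>V\<^esub> linear_extension R V g f"
      using a f B by (simp add: ext[where B = ?B])
  qed
qed

lemma linear_extension_basis_vector:
  assumes "field R" "module R V" "g s \<in> carrier V"
  shows "linear_extension R V g (basis_vector R s) = g s"
proof -
  interpret field R by fact
  interpret V: module R V by fact
  have "{t. basis_vector R s t \<noteq> \<zero>\<^bsub>R\<^esub>} = {s}"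
    by (auto simp: basis_vector_def)
  then show ?thesis
    using assms(3) by (simp add: linear_extension_def V.M.finsum_insert basis_vector_def)
qed

lemma free_hom_space_twist_superset:
  assumes "field R" "f \<in> carrier (free_hom_space R S \<sigma>)"
    and "finite B" "{s. f s \<noteq> \<zero>\<^bsub>R\<^esub>} \<subseteq> B"
  shows "twist (free_hom_space R S \<sigma>) f t = finsum R f {s \<in> B. \<sigma> s = t}"
proof -
  interpret field R by fact
  show ?thesis
    unfolding free_hom_space_simps
    by (rule add.finprod_mono_neutral_cong_left)
      (use assms in \<open>auto simp: free_hom_space_carrier_iff\<close>)
qed

lemma free_hom_space_twist_linear:
  assumes "field R" and "\<sigma> ` S \<subseteq> S"
  shows "twist (free_hom_space R S \<sigma>) \<in> linear_maps R (free_hom_space R S \<sigma>) (free_hom_space R S \<sigma>)"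
proof -
  interpret field R by fact
  let ?F = "free_hom_space R S \<sigma>"
  interpret F: module R ?F by (rule free_hom_space_module) fact
  note tw = free_hom_space_twist_superset[OF assms(1)]
  have c: "f \<in> B \<rightarrow> carrier R" if "f \<in> carrier ?F" for f B
    using that by (auto simp: free_hom_space_carrier_iff)
  show ?thesis
  proof (rule linear_mapsI)
    fix f assume f: "f \<in> carrier ?F"
    let ?B = "{s. f s \<noteq> \<zero>\<^bsub>R\<^esub>}"
    \<comment> \<open>Coefficients of points with the same image under \<open>\<sigma>\<close> may
      cancel, so the new support is only contained in the image of the old one.\<close>
    have sub: "t \<in> \<sigma> ` ?B" if "twist ?F f t \<noteq> \<zero>\<^bsub>R\<^esub>" for t
    proof (rule ccontr)
      assume "t \<notin> \<sigma> ` ?B"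
      then have "{s. f s \<noteq> \<zero>\<^bsub>R\<^esub> \<and> \<sigma> s = t} = {}" by auto
      then show False using that unfolding free_hom_space_simps by (simp only: finsum_empty) simp
    qed
    then have "finite {t. twist ?F f t \<noteq> \<zero>\<^bsub>R\<^esub>}"
      using f finite_subset[of "{t. twist ?F f t \<noteq> \<zero>\<^bsub>R\<^esub>}" "\<sigma> ` ?B"]
      by (auto simp: free_hom_space_carrier_iff[of f])
    moreover have "twist ?F f t \<in> carrier R" for t
      unfolding free_hom_space_simps by (rule finsum_closed[OF c[OF f]])
    ultimately show "twist ?F f \<in> carrier ?F"
      using f sub assms(2) by (fastforce simp: free_hom_space_carrier_iff[of "twist _ _"] free_hom_space_carrier_iff[of f])
  next
    fix f h assume fh: "f \<in> carrier ?F" "h \<in> carrier ?F"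
    let ?B = "{s. f s \<noteq> \<zero>\<^bsub>R\<^esub>} \<union> {s. h s \<noteq> \<zero>\<^bsub>R\<^esub>}"
    have B: "finite ?B" "{s. (f \<oplus>\<^bsub>?F\<^esub> h) s \<noteq> \<zero>\<^bsub>R\<^esub>} \<subseteq> ?B"
      using fh by (auto simp: free_hom_space_carrier_iff free_hom_space_simps)
    have "twist ?F (f \<oplus>\<^bsub>?F\<^esub> h) t = twist ?F f t \<oplus>\<^bsub>R\<^esub> twist ?F h t" for t
      using fh B finsum_addf[OF c[OF fh(1)] c[OF fh(2)], of "{s \<in> ?B. \<sigma> s = t}"]
      by (simp add: tw[where B = ?B]) (simp add: free_hom_space_simps)
    then show "twist ?F (f \<oplus>\<^bsub>?F\<^esub> h) = twist ?F f \<oplus>\<^bsub>?F\<^esub> twist ?F h"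
      by (auto simp: free_hom_space_simps(2))
  next
    fix a f assume a: "a \<in> carrier R" and f: "f \<in> carrier ?F"
    let ?B = "{s. f s \<noteq> \<zero>\<^bsub>R\<^esub>}"
    have B: "finite ?B" "{s. (a \<odot>\<^bsub>?F\<^esub> f) s \<noteq> \<zero>\<^bsub>R\<^esub>} \<subseteq> ?B"
      using a f by (auto simp: free_hom_space_carrier_iff free_hom_space_simps)
    have "twist ?F (a \<odot>\<^bsub>?F\<^esub> f) t = a \<otimes>\<^bsub>R\<^esub> twist ?F f t" for t
      using f a B finsum_rdistr[OF _ a c[OF f], of "{s \<in> ?B. \<sigma> s = t}"]
      by (simp add: tw[where B = ?B]) (simp add: free_hom_space_simps)
    then show "twist ?F (a \<odot>\<^bsub>?F\<^esub> f) = a \<odot>\<^bsub>?F\<^esub> twist ?F f"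
      by (auto simp: free_hom_space_simps(3))
  qed
qed

lemma free_hom_space_twist_basis_vector:
  assumes "field R"
  shows "twist (free_hom_space R S \<sigma>) (basis_vector R s) = basis_vector R (\<sigma> s)"
proof
  fix t
  interpret field R by fact
  have "{s'. basis_vector R s s' \<noteq> \<zero>\<^bsub>R\<^esub> \<and> \<sigma> s' = t} = (if \<sigma> s = t then {s} else {})"
    by (auto simp: basis_vector_def)
  then show "twist (free_hom_space R S \<sigma>) (basis_vector R s) t = basis_vector R (\<sigma> s) t"
    by (simp add: free_hom_space_simps(4) basis_vector_def)
qed

section \<open>Exterior powers and the boundary map\<close>

context hom_lie_algebra
begin

abbreviation tuples where "tuples n \<equiv> tuple_space R L n"

abbreviation relations where "relations n \<equiv> exterior_relations R L n"

abbreviation wedge where "wedge n xs \<equiv> relations n +>\<^bsub>tuples n\<^esub> basis_vector R xs"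

text \<open>The boundary map before division by \<open>relations\<close>. It is tied to
  \<open>boundary_map\<close> by \<open>boundary_map_projection\<close>, so that calculations can be
  done with formal combinations of tuples.\<close>

definition boundary
  where "boundary n = linear_extension R (tuples (n - 1)) (tuple_boundary R L n)"

lemma field: "field R" ..

lemma module_L: "module R L" ..

lemma twist_closed: "x \<in> carrier L \<Longrightarrow> twist L x \<in> carrier L"
  by (rule linear_maps_closed[OF twist_linear])

lemma tuples_module: "module R (tuples n)"
  unfolding tuple_space_def by (rule free_hom_space_module[OF field])

lemma basis_vector_tuples:
  "length xs = n \<Longrightarrow> set xs \<subseteq> carrier L \<Longrightarrow> basis_vector R xs \<in> carrier (tuples n)"
  unfolding tuple_space_def by (rule basis_vector_closed[OF field]) auto

lemma tuples_spanned:
  assumes "submodule U R (tuples n)"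
    and "\<And>xs. length xs = n \<Longrightarrow> set xs \<subseteq> carrier L \<Longrightarrow> basis_vector R xs \<in> U"
    and "t \<in> carrier (tuples n)"
  shows "t \<in> U"
  using free_hom_space_spanned[OF field assms(1)[unfolded tuple_space_def] _
      assms(3)[unfolded tuple_space_def]] assms(2) by blast

lemma tuples_maps_eqI:
  assumes "module R W" "g \<in> linear_maps R (tuples n) W" "h \<in> linear_maps R (tuples n) W"
    and "\<And>xs. length xs = n \<Longrightarrow> set xs \<subseteq> carrier L \<Longrightarrow> g (basis_vector R xs) = h (basis_vector R xs)"
    and "t \<in> carrier (tuples n)"
  shows "g t = h t"
  using free_hom_space_maps_eqI[OF field assms(1) assms(2,3)[unfolded tuple_space_def] _
      assms(5)[unfolded tuple_space_def]] assms(4) by blast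

lemma tuples_extension_linear:
  assumes "module R V" "\<And>xs. length xs = n \<Longrightarrow> set xs \<subseteq> carrier L \<Longrightarrow> g xs \<in> carrier V"
  shows "linear_extension R V g \<in> linear_maps R (tuples n) V"
  unfolding tuple_space_def by (rule linear_extension_linear[OF field]) (use assms in auto)

lemma twist_tuples_linear: "twist (tuples n) \<in> linear_maps R (tuples n) (tuples n)"
  unfolding tuple_space_def
  by (rule free_hom_space_twist_linear[OF field]) (auto simp: twist_closed subset_iff)

lemma twist_tuples_basis_vector:
  "twist (tuples n) (basis_vector R xs) = basis_vector R (map (twist L) xs)"
  unfolding tuple_space_def by (rule free_hom_space_twist_basis_vector[OF field])

lemma generators_closed:
  "multilinear_relations R L n \<union> skew_relations R L n \<subseteq> carrier (tuples n)"
proof -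
  interpret T: module R "tuples n" by (rule tuples_module)
  have upd: "basis_vector R (xs[i := a]) \<in> carrier (tuples n)"
    if "length xs = n" "set xs \<subseteq> carrier L" "a \<in> carrier L" for xs i a
    using that set_update_subset_insert[of xs i a] by (intro basis_vector_tuples) auto
  have upd2: "basis_vector R (xs[i := xs ! j, j := xs ! i]) \<in> carrier (tuples n)"
    if "length xs = n" "set xs \<subseteq> carrier L" "i < j" "j < n" for xs i j
    using that set_update_subset_insert[of xs i "xs ! j"]
    by (intro upd) (auto simp: subset_iff)
  show ?thesis
  proof
    fix t assume t: "t \<in> multilinear_relations R L n \<union> skew_relations R L n"
    have c1: "basis_vector R (xs[i := a \<oplus>\<^bsub>L\<^esub> b]) \<ominus>\<^bsub>tuples n\<^esub>
       (basis_vector R (xs[i := a]) \<oplus>\<^bsub>tuples n\<^esub> basis_vector R (xs[i := b])) \<in> carrier (tuples n)"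
      if "length xs = n" "set xs \<subseteq> carrier L" "a \<in> carrier L" "b \<in> carrier L" for xs i a b
      using that by (intro T.M.minus_closed T.M.a_closed upd M.a_closed)
    have c2: "basis_vector R (xs[i := c \<odot>\<^bsub>L\<^esub> a]) \<ominus>\<^bsub>tuples n\<^esub>
       (c \<odot>\<^bsub>tuples n\<^esub> basis_vector R (xs[i := a])) \<in> carrier (tuples n)"
      if "length xs = n" "set xs \<subseteq> carrier L" "c \<in> carrier R" "a \<in> carrier L" for xs i a c
      using that by (intro T.M.minus_closed T.smult_closed upd smult_closed)
    have c3: "basis_vector R xs \<oplus>\<^bsub>tuples n\<^esub>
        basis_vector R (xs[i := xs ! j, j := xs ! i]) \<in> carrier (tuples n)"
      if "length xs = n" "set xs \<subseteq> carrier L" "i < j" "j < n" for xs i j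
      using that by (intro T.M.a_closed upd2 basis_vector_tuples)
    show "t \<in> carrier (tuples n)"
      using t unfolding multilinear_relations_def skew_relations_def
      by (elim UnE CollectE exE conjE) (simp_all only: c1 c2 c3)
  qed
qed

lemma relations_submodule: "submodule (relations n) R (tuples n)"
  unfolding exterior_relations_def
  by (rule submodule_linear_span[OF tuples_module generators_closed])

lemma exterior_power_module: "module R (exterior_power R L n)"
  unfolding exterior_power_def by (rule hom_quotient_module[OF tuples_module relations_submodule])

lemma exterior_power_carrier:
  "carrier (exterior_power R L n) = (\<lambda>t. relations n +>\<^bsub>tuples n\<^esub> t) ` carrier (tuples n)"
  by (simp add: exterior_power_def hom_quotient_simps)

lemma projection_linear:
  "(\<lambda>t. relations n +>\<^bsub>tuples n\<^esub> t) \<in> linear_maps R (tuples n) (exterior_power R L n)"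
  unfolding exterior_power_def by (rule coset_linear[OF tuples_module relations_submodule])

lemma projection_eq_iff:
  "s \<in> carrier (tuples n) \<Longrightarrow> t \<in> carrier (tuples n) \<Longrightarrow>
    relations n +>\<^bsub>tuples n\<^esub> s = relations n +>\<^bsub>tuples n\<^esub> t \<longleftrightarrow> s \<ominus>\<^bsub>tuples n\<^esub> t \<in> relations n"
  by (rule coset_eq_iff[OF tuples_module relations_submodule])

lemma projection_eq_zero_iff:
  "t \<in> carrier (tuples n) \<Longrightarrow>
    relations n +>\<^bsub>tuples n\<^esub> t = \<zero>\<^bsub>exterior_power R L n\<^esub> \<longleftrightarrow> t \<in> relations n"
  by (simp add: exterior_power_def hom_quotient_simps
      coset_eq_zero_iff[OF tuples_module relations_submodule])

text \<open>Universal property of the exterior power: such a \<open>g\<close> descends to the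
  quotient. Its kernel is a submodule, so only the generators of \<open>relations n\<close> have to
  be tested.\<close>

lemma relations_vanish:
  assumes W: "module R W" and g: "g \<in> linear_maps R (tuples n) W"
    and add: "\<And>xs i a b. \<lbrakk>length xs = n; set xs \<subseteq> carrier L; i < n; a \<in> carrier L; b \<in> carrier L\<rbrakk>
      \<Longrightarrow> g (basis_vector R (xs[i := a \<oplus>\<^bsub>L\<^esub> b]))
        = g (basis_vector R (xs[i := a])) \<oplus>\<^bsub>W\<^esub> g (basis_vector R (xs[i := b]))"
    and smult: "\<And>xs i c a. \<lbrakk>length xs = n; set xs \<subseteq> carrier L; i < n; c \<in> carrier R; a \<in> carrier L\<rbrakk>
      \<Longrightarrow> g (basis_vector R (xs[i := c \<odot>\<^bsub>L\<^esub> a])) = c \<odot>\<^bsub>W\<^esub> g (basis_vector R (xs[i := a]))"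
    and skew: "\<And>xs i j. \<lbrakk>length xs = n; set xs \<subseteq> carrier L; i < j; j < n\<rbrakk>
      \<Longrightarrow> g (basis_vector R xs) \<oplus>\<^bsub>W\<^esub> g (basis_vector R (xs[i := xs ! j, j := xs ! i])) = \<zero>\<^bsub>W\<^esub>"
    and t: "t \<in> relations n"
  shows "g t = \<zero>\<^bsub>W\<^esub>"
proof -
  interpret T: module R "tuples n" by (rule tuples_module)
  interpret W: module R W by fact
  have upd: "basis_vector R (xs[i := a]) \<in> carrier (tuples n)"
    if "length xs = n" "set xs \<subseteq> carrier L" "a \<in> carrier L" for xs i a
    using that set_update_subset_insert[of xs i a] by (intro basis_vector_tuples) auto
  have upd2: "basis_vector R (xs[i := xs ! j, j := xs ! i]) \<in> carrier (tuples n)"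
    if "length xs = n" "set xs \<subseteq> carrier L" "i < j" "j < n" for xs i j
    using that set_update_subset_insert[of xs i "xs ! j"]
    by (intro upd) (auto simp: subset_iff)
  have "multilinear_relations R L n \<union> skew_relations R L n
      \<subseteq> {t \<in> carrier (tuples n). g t = \<zero>\<^bsub>W\<^esub>}" (is "?G \<subseteq> ?K")
  proof
    fix t assume t: "t \<in> ?G"
    then have tc: "t \<in> carrier (tuples n)" using generators_closed by blast
    have v1: "g (basis_vector R (xs[i := a \<oplus>\<^bsub>L\<^esub> b]) \<ominus>\<^bsub>tuples n\<^esub>
       (basis_vector R (xs[i := a]) \<oplus>\<^bsub>tuples n\<^esub> basis_vector R (xs[i := b]))) = \<zero>\<^bsub>W\<^esub>"
      if "length xs = n" "set xs \<subseteq> carrier L" "i < n" "a \<in> carrier L" "b \<in> carrier L" for xs i a b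
      using that add[OF that] by (simp add: linear_maps_minus[OF tuples_module W g]
          linear_maps_add[OF g] upd linear_maps_closed[OF g] W.M.minus_eq_zero_iff)
    have v2: "g (basis_vector R (xs[i := c \<odot>\<^bsub>L\<^esub> a]) \<ominus>\<^bsub>tuples n\<^esub>
       (c \<odot>\<^bsub>tuples n\<^esub> basis_vector R (xs[i := a]))) = \<zero>\<^bsub>W\<^esub>"
      if "length xs = n" "set xs \<subseteq> carrier L" "i < n" "c \<in> carrier R" "a \<in> carrier L" for xs i a c
      using that smult[OF that] by (simp add: linear_maps_minus[OF tuples_module W g]
          linear_maps_smult[OF g] upd linear_maps_closed[OF g] W.M.minus_eq_zero_iff)
    have v3: "g (basis_vector R xs \<oplus>\<^bsub>tuples n\<^esub>
        basis_vector R (xs[i := xs ! j, j := xs ! i])) = \<zero>\<^bsub>W\<^esub>"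
      if "length xs = n" "set xs \<subseteq> carrier L" "i < j" "j < n" for xs i j
      using that skew[OF that] by (simp add: linear_maps_add[OF g] upd2 basis_vector_tuples)
    have "g t = \<zero>\<^bsub>W\<^esub>"
      using t unfolding multilinear_relations_def skew_relations_def
      by (elim UnE CollectE exE conjE) (simp_all only: v1 v2 v3)
    with tc show "t \<in> ?K" by simp
  qed
  then have "relations n \<subseteq> ?K"
    unfolding exterior_relations_def
    by (rule linear_span_minimal[OF submodule_kernel[OF tuples_module W g]])
  then show ?thesis using t by blast
qed

lemma wedge_closed:
  "length xs = n \<Longrightarrow> set xs \<subseteq> carrier L \<Longrightarrow> wedge n xs \<in> carrier (exterior_power R L n)"
  using linear_maps_closed[OF projection_linear] basis_vector_tuples by blast

lemma
  assumes "length xs = n" "set xs \<subseteq> carrier L" "i < n" "a \<in> carrier L"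
  shows wedge_add: "b \<in> carrier L \<Longrightarrow> wedge n (xs[i := a \<oplus>\<^bsub>L\<^esub> b])
      = wedge n (xs[i := a]) \<oplus>\<^bsub>exterior_power R L n\<^esub> wedge n (xs[i := b])"
    and wedge_smult: "c \<in> carrier R \<Longrightarrow> wedge n (xs[i := c \<odot>\<^bsub>L\<^esub> a])
      = c \<odot>\<^bsub>exterior_power R L n\<^esub> wedge n (xs[i := a])"
proof -
  interpret T: module R "tuples n" by (rule tuples_module)
  have upd: "basis_vector R (xs[i := a]) \<in> carrier (tuples n)" if "a \<in> carrier L" for a
    using that assms set_update_subset_insert[of xs i a] by (intro basis_vector_tuples) auto
  note rel = linear_span_superset[of "multilinear_relations R L n \<union> skew_relations R L n" R "tuples n",
      folded exterior_relations_def]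
  show "wedge n (xs[i := a \<oplus>\<^bsub>L\<^esub> b])
      = wedge n (xs[i := a]) \<oplus>\<^bsub>exterior_power R L n\<^esub> wedge n (xs[i := b])" if "b \<in> carrier L"
  proof -
    have "basis_vector R (xs[i := a \<oplus>\<^bsub>L\<^esub> b]) \<ominus>\<^bsub>tuples n\<^esub>
       (basis_vector R (xs[i := a]) \<oplus>\<^bsub>tuples n\<^esub> basis_vector R (xs[i := b])) \<in> multilinear_relations R L n"
      unfolding multilinear_relations_def using assms that by blast
    then show ?thesis
      using assms(4) that rel
      by (subst linear_maps_add[OF projection_linear, symmetric]; (intro upd)?)
        (auto simp: projection_eq_iff upd)
  qed
  show "wedge n (xs[i := c \<odot>\<^bsub>L\<^esub> a]) = c \<odot>\<^bsub>exterior_power R L n\<^esub> wedge n (xs[i := a])"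
    if "c \<in> carrier R"
  proof -
    have "basis_vector R (xs[i := c \<odot>\<^bsub>L\<^esub> a]) \<ominus>\<^bsub>tuples n\<^esub>
       (c \<odot>\<^bsub>tuples n\<^esub> basis_vector R (xs[i := a])) \<in> multilinear_relations R L n"
      unfolding multilinear_relations_def using assms that by blast
    then show ?thesis
      using assms(4) that rel
      by (subst linear_maps_smult[OF projection_linear, symmetric]; (intro upd)?)
        (auto simp: projection_eq_iff upd)
  qed
qed

lemma wedge_skew:
  assumes "length xs = n" "set xs \<subseteq> carrier L" "i < j" "j < n"
  shows "wedge n (xs[i := xs ! j, j := xs ! i]) = \<ominus>\<^bsub>exterior_power R L n\<^esub> wedge n xs"
proof -
  interpret T: module R "tuples n" by (rule tuples_module)
  interpret E: module R "exterior_power R L n" by (rule exterior_power_module)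
  have "set (xs[i := xs ! j, j := xs ! i]) \<subseteq> carrier L"
    using assms by (auto simp: set_swap)
  then have c: "basis_vector R xs \<in> carrier (tuples n)"
      "basis_vector R (xs[i := xs ! j, j := xs ! i]) \<in> carrier (tuples n)"
    using assms by (auto intro!: basis_vector_tuples)
  have "basis_vector R xs \<oplus>\<^bsub>tuples n\<^esub> basis_vector R (xs[i := xs ! j, j := xs ! i])
      \<in> skew_relations R L n"
    unfolding skew_relations_def using assms by blast
  then have "wedge n (xs[i := xs ! j, j := xs ! i]) \<oplus>\<^bsub>exterior_power R L n\<^esub> wedge n xs
      = \<zero>\<^bsub>exterior_power R L n\<^esub>"
    using c linear_span_superset[of "multilinear_relations R L n \<union> skew_relations R L n" R "tuples n",
      folded exterior_relations_def]
    by (subst linear_maps_add[OF projection_linear, symmetric])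
      (auto simp: projection_eq_zero_iff T.M.a_comm)
  then show ?thesis
    using c linear_maps_closed[OF projection_linear] by (simp add: E.M.minus_equality)
qed

lemma boundary_linear:
  assumes "1 \<le> n"
  shows "boundary n \<in> linear_maps R (tuples n) (tuples (n - 1))"
    and "\<lbrakk>length xs = n; set xs \<subseteq> carrier L\<rbrakk>
      \<Longrightarrow> boundary n (basis_vector R xs) = tuple_boundary R L n xs"
proof -
  interpret T: module R "tuples (n - 1)" by (rule tuples_module)
  have *: "tuple_boundary R L n xs \<in> carrier (tuples (n - 1))"
    if "length xs = n" "set xs \<subseteq> carrier L" for xs
  proof -
    have "basis_vector R ((xs ! i \<otimes>\<^bsub>L\<^esub> xs ! j) # map (twist L) (nths xs (- {i, j})))
        \<in> carrier (tuples (n - 1))" if "i < j" "j < n" for i j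
    proof (rule basis_vector_tuples)
      \<comment> \<open>Deleting two entries leaves \<open>n - 2\<close>, and the bracket in front
        brings the length to \<open>n - 1\<close>. From \<open>i < j\<close> and
        \<open>j < n\<close> it follows that \<open>n\<close> is at least 2, so truncated
        subtraction is harmless.\<close>
      have "{k. k < n \<and> (k \<noteq> i \<and> k \<noteq> j)} = {..<n} - {i, j}" by auto
      also have "card \<dots> = n - 2" using that by (subst card_Diff_subset) auto
      finally show "length ((xs ! i \<otimes>\<^bsub>L\<^esub> xs ! j) # map (twist L) (nths xs (- {i, j}))) = n - 1"
        using that \<open>length xs = n\<close> by (simp add: length_nths)
      have "xs ! i \<in> carrier L" "xs ! j \<in> carrier L"
        using that \<open>length xs = n\<close> \<open>set xs \<subseteq> carrier L\<close> by auto
      then show "set ((xs ! i \<otimes>\<^bsub>L\<^esub> xs ! j) # map (twist L) (nths xs (- {i, j}))) \<subseteq> carrier L"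
        using \<open>set xs \<subseteq> carrier L\<close> bracket_closed twist_closed by (auto dest: in_set_nthsD)
    qed
    then show ?thesis
      unfolding tuple_boundary_def
      by (intro T.M.finsum_closed Pi_I)
        (clarsimp intro!: T.smult_closed simp del: One_nat_def)
  qed
  show "boundary n \<in> linear_maps R (tuples n) (tuples (n - 1))"
    unfolding boundary_def using * by (rule tuples_extension_linear[OF tuples_module])
  show "boundary n (basis_vector R xs) = tuple_boundary R L n xs"
    if "length xs = n" "set xs \<subseteq> carrier L"
    unfolding boundary_def using *[OF that] by (rule linear_extension_basis_vector[OF field tuples_module])
qed

text \<open>The only pair of positions is (0, 1), with odd sum; hence the minus sign.\<close>

lemma boundary_2:
  assumes "x \<in> carrier L" "y \<in> carrier L"
  shows "boundary 2 (basis_vector R [x, y]) = \<ominus>\<^bsub>tuples 1\<^esub> basis_vector R [x \<otimes>\<^bsub>L\<^esub> y]"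
proof -
  interpret T: module R "tuples 1" by (rule tuples_module)
  let ?f = "\<lambda>(i, j). \<ominus>\<^bsub>R\<^esub> \<one>\<^bsub>R\<^esub> [^]\<^bsub>R\<^esub> (i + j) \<odot>\<^bsub>tuples 1\<^esub>
    basis_vector R (([x, y] ! i \<otimes>\<^bsub>L\<^esub> [x, y] ! j) # map (twist L) (nths [x, y] (- {i, j})))"
  have c: "basis_vector R [x \<otimes>\<^bsub>L\<^esub> y] \<in> carrier (tuples 1)"
    using assms by (auto intro!: basis_vector_tuples bracket_closed)
  have f: "?f (0, 1) = \<ominus>\<^bsub>tuples 1\<^esub> basis_vector R [x \<otimes>\<^bsub>L\<^esub> y]"
    using T.smult_l_minus[OF one_closed c] T.smult_one[OF c] by (simp add: nths_Cons)
  have "boundary 2 (basis_vector R [x, y]) = finsum (tuples 1) ?f {(i, j). i < j \<and> j < 2}"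
    using assms by (subst boundary_linear(2)) (simp_all add: tuple_boundary_def)
  also have "{(i, j). i < j \<and> j < (2::nat)} = {(0, 1)}" by auto
  also have "finsum (tuples 1) ?f {(0, 1)} = ?f (0, 1)"
    using T.M.finsum_insert[of "{}" "(0, 1)" ?f] c unfolding f by (simp del: One_nat_def)
  finally show ?thesis unfolding f .
qed

text \<open>The position sums 1, 2 and 3 produce the signs -, +, -. The bracket of x and z stands
  out of cyclic order, which \<open>linear_map_boundary_3\<close> repairs.\<close>

lemma boundary_3:
  assumes "x \<in> carrier L" "y \<in> carrier L" "z \<in> carrier L"
  shows "boundary 3 (basis_vector R [x, y, z]) =
    \<ominus>\<^bsub>tuples 2\<^esub> basis_vector R [x \<otimes>\<^bsub>L\<^esub> y, twist L z] \<oplus>\<^bsub>tuples 2\<^esub>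
    (basis_vector R [x \<otimes>\<^bsub>L\<^esub> z, twist L y] \<oplus>\<^bsub>tuples 2\<^esub>
     \<ominus>\<^bsub>tuples 2\<^esub> basis_vector R [y \<otimes>\<^bsub>L\<^esub> z, twist L x])"
proof -
  interpret T: module R "tuples 2" by (rule tuples_module)
  let ?f = "\<lambda>(i, j). \<ominus>\<^bsub>R\<^esub> \<one>\<^bsub>R\<^esub> [^]\<^bsub>R\<^esub> (i + j) \<odot>\<^bsub>tuples 2\<^esub>
    basis_vector R (([x, y, z] ! i \<otimes>\<^bsub>L\<^esub> [x, y, z] ! j)
      # map (twist L) (nths [x, y, z] (- {i, j})))"
  have c: "basis_vector R [x \<otimes>\<^bsub>L\<^esub> y, twist L z] \<in> carrier (tuples 2)"
    "basis_vector R [x \<otimes>\<^bsub>L\<^esub> z, twist L y] \<in> carrier (tuples 2)"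
    "basis_vector R [y \<otimes>\<^bsub>L\<^esub> z, twist L x] \<in> carrier (tuples 2)"
    using assms by (auto intro!: basis_vector_tuples bracket_closed twist_closed)
  have p: "\<ominus>\<^bsub>R\<^esub> \<one>\<^bsub>R\<^esub> [^]\<^bsub>R\<^esub> (2::nat) = \<one>\<^bsub>R\<^esub>" "\<ominus>\<^bsub>R\<^esub> \<one>\<^bsub>R\<^esub> [^]\<^bsub>R\<^esub> (3::nat) = \<ominus>\<^bsub>R\<^esub> \<one>\<^bsub>R\<^esub>"
    by (simp_all add: numeral_eq_Suc l_minus r_minus)
  have f: "?f (0, 1) = \<ominus>\<^bsub>tuples 2\<^esub> basis_vector R [x \<otimes>\<^bsub>L\<^esub> y, twist L z]"
    "?f (0, 2) = basis_vector R [x \<otimes>\<^bsub>L\<^esub> z, twist L y]"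
    "?f (1, 2) = \<ominus>\<^bsub>tuples 2\<^esub> basis_vector R [y \<otimes>\<^bsub>L\<^esub> z, twist L x]"
    using T.smult_l_minus[OF one_closed c(1)] T.smult_l_minus[OF one_closed c(3)] c p
    by (simp_all add: nths_Cons)
  have "boundary 3 (basis_vector R [x, y, z]) = finsum (tuples 2) ?f {(i, j). i < j \<and> j < 3}"
    using assms by (subst boundary_linear(2)) (simp_all add: tuple_boundary_def)
  also have "{(i, j). i < j \<and> j < (3::nat)} = {(0, 1), (0, 2), (1, 2)}" by auto
  also have "finsum (tuples 2) ?f {(0, 1), (0, 2), (1, 2)}
      = ?f (0, 1) \<oplus>\<^bsub>tuples 2\<^esub> (?f (0, 2) \<oplus>\<^bsub>tuples 2\<^esub> ?f (1, 2))"
    using T.M.finsum_insert[of "{}" "(1, 2)" ?f] T.M.finsum_insert[of "{(1, 2)}" "(0, 2)" ?f]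
      T.M.finsum_insert[of "{(0, 2), (1, 2)}" "(0, 1)" ?f] c unfolding Pi_iff ball_simps f
    by (simp del: One_nat_def)
  finally show ?thesis unfolding f .
qed

end

section \<open>Exterior powers in degrees one to three, and cycles of degree two\<close>

context hom_lie_algebra
begin

lemma bracket_linear:
  assumes "x \<in> carrier L"
  shows "(\<lambda>y. y \<otimes>\<^bsub>L\<^esub> x) \<in> linear_maps R L L" "(\<lambda>y. x \<otimes>\<^bsub>L\<^esub> y) \<in> linear_maps R L L"
  using assms by (auto intro!: linear_mapsI
      simp: bracket_closed bracket_add_left bracket_add_right bracket_smult_left bracket_smult_right)

lemma wedge_1_linear: "(\<lambda>x. wedge 1 [x]) \<in> linear_maps R L (exterior_power R L 1)"
  using wedge_add[of "[a]" 1 0 for a] wedge_smult[of "[a]" 1 0 for a]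
  by (intro linear_mapsI wedge_closed) auto

lemma wedge_2_linear:
  assumes "x \<in> carrier L"
  shows "(\<lambda>y. wedge 2 [y, x]) \<in> linear_maps R L (exterior_power R L 2)"
    and "(\<lambda>y. wedge 2 [x, y]) \<in> linear_maps R L (exterior_power R L 2)"
  using assms wedge_add[of "[a, x]" 2 0 for a] wedge_smult[of "[a, x]" 2 0 for a]
    wedge_add[of "[x, a]" 2 1 for a] wedge_smult[of "[x, a]" 2 1 for a]
  by (auto intro!: linear_mapsI wedge_closed)

lemma wedge_2_skew:
  "x \<in> carrier L \<Longrightarrow> y \<in> carrier L \<Longrightarrow> wedge 2 [y, x] = \<ominus>\<^bsub>exterior_power R L 2\<^esub> wedge 2 [x, y]"
  using wedge_skew[of "[x, y]" 2 0 1] by simp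

lemma length_2_cases:
  assumes "length xs = 2" "set xs \<subseteq> carrier L"
  obtains x y where "xs = [x, y]" "x \<in> carrier L" "y \<in> carrier L"
  using assms by (auto simp: numeral_2_eq_2 length_Suc_conv)

lemma length_3_cases:
  assumes "length xs = 3" "set xs \<subseteq> carrier L"
  obtains x y z where "xs = [x, y, z]" "x \<in> carrier L" "y \<in> carrier L" "z \<in> carrier L"
  using assms by (auto simp: numeral_3_eq_3 length_Suc_conv)

text \<open>Antisymmetry exchanges the two entries, so linearity in the left entry yields linearity
  in the right one.\<close>

lemma relations_vanish_2:
  assumes W: "module R W" and g: "g \<in> linear_maps R (tuples 2) W"
    and left: "\<And>y. y \<in> carrier L \<Longrightarrow> (\<lambda>x. g (basis_vector R [x, y])) \<in> linear_maps R L W"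
    and skew: "\<And>x y. x \<in> carrier L \<Longrightarrow> y \<in> carrier L
      \<Longrightarrow> g (basis_vector R [y, x]) = \<ominus>\<^bsub>W\<^esub> g (basis_vector R [x, y])"
    and t: "t \<in> relations 2"
  shows "g t = \<zero>\<^bsub>W\<^esub>"
proof -
  interpret W: module R W by fact
  have c: "g (basis_vector R [x, y]) \<in> carrier W" if "x \<in> carrier L" "y \<in> carrier L" for x y
    using that by (intro linear_maps_closed[OF g] basis_vector_tuples) auto
  note left_add = linear_maps_add[OF left] and left_smult = linear_maps_smult[OF left]
  show ?thesis
  proof (rule relations_vanish[OF W g _ _ _ t])
    fix xs :: "'v list" and i :: nat and a b
    assume xs: "length xs = 2" "set xs \<subseteq> carrier L" and i: "i < 2"
      and ab: "a \<in> carrier L" "b \<in> carrier L"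
    obtain x y where "xs = [x, y]" "x \<in> carrier L" "y \<in> carrier L"
      using xs by (rule length_2_cases)
    then show "g (basis_vector R (xs[i := a \<oplus>\<^bsub>L\<^esub> b]))
        = g (basis_vector R (xs[i := a])) \<oplus>\<^bsub>W\<^esub> g (basis_vector R (xs[i := b]))"
      using i ab c
      by (auto simp: less_2_cases_iff left_add skew[of _ x] W.M.minus_add)
  next
    fix xs :: "'v list" and i :: nat and k a
    assume xs: "length xs = 2" "set xs \<subseteq> carrier L" and i: "i < 2"
      and ka: "k \<in> carrier R" "a \<in> carrier L"
    obtain x y where "xs = [x, y]" "x \<in> carrier L" "y \<in> carrier L"
      using xs by (rule length_2_cases)
    then show "g (basis_vector R (xs[i := k \<odot>\<^bsub>L\<^esub> a])) = k \<odot>\<^bsub>W\<^esub> g (basis_vector R (xs[i := a]))"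
      using i ka c
      by (auto simp: less_2_cases_iff left_smult skew[of _ x] W.smult_r_minus)
  next
    fix xs :: "'v list" and i j :: nat
    assume xs: "length xs = 2" "set xs \<subseteq> carrier L" and ij: "i < j" "j < 2"
    obtain x y where "xs = [x, y]" "x \<in> carrier L" "y \<in> carrier L"
      using xs by (rule length_2_cases)
    moreover have "i = 0" "j = 1" using ij by auto
    ultimately show "g (basis_vector R xs) \<oplus>\<^bsub>W\<^esub> g (basis_vector R (xs[i := xs ! j, j := xs ! i]))
        = \<zero>\<^bsub>W\<^esub>"
      using c skew[of x y] by (simp add: W.M.r_neg)
  qed
qed

text \<open>Cyclic invariance carries linearity from the first entry to the other two. A 3-cycle and
  one transposition generate all permutations of three positions, so antisymmetry under the
  remaining transpositions follows as well. The hypotheses fit the cyclic form of the boundary in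
  \<open>linear_map_boundary_3\<close>.\<close>

lemma relations_vanish_3:
  assumes W: "module R W" and g: "g \<in> linear_maps R (tuples 3) W"
    and linear: "\<And>y z. y \<in> carrier L \<Longrightarrow> z \<in> carrier L
      \<Longrightarrow> (\<lambda>x. g (basis_vector R [x, y, z])) \<in> linear_maps R L W"
    and cyclic: "\<And>x y z. x \<in> carrier L \<Longrightarrow> y \<in> carrier L \<Longrightarrow> z \<in> carrier L
      \<Longrightarrow> g (basis_vector R [y, z, x]) = g (basis_vector R [x, y, z])"
    and skew: "\<And>x y z. x \<in> carrier L \<Longrightarrow> y \<in> carrier L \<Longrightarrow> z \<in> carrier L
      \<Longrightarrow> g (basis_vector R [y, x, z]) = \<ominus>\<^bsub>W\<^esub> g (basis_vector R [x, y, z])"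
    and t: "t \<in> relations 3"
  shows "g t = \<zero>\<^bsub>W\<^esub>"
proof -
  interpret W: module R W by fact
  have c: "g (basis_vector R [x, y, z]) \<in> carrier W"
    if "x \<in> carrier L" "y \<in> carrier L" "z \<in> carrier L" for x y z
    using that by (intro linear_maps_closed[OF g] basis_vector_tuples) auto
  note linear_add = linear_maps_add[OF linear] and linear_smult = linear_maps_smult[OF linear]
  have less_3: "i < 3 \<longleftrightarrow> i = 0 \<or> i = 1 \<or> i = 2" for i :: nat by auto
  show ?thesis
  proof (rule relations_vanish[OF W g _ _ _ t])
    fix xs :: "'v list" and i :: nat and a b
    assume xs: "length xs = 3" "set xs \<subseteq> carrier L" and i: "i < 3"
      and ab: "a \<in> carrier L" "b \<in> carrier L"
    obtain x y z where "xs = [x, y, z]" "x \<in> carrier L" "y \<in> carrier L" "z \<in> carrier L"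
      using xs by (rule length_3_cases)
    then show "g (basis_vector R (xs[i := a \<oplus>\<^bsub>L\<^esub> b]))
        = g (basis_vector R (xs[i := a])) \<oplus>\<^bsub>W\<^esub> g (basis_vector R (xs[i := b]))"
      using i ab linear_add[of y z a b] linear_add[of z x a b] linear_add[of x y a b]
        cyclic[of x a z] cyclic[of x b z] cyclic[of x "a \<oplus>\<^bsub>L\<^esub> b" z]
        cyclic[of a x y] cyclic[of b x y] cyclic[of "a \<oplus>\<^bsub>L\<^esub> b" x y]
      by (auto simp: less_3 numeral_2_eq_2)
  next
    fix xs :: "'v list" and i :: nat and k a
    assume xs: "length xs = 3" "set xs \<subseteq> carrier L" and i: "i < 3"
      and ka: "k \<in> carrier R" "a \<in> carrier L"
    obtain x y z where "xs = [x, y, z]" "x \<in> carrier L" "y \<in> carrier L" "z \<in> carrier L"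
      using xs by (rule length_3_cases)
    then show "g (basis_vector R (xs[i := k \<odot>\<^bsub>L\<^esub> a])) = k \<odot>\<^bsub>W\<^esub> g (basis_vector R (xs[i := a]))"
      using i ka linear_smult[of y z k a] linear_smult[of z x k a] linear_smult[of x y k a]
        cyclic[of x a z] cyclic[of x "k \<odot>\<^bsub>L\<^esub> a" z] cyclic[of a x y] cyclic[of "k \<odot>\<^bsub>L\<^esub> a" x y]
      by (auto simp: less_3 numeral_2_eq_2)
  next
    fix xs :: "'v list" and i j :: nat
    assume xs: "length xs = 3" "set xs \<subseteq> carrier L" and ij: "i < j" "j < 3"
    obtain x y z where xyz: "xs = [x, y, z]" "x \<in> carrier L" "y \<in> carrier L" "z \<in> carrier L"
      using xs by (rule length_3_cases)
    have "g (basis_vector R [y, x, z]) = \<ominus>\<^bsub>W\<^esub> g (basis_vector R [x, y, z])"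
      "g (basis_vector R [z, y, x]) = \<ominus>\<^bsub>W\<^esub> g (basis_vector R [x, y, z])"
      "g (basis_vector R [x, z, y]) = \<ominus>\<^bsub>W\<^esub> g (basis_vector R [x, y, z])"
      using xyz skew[of x y z] cyclic[of z y x] cyclic[of x z y] by auto
    moreover have "i = 0 \<and> j = 1 \<or> i = 0 \<and> j = 2 \<or> i = 1 \<and> j = 2" using ij by auto
    ultimately show "g (basis_vector R xs) \<oplus>\<^bsub>W\<^esub> g (basis_vector R (xs[i := xs ! j, j := xs ! i]))
        = \<zero>\<^bsub>W\<^esub>"
      using xyz c by (auto simp: numeral_2_eq_2 W.M.r_neg)
  qed
qed

text \<open>Up to sign this is the boundary map of degree 2, read in \<open>L\<close> itself instead
  of in the first exterior power.\<close>

definition bracket_map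
  where "bracket_map = linear_extension R L (\<lambda>xs. xs ! 0 \<otimes>\<^bsub>L\<^esub> xs ! 1)"

lemma bracket_map_linear: "bracket_map \<in> linear_maps R (tuples 2) L"
  unfolding bracket_map_def
  by (rule tuples_extension_linear[OF module_L]) (auto elim!: length_2_cases intro: bracket_closed)

lemma bracket_map_basis_vector:
  "x \<in> carrier L \<Longrightarrow> y \<in> carrier L \<Longrightarrow> bracket_map (basis_vector R [x, y]) = x \<otimes>\<^bsub>L\<^esub> y"
  unfolding bracket_map_def
  by (subst linear_extension_basis_vector[OF field module_L]) (auto intro: bracket_closed)

lemma bracket_map_relations: "t \<in> relations 2 \<Longrightarrow> bracket_map t = \<zero>\<^bsub>L\<^esub>"
proof (rule relations_vanish_2[OF module_L bracket_map_linear])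
  show "(\<lambda>x. bracket_map (basis_vector R [x, y])) \<in> linear_maps R L L" if "y \<in> carrier L" for y
    using bracket_linear(1)[OF that] that
    by (auto intro!: linear_mapsI simp: bracket_map_basis_vector bracket_closed bracket_add_left
        bracket_smult_left)
  show "bracket_map (basis_vector R [y, x]) = \<ominus>\<^bsub>L\<^esub> bracket_map (basis_vector R [x, y])"
    if "x \<in> carrier L" "y \<in> carrier L" for x y
    using that bracket_skew[of y x] by (simp add: bracket_map_basis_vector)
qed

text \<open>The space \<open>tuples 1\<close> consists of formal combinations of elements of
  \<open>L\<close>. The map \<open>\<epsilon>\<close> evaluates them in \<open>L\<close>, and its
  kernel is \<open>relations 1\<close>; so being a cycle can be tested in \<open>L\<close>, where
  the boundary becomes the negative of \<open>bracket_map\<close>.\<close>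

lemma boundary_2_mem_relations_iff:
  assumes t: "t \<in> carrier (tuples 2)"
  shows "boundary 2 t \<in> relations 1 \<longleftrightarrow> bracket_map t = \<zero>\<^bsub>L\<^esub>"
proof -
  define \<epsilon> where "\<epsilon> = linear_extension R L (\<lambda>xs. xs ! 0)"
  have \<epsilon>: "\<epsilon> \<in> linear_maps R (tuples 1) L"
    unfolding \<epsilon>_def by (rule tuples_extension_linear[OF module_L]) (auto simp: length_Suc_conv)
  have \<epsilon>_basis: "\<epsilon> (basis_vector R [x]) = x" if "x \<in> carrier L" for x
    unfolding \<epsilon>_def using that by (subst linear_extension_basis_vector[OF field module_L]) auto
  have vanish: "\<epsilon> f = \<zero>\<^bsub>L\<^esub>" if "f \<in> relations 1" for f
    by (rule relations_vanish[OF module_L \<epsilon> _ _ _ that])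
      (auto simp: length_Suc_conv \<epsilon>_basis)
  \<comment> \<open>Modulo \<open>relations 1\<close> every \<open>f\<close> equals the basis vector
    of its value \<open>\<epsilon> f\<close>: both expressions are linear in \<open>f\<close> and
    agree on basis vectors.\<close>
  have conv: "f \<in> relations 1" if f: "f \<in> carrier (tuples 1)" and "\<epsilon> f = \<zero>\<^bsub>L\<^esub>" for f
  proof -
    have "relations 1 +>\<^bsub>tuples 1\<^esub> f = wedge 1 [\<epsilon> f]"
      by (rule tuples_maps_eqI[OF exterior_power_module projection_linear
            linear_maps_comp[OF \<epsilon> wedge_1_linear] _ f])
        (auto simp: length_Suc_conv \<epsilon>_basis)
    also have "\<dots> = \<zero>\<^bsub>exterior_power R L 1\<^esub>"
      using linear_maps_zero[OF module_L exterior_power_module wedge_1_linear] that(2) by simp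
    finally show ?thesis using f by (simp add: projection_eq_zero_iff)
  qed
  have D: "boundary 2 \<in> linear_maps R (tuples 2) (tuples 1)"
    using boundary_linear(1)[of 2] by simp
  have "\<epsilon> (boundary 2 t) = \<ominus>\<^bsub>L\<^esub> bracket_map t"
  proof (rule tuples_maps_eqI[OF module_L linear_maps_comp[OF D \<epsilon>]
        linear_maps_uminus[OF tuples_module module_L bracket_map_linear] _ t])
    fix xs :: "'v list" assume "length xs = 2" "set xs \<subseteq> carrier L"
    then obtain x y where "xs = [x, y]" "x \<in> carrier L" "y \<in> carrier L"
      by (rule length_2_cases)
    moreover from this have "\<epsilon> (\<ominus>\<^bsub>tuples 1\<^esub> basis_vector R [x \<otimes>\<^bsub>L\<^esub> y]) = \<ominus>\<^bsub>L\<^esub> (x \<otimes>\<^bsub>L\<^esub> y)"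
      by (subst linear_maps_neg[OF tuples_module module_L \<epsilon>])
        (auto simp: \<epsilon>_basis bracket_closed intro!: basis_vector_tuples)
    ultimately show "\<epsilon> (boundary 2 (basis_vector R xs)) = \<ominus>\<^bsub>L\<^esub> bracket_map (basis_vector R xs)"
      using boundary_2[of x y] by (simp add: bracket_map_basis_vector)
  qed
  moreover have "bracket_map t \<in> carrier L"
    using linear_maps_closed[OF bracket_map_linear t] .
  ultimately have "\<epsilon> (boundary 2 t) = \<zero>\<^bsub>L\<^esub> \<longleftrightarrow> bracket_map t = \<zero>\<^bsub>L\<^esub>"
    using M.add.inv_eq_1_iff[of "bracket_map t"] by simp
  then show ?thesis
    using vanish conv linear_maps_closed[OF D t] by blast
qed

section \<open>The boundary map in degree three\<close>

lemma boundary_3_linear: "boundary 3 \<in> linear_maps R (tuples 3) (tuples 2)"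
  using boundary_linear(1)[of 3] by simp

text \<open>Linearity in the left entry allows the bracket of x and z to be reversed at the cost of
  a sign. The mixed signs of \<open>boundary_3\<close> thereby become the negative of a cyclic sum,
  the shape in which the Hom-Jacobi identity can be applied.\<close>

lemma linear_map_boundary_3:
  assumes W: "module R W" and g: "g \<in> linear_maps R (tuples 2) W"
    and left: "\<And>y. y \<in> carrier L \<Longrightarrow> (\<lambda>x. g (basis_vector R [x, y])) \<in> linear_maps R L W"
    and "x \<in> carrier L" "y \<in> carrier L" "z \<in> carrier L"
  shows "g (boundary 3 (basis_vector R [x, y, z])) =
    \<ominus>\<^bsub>W\<^esub> (g (basis_vector R [x \<otimes>\<^bsub>L\<^esub> y, twist L z]) \<oplus>\<^bsub>W\<^esub>
      (g (basis_vector R [y \<otimes>\<^bsub>L\<^esub> z, twist L x]) \<oplus>\<^bsub>W\<^esub>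
       g (basis_vector R [z \<otimes>\<^bsub>L\<^esub> x, twist L y])))"
proof -
  interpret T: module R "tuples 2" by (rule tuples_module)
  interpret W: module R W by fact
  have c: "basis_vector R [a \<otimes>\<^bsub>L\<^esub> b, twist L d] \<in> carrier (tuples 2)"
    if "a \<in> carrier L" "b \<in> carrier L" "d \<in> carrier L" for a b d
    using that by (auto intro!: basis_vector_tuples bracket_closed twist_closed)
  have "g (basis_vector R [x \<otimes>\<^bsub>L\<^esub> z, twist L y]) = \<ominus>\<^bsub>W\<^esub> g (basis_vector R [z \<otimes>\<^bsub>L\<^esub> x, twist L y])"
    using assms linear_maps_neg[OF module_L W left[of "twist L y"], of "z \<otimes>\<^bsub>L\<^esub> x"]
    by (subst bracket_skew) (auto simp: twist_closed bracket_closed)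
  then show ?thesis
    using assms(4-) c linear_maps_closed[OF g]
    by (simp add: boundary_3 linear_maps_add[OF g] linear_maps_neg[OF tuples_module W g]
        W.M.minus_add W.M.a_ac)
qed

text \<open>The boundary descends to the exterior cube: the cyclic sum is visibly invariant under
  rotation, and exchanging x and y reverses every bracket in it.\<close>

lemma boundary_3_relations:
  assumes "t \<in> relations 3" shows "boundary 3 t \<in> relations 2"
proof -
  interpret E: module R "exterior_power R L 2" by (rule exterior_power_module)
  interpret T: module R "tuples 3" by (rule tuples_module)
  let ?g = "\<lambda>t. relations 2 +>\<^bsub>tuples 2\<^esub> boundary 3 t"
  have g: "?g \<in> linear_maps R (tuples 3) (exterior_power R L 2)"
    by (rule linear_maps_comp[OF boundary_3_linear projection_linear])
  have val: "?g (basis_vector R [x, y, z]) = \<ominus>\<^bsub>exterior_power R L 2\<^esub>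
      (wedge 2 [x \<otimes>\<^bsub>L\<^esub> y, twist L z] \<oplus>\<^bsub>exterior_power R L 2\<^esub>
      (wedge 2 [y \<otimes>\<^bsub>L\<^esub> z, twist L x] \<oplus>\<^bsub>exterior_power R L 2\<^esub> wedge 2 [z \<otimes>\<^bsub>L\<^esub> x, twist L y]))"
    if "x \<in> carrier L" "y \<in> carrier L" "z \<in> carrier L" for x y z
    using linear_map_boundary_3[OF exterior_power_module projection_linear wedge_2_linear(1) that] .
  have c: "wedge 2 [x, y] \<in> carrier (exterior_power R L 2)"
    if "x \<in> carrier L" "y \<in> carrier L" for x y
    using that by (intro wedge_closed) auto
  note add = linear_maps_add[OF wedge_2_linear(1)] linear_maps_add[OF wedge_2_linear(2)]
  note smult = linear_maps_smult[OF wedge_2_linear(1)] linear_maps_smult[OF wedge_2_linear(2)]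
  note neg = linear_maps_neg[OF module_L exterior_power_module wedge_2_linear(1)]
  have "?g t = \<zero>\<^bsub>exterior_power R L 2\<^esub>"
  proof (rule relations_vanish_3[OF exterior_power_module g _ _ _ assms])
    show "(\<lambda>x. ?g (basis_vector R [x, y, z])) \<in> linear_maps R L (exterior_power R L 2)"
      if "y \<in> carrier L" "z \<in> carrier L" for y z
      by (rule linear_mapsI)
        (use that in \<open>simp_all add: val c bracket_closed twist_closed add smult bracket_add_left
          bracket_add_right bracket_smult_left bracket_smult_right linear_maps_add[OF twist_linear]
          linear_maps_smult[OF twist_linear] E.M.minus_add E.M.a_ac E.smult_r_minus
          E.smult_r_distr\<close>)
    show "?g (basis_vector R [y, z, x]) = ?g (basis_vector R [x, y, z])"
      if "x \<in> carrier L" "y \<in> carrier L" "z \<in> carrier L" for x y z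
      using that by (simp add: val c bracket_closed twist_closed E.M.a_ac)
    show "?g (basis_vector R [y, x, z]) = \<ominus>\<^bsub>exterior_power R L 2\<^esub> ?g (basis_vector R [x, y, z])"
      if "x \<in> carrier L" "y \<in> carrier L" "z \<in> carrier L" for x y z
      using that bracket_skew[of y x] bracket_skew[of x z] bracket_skew[of z y]
      by (simp add: val c bracket_closed twist_closed neg E.M.minus_add E.M.a_ac)
  qed
  moreover have "t \<in> carrier (tuples 3)"
    using assms T.submoduleE(1)[OF relations_submodule] by blast
  ultimately show ?thesis
    using linear_maps_closed[OF boundary_3_linear] by (simp add: projection_eq_zero_iff)
qed

text \<open>This is the vanishing of two successive boundaries. After antisymmetry has moved the
  twisted factor to the left in each term, the cyclic sum is the Hom-Jacobi identity.\<close>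

lemma bracket_map_boundary_3:
  assumes "s \<in> carrier (tuples 3)"
  shows "bracket_map (boundary 3 s) = \<zero>\<^bsub>L\<^esub>"
proof -
  have left: "(\<lambda>x. bracket_map (basis_vector R [x, y])) \<in> linear_maps R L L" if "y \<in> carrier L" for y
    using that by (auto intro!: linear_mapsI simp: bracket_map_basis_vector bracket_closed
        bracket_add_left bracket_smult_left)
  show ?thesis
  proof (rule tuples_maps_eqI[OF module_L linear_maps_comp[OF boundary_3_linear bracket_map_linear]
        _ _ assms])
    show "(\<lambda>_. \<zero>\<^bsub>L\<^esub>) \<in> linear_maps R (tuples 3) L"
      by (rule linear_mapsI) auto
    fix xs :: "'v list" assume "length xs = 3" "set xs \<subseteq> carrier L"
    then obtain x y z where xyz: "xs = [x, y, z]" "x \<in> carrier L" "y \<in> carrier L" "z \<in> carrier L"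
      by (rule length_3_cases)
    have "(x \<otimes>\<^bsub>L\<^esub> y) \<otimes>\<^bsub>L\<^esub> twist L z \<oplus>\<^bsub>L\<^esub> ((y \<otimes>\<^bsub>L\<^esub> z) \<otimes>\<^bsub>L\<^esub> twist L x \<oplus>\<^bsub>L\<^esub> (z \<otimes>\<^bsub>L\<^esub> x) \<otimes>\<^bsub>L\<^esub> twist L y)
      = \<ominus>\<^bsub>L\<^esub> (twist L x \<otimes>\<^bsub>L\<^esub> (y \<otimes>\<^bsub>L\<^esub> z) \<oplus>\<^bsub>L\<^esub> twist L y \<otimes>\<^bsub>L\<^esub> (z \<otimes>\<^bsub>L\<^esub> x) \<oplus>\<^bsub>L\<^esub> twist L z \<otimes>\<^bsub>L\<^esub> (x \<otimes>\<^bsub>L\<^esub> y))"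
      using xyz bracket_skew[of "x \<otimes>\<^bsub>L\<^esub> y" "twist L z"] bracket_skew[of "y \<otimes>\<^bsub>L\<^esub> z" "twist L x"]
        bracket_skew[of "z \<otimes>\<^bsub>L\<^esub> x" "twist L y"]
      by (simp add: bracket_closed twist_closed M.minus_add M.a_ac)
    then show "bracket_map (boundary 3 (basis_vector R xs)) = \<zero>\<^bsub>L\<^esub>"
      using xyz linear_map_boundary_3[OF module_L bracket_map_linear left, of x y z]
      by (simp add: bracket_map_basis_vector bracket_closed twist_closed hom_jacobi)
  qed
qed

section \<open>Compatibility with the twist\<close>

lemma twist_boundary_3:
  assumes "s \<in> carrier (tuples 3)"
  shows "boundary 3 (twist (tuples 3) s) = twist (tuples 2) (boundary 3 s)"
proof (rule tuples_maps_eqI[OF tuples_module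
      linear_maps_comp[OF twist_tuples_linear boundary_3_linear]
      linear_maps_comp[OF boundary_3_linear twist_tuples_linear] _ assms])
  interpret T: module R "tuples 2" by (rule tuples_module)
  fix xs :: "'v list" assume "length xs = 3" "set xs \<subseteq> carrier L"
  then obtain x y z where xyz: "xs = [x, y, z]" "x \<in> carrier L" "y \<in> carrier L" "z \<in> carrier L"
    by (rule length_3_cases)
  have c: "basis_vector R [a \<otimes>\<^bsub>L\<^esub> b, twist L d] \<in> carrier (tuples 2)"
    if "a \<in> carrier L" "b \<in> carrier L" "d \<in> carrier L" for a b d
    using that by (auto intro!: basis_vector_tuples bracket_closed twist_closed)
  \<comment> \<open>Multiplicativity of the twist matches the bracket entries; the remaining entries
    are twisted twice on either side.\<close>
  show "boundary 3 (twist (tuples 3) (basis_vector R xs))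
      = twist (tuples 2) (boundary 3 (basis_vector R xs))"
    using xyz by (simp add: twist_tuples_basis_vector boundary_3 twist_closed c
        linear_maps_add[OF twist_tuples_linear]
        linear_maps_neg[OF tuples_module tuples_module twist_tuples_linear] twist_bracket)
qed

lemma twist_relations_2:
  assumes "t \<in> relations 2"
  shows "twist (tuples 2) t \<in> relations 2"
proof -
  interpret T: module R "tuples 2" by (rule tuples_module)
  let ?g = "\<lambda>t. relations 2 +>\<^bsub>tuples 2\<^esub> twist (tuples 2) t"
  note g = linear_maps_comp[OF twist_tuples_linear projection_linear, of 2]
  have "?g t = \<zero>\<^bsub>exterior_power R L 2\<^esub>"
  proof (rule relations_vanish_2[OF exterior_power_module g _ _ assms])
    show "(\<lambda>x. ?g (basis_vector R [x, y])) \<in> linear_maps R L (exterior_power R L 2)"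
      if "y \<in> carrier L" for y
      using linear_maps_comp[OF twist_linear wedge_2_linear(1)[OF twist_closed[OF that]]]
      by (simp add: twist_tuples_basis_vector)
    show "?g (basis_vector R [y, x]) = \<ominus>\<^bsub>exterior_power R L 2\<^esub> ?g (basis_vector R [x, y])"
      if "x \<in> carrier L" "y \<in> carrier L" for x y
      using that wedge_2_skew[of "twist L x" "twist L y"]
      by (simp add: twist_tuples_basis_vector twist_closed)
  qed
  moreover have "t \<in> carrier (tuples 2)"
    using assms T.submoduleE(1)[OF relations_submodule] by blast
  ultimately show ?thesis
    using linear_maps_closed[OF twist_tuples_linear] by (simp add: projection_eq_zero_iff)
qed

lemma twist_bracket_map:
  assumes "t \<in> carrier (tuples 2)"
  shows "bracket_map (twist (tuples 2) t) = twist L (bracket_map t)"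
  by (rule tuples_maps_eqI[OF module_L linear_maps_comp[OF twist_tuples_linear bracket_map_linear]
        linear_maps_comp[OF bracket_map_linear twist_linear] _ assms])
    (auto elim!: length_2_cases
      simp: twist_tuples_basis_vector bracket_map_basis_vector twist_closed twist_bracket)

section \<open>The second homology as a quotient of cycles\<close>

lemma boundary_map_projection:
  assumes "1 \<le> n" "\<And>t. t \<in> relations n \<Longrightarrow> boundary n t \<in> relations (n - 1)"
    and "t \<in> carrier (tuples n)"
  shows "boundary_map R L n (relations n +>\<^bsub>tuples n\<^esub> t)
    = relations (n - 1) +>\<^bsub>tuples (n - 1)\<^esub> boundary n t"
  unfolding boundary_map_def boundary_def[symmetric]
  by (rule coset_map_coset[OF tuples_module tuples_module relations_submodule relations_submodule
        boundary_linear(1)]) (use assms in auto)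

text \<open>\<open>U\<close> consists of all representatives, among formal combinations of pairs, of
  cycles in the exterior square. Describing homology as an image of \<open>U\<close> with an
  explicit kernel removes both layers of quotients at once.\<close>

lemma homology_2_cover:
  defines "U \<equiv> (tuples 2)\<lparr>carrier := {t \<in> carrier (tuples 2). bracket_map t = \<zero>\<^bsub>L\<^esub>}\<rparr>"
  shows "module R U" and "twist U ` carrier U \<subseteq> carrier U" and "module R (homology R L 2)"
    and "\<exists>f\<in>hom_space_morphisms R U (homology R L 2).
      f ` carrier U = carrier (homology R L 2) \<and>
      (\<forall>t\<in>carrier U. f t = \<zero>\<^bsub>homology R L 2\<^esub> \<longleftrightarrow>
        (\<exists>s\<in>carrier (tuples 3). t \<ominus>\<^bsub>tuples 2\<^esub> boundary 3 s \<in> relations 2))"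
proof -
  let ?E = "exterior_power R L 2" and ?\<pi> = "\<lambda>t. relations 2 +>\<^bsub>tuples 2\<^esub> t"
  interpret T: module R "tuples 2" by (rule tuples_module)
  interpret E: module R ?E by (rule exterior_power_module)
  \<comment> \<open>\<open>B\<close> and \<open>Z\<close> are the boundaries and the cycles inside
    the exterior square.\<close>
  define B where "B = (\<lambda>s. ?\<pi> (boundary 3 s)) ` carrier (tuples 3)"
  define Z where "Z = ?\<pi> ` carrier U"
  note [simp] = linear_maps_closed[OF boundary_3_linear]
  have Usub: "submodule (carrier U) R (tuples 2)"
    unfolding U_def using submodule_kernel[OF tuples_module module_L bracket_map_linear] by simp
  have U_sub: "carrier U \<subseteq> carrier (tuples 2)" by (auto simp: U_def)
  show U: "module R U"
    using submodule.submodule_is_module[OF Usub tuples_module] by (simp add: U_def)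
  have tw: "twist (tuples 2) t \<in> carrier U" if "t \<in> carrier U" for t
    using that linear_maps_closed[OF twist_tuples_linear]
      linear_maps_zero[OF module_L module_L twist_linear]
    by (simp add: U_def twist_bracket_map)
  then show "twist U ` carrier U \<subseteq> carrier U" by (auto simp: U_def)
  have bm2: "boundary_map R L 2 (?\<pi> t) = \<zero>\<^bsub>exterior_power R L 1\<^esub> \<longleftrightarrow> t \<in> carrier U"
    if t: "t \<in> carrier (tuples 2)" for t
  proof -
    have "boundary 2 t \<in> relations (2 - 1)" if "t \<in> relations 2" for t
      using that boundary_2_mem_relations_iff[of t] bracket_map_relations[of t]
        T.submoduleE(1)[OF relations_submodule] by auto
    then have "boundary_map R L 2 (?\<pi> t) = relations 1 +>\<^bsub>tuples 1\<^esub> boundary 2 t"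
      using boundary_map_projection[of 2 t] t by simp
    then show ?thesis
      using t boundary_2_mem_relations_iff[OF t] linear_maps_closed[OF boundary_linear(1)[of 2]]
      by (simp add: projection_eq_zero_iff U_def)
  qed
  have ker: "a_kernel ?E (exterior_power R L 1) (boundary_map R L 2) = Z"
  proof -
    have "a_kernel ?E (exterior_power R L 1) (boundary_map R L 2) = ?\<pi> ` {t \<in> carrier (tuples 2).
        boundary_map R L 2 (?\<pi> t) = \<zero>\<^bsub>exterior_power R L 1\<^esub>}"
      unfolding a_kernel_def' exterior_power_carrier by blast
    also have "{t \<in> carrier (tuples 2). boundary_map R L 2 (?\<pi> t) = \<zero>\<^bsub>exterior_power R L 1\<^esub>}
        = carrier U"
      using U_sub bm2 by blast
    finally show ?thesis by (simp add: Z_def)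
  qed
  have "boundary_map R L 3 (relations 3 +>\<^bsub>tuples 3\<^esub> s) = ?\<pi> (boundary 3 s)"
    if "s \<in> carrier (tuples 3)" for s
    using boundary_map_projection[of 3 s] that boundary_3_relations by simp
  then have im: "boundary_map R L 3 ` carrier (exterior_power R L 3) = B"
    by (auto simp: exterior_power_carrier B_def image_image)
  have H: "homology R L 2 = hom_quotient (?E\<lparr>carrier := Z\<rparr>) B"
    unfolding homology_def using ker im by simp
  have Zsub: "submodule Z R ?E"
    unfolding Z_def by (rule submodule_image[OF tuples_module exterior_power_module projection_linear Usub])
  have "submodule B R ?E"
    unfolding B_def
    by (rule submodule_image[OF tuples_module exterior_power_module
          linear_maps_comp[OF boundary_3_linear projection_linear]
          module.carrier_is_submodule[OF tuples_module]])
  moreover have "B \<subseteq> Z"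
    by (auto simp: B_def Z_def U_def bracket_map_boundary_3)
  ultimately have Bsub: "submodule B R (?E\<lparr>carrier := Z\<rparr>)"
    by (intro submodule_restrict_carrier[OF exterior_power_module Zsub])
  have Zmod: "module R (?E\<lparr>carrier := Z\<rparr>)"
    by (rule submodule.submodule_is_module[OF Zsub exterior_power_module])
  show "module R (homology R L 2)"
    unfolding H by (rule hom_quotient_module[OF Zmod Bsub])
  have twE: "twist ?E (?\<pi> t) = ?\<pi> (twist (tuples 2) t)" if "t \<in> carrier (tuples 2)" for t
    unfolding exterior_power_def
    by (rule hom_quotient_twist[OF tuples_module relations_submodule twist_tuples_linear
          twist_relations_2 that])
  have \<pi>U: "?\<pi> \<in> linear_maps R U (?E\<lparr>carrier := Z\<rparr>)"
    unfolding U_def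
    by (rule linear_maps_restrict_carrier[OF projection_linear]) (auto simp: Z_def U_def)
  \<comment> \<open>The twist of the exterior square is controlled through \<open>twE\<close> only
    on classes of tuples, so its linearity on \<open>Z\<close> is proved by choosing representatives
    in \<open>U\<close>.\<close>
  have twZ: "twist (?E\<lparr>carrier := Z\<rparr>) \<in> linear_maps R (?E\<lparr>carrier := Z\<rparr>) (?E\<lparr>carrier := Z\<rparr>)"
  proof (rule linear_mapsI)
    note op = linear_maps_add[OF projection_linear, symmetric]
      linear_maps_smult[OF projection_linear, symmetric]
    fix x y c assume x: "x \<in> carrier (?E\<lparr>carrier := Z\<rparr>)"
    obtain s where s: "s \<in> carrier U" "x = ?\<pi> s" using x by (auto simp: Z_def)
    then have s': "s \<in> carrier (tuples 2)" "twist (tuples 2) s \<in> carrier (tuples 2)"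
      using U_sub tw by auto
    show "twist (?E\<lparr>carrier := Z\<rparr>) x \<in> carrier (?E\<lparr>carrier := Z\<rparr>)"
      using s s' tw by (simp add: twE Z_def)
    { assume "c \<in> carrier R"
      then show "twist (?E\<lparr>carrier := Z\<rparr>) (c \<odot>\<^bsub>?E\<lparr>carrier := Z\<rparr>\<^esub> x)
          = c \<odot>\<^bsub>?E\<lparr>carrier := Z\<rparr>\<^esub> twist (?E\<lparr>carrier := Z\<rparr>) x"
        using s s' by (simp add: op twE linear_maps_smult[OF twist_tuples_linear]) }
    assume "y \<in> carrier (?E\<lparr>carrier := Z\<rparr>)"
    then obtain t where t: "t \<in> carrier U" "y = ?\<pi> t" by (auto simp: Z_def)
    then have t': "t \<in> carrier (tuples 2)" "twist (tuples 2) t \<in> carrier (tuples 2)"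
      using U_sub tw by auto
    show "twist (?E\<lparr>carrier := Z\<rparr>) (x \<oplus>\<^bsub>?E\<lparr>carrier := Z\<rparr>\<^esub> y)
        = twist (?E\<lparr>carrier := Z\<rparr>) x \<oplus>\<^bsub>?E\<lparr>carrier := Z\<rparr>\<^esub> twist (?E\<lparr>carrier := Z\<rparr>) y"
      using s s' t t' by (simp add: op twE linear_maps_add[OF twist_tuples_linear])
  qed
  \<comment> \<open>The twist of the boundary of \<open>s\<close> is the boundary of the twist of
    \<open>s\<close>.\<close>
  have twB: "twist (?E\<lparr>carrier := Z\<rparr>) b \<in> B" if "b \<in> B" for b
    using that linear_maps_closed[OF twist_tuples_linear]
    by (auto simp: B_def twE twist_boundary_3[symmetric])
  let ?f = "\<lambda>t. B +>\<^bsub>?E\<lparr>carrier := Z\<rparr>\<^esub> ?\<pi> t"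
  have f: "?f \<in> linear_maps R U (homology R L 2)"
    unfolding H by (rule linear_maps_comp[OF \<pi>U coset_linear[OF Zmod Bsub]])
  have "?f (twist U t) = twist (homology R L 2) (?f t)" if "t \<in> carrier U" for t
    unfolding H
    by (subst hom_quotient_twist[OF Zmod Bsub twZ twB])
      (use that U_sub in \<open>auto simp: Z_def twE U_def\<close>)
  then have "?f \<in> hom_space_morphisms R U (homology R L 2)"
    using f by (simp add: hom_space_morphisms_def)
  moreover have "?f ` carrier U = carrier (homology R L 2)"
    by (simp add: H hom_quotient_simps Z_def image_image)
  moreover have "?f t = \<zero>\<^bsub>homology R L 2\<^esub> \<longleftrightarrow>
      (\<exists>s\<in>carrier (tuples 3). t \<ominus>\<^bsub>tuples 2\<^esub> boundary 3 s \<in> relations 2)" if "t \<in> carrier U" for t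
  proof -
    have "?\<pi> t \<in> carrier (?E\<lparr>carrier := Z\<rparr>)" using that by (simp add: Z_def)
    then have "?f t = \<zero>\<^bsub>homology R L 2\<^esub> \<longleftrightarrow> ?\<pi> t \<in> B"
      by (simp only: H hom_quotient_simps coset_eq_zero_iff[OF Zmod Bsub])
    also have "\<dots> \<longleftrightarrow> (\<exists>s\<in>carrier (tuples 3). ?\<pi> t = ?\<pi> (boundary 3 s))"
      by (auto simp: B_def)
    also have "\<dots> \<longleftrightarrow> (\<exists>s\<in>carrier (tuples 3). t \<ominus>\<^bsub>tuples 2\<^esub> boundary 3 s \<in> relations 2)"
      using that U_sub by (intro bex_cong projection_eq_iff) auto
    finally show ?thesis .
  qed
  ultimately show "\<exists>f\<in>hom_space_morphisms R U (homology R L 2).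
      f ` carrier U = carrier (homology R L 2) \<and>
      (\<forall>t\<in>carrier U. f t = \<zero>\<^bsub>homology R L 2\<^esub> \<longleftrightarrow>
        (\<exists>s\<in>carrier (tuples 3). t \<ominus>\<^bsub>tuples 2\<^esub> boundary 3 s \<in> relations 2))"
    by blast
qed

end

section \<open>Free Hom-Lie algebras\<close>

text \<open>The free nonassociative algebra arises from a free Hom-vector space by replacing the
  product only, so its linear structure is inherited.\<close>

lemma module_mult_update:
  "module R V \<Longrightarrow> module R (V\<lparr>mult := m\<rparr>)"
  by (simp add: module_def abelian_group_def abelian_monoid_def abelian_group_axioms_def
      module_axioms_def)

lemma linear_maps_mult_update:
  "linear_maps R (V\<lparr>mult := m\<rparr>) W = linear_maps R V W"
  "linear_maps R W (V\<lparr>mult := m\<rparr>) = linear_maps R W V"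
  by (simp_all add: linear_maps_def hom_def)

locale free_nonassoc = field R
  for R :: "('k, 'r) ring_scheme" (structure) and X :: "'x set" and \<sigma> :: "'x \<Rightarrow> 'x" +
  assumes hom_set: "\<sigma> \<in> X \<rightarrow> X"
begin

abbreviation A where "A \<equiv> free_nonassoc_algebra R X \<sigma>"

abbreviation words where "words \<equiv> {w. set_magma w \<subseteq> X}"

abbreviation I where "I \<equiv> generated_ideal R A (hom_lie_relations A)"

lemma field: "field R" ..

lemma A_module: "module R A"
  unfolding free_nonassoc_algebra_def
  by (rule module_mult_update[OF free_hom_space_module[OF field]])

sublocale A: module R A by (rule A_module)

lemma A_carrier: "carrier A = carrier (free_hom_space R words (map_magma \<sigma>))"
  by (simp add: free_nonassoc_algebra_def)

lemma A_simps:
  "\<zero>\<^bsub>A\<^esub> = (\<lambda>s. \<zero>)"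
  "f \<oplus>\<^bsub>A\<^esub> g = (\<lambda>s. f s \<oplus> g s)"
  "c \<odot>\<^bsub>A\<^esub> f = (\<lambda>s. c \<otimes> f s)"
  "f \<otimes>\<^bsub>A\<^esub> g = (\<lambda>w. case w of Gen x \<Rightarrow> \<zero> | Mul u v \<Rightarrow> f u \<otimes> g v)"
  by (simp_all add: free_nonassoc_algebra_def free_hom_space_def)

lemma A_maps_eqI:
  assumes "module R W" "g \<in> linear_maps R A W" "h \<in> linear_maps R A W"
    and "\<And>w. w \<in> words \<Longrightarrow> g (basis_vector R w) = h (basis_vector R w)"
    and "f \<in> carrier A"
  shows "g f = h f"
  using free_hom_space_maps_eqI[OF field assms(1), of g words "map_magma \<sigma>" h f] assms(2-)
  by (simp add: free_nonassoc_algebra_def linear_maps_mult_update)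

lemma basis_vector_A: "w \<in> words \<Longrightarrow> basis_vector R w \<in> carrier A"
  unfolding A_carrier by (rule basis_vector_closed[OF field])

lemma mult_closed: "f \<in> carrier A \<Longrightarrow> g \<in> carrier A \<Longrightarrow> f \<otimes>\<^bsub>A\<^esub> g \<in> carrier A"
proof -
  assume fg: "f \<in> carrier A" "g \<in> carrier A"
  have "{w. (f \<otimes>\<^bsub>A\<^esub> g) w \<noteq> \<zero>} \<subseteq> (\<lambda>(u, v). Mul u v) ` ({u. f u \<noteq> \<zero>} \<times> {v. g v \<noteq> \<zero>})"
  proof
    fix w assume w: "w \<in> {w. (f \<otimes>\<^bsub>A\<^esub> g) w \<noteq> \<zero>}"
    show "w \<in> (\<lambda>(u, v). Mul u v) ` ({u. f u \<noteq> \<zero>} \<times> {v. g v \<noteq> \<zero>})"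
      using w fg by (cases w) (auto simp: A_simps A_carrier free_hom_space_carrier_iff)
  qed
  moreover have "finite ((\<lambda>(u, v). Mul u v) ` ({u. f u \<noteq> \<zero>} \<times> {v. g v \<noteq> \<zero>}))"
    using fg by (auto simp: A_carrier free_hom_space_carrier_iff)
  ultimately have "finite {w. (f \<otimes>\<^bsub>A\<^esub> g) w \<noteq> \<zero>}"
    by (rule finite_subset)
  moreover have "(f \<otimes>\<^bsub>A\<^esub> g) w \<in> carrier R" for w
    using fg by (cases w) (simp_all add: A_simps A_carrier free_hom_space_carrier_iff)
  moreover have "w \<in> words" if "(f \<otimes>\<^bsub>A\<^esub> g) w \<noteq> \<zero>" for w
  proof (cases w)
    case (Mul u v)
    have R: "f u \<in> carrier R" "g v \<in> carrier R"
      using fg by (simp_all add: A_carrier free_hom_space_carrier_iff)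
    have "f u \<otimes> g v \<noteq> \<zero>" using that by (simp add: A_simps Mul)
    then have "f u \<noteq> \<zero>" "g v \<noteq> \<zero>" using R by auto
    then have "u \<in> words" "v \<in> words"
      using fg unfolding A_carrier free_hom_space_carrier_iff by blast+
    then show ?thesis by (simp add: Mul)
  qed (use that in \<open>simp add: A_simps\<close>)
  ultimately show ?thesis
    unfolding A_carrier free_hom_space_carrier_iff by blast
qed

lemma mult_linear:
  assumes "f \<in> carrier A"
  shows "(\<lambda>g. g \<otimes>\<^bsub>A\<^esub> f) \<in> linear_maps R A A" "(\<lambda>g. f \<otimes>\<^bsub>A\<^esub> g) \<in> linear_maps R A A"
proof -
  have val: "g w \<in> carrier R" if "g \<in> carrier A" for g w
    using that by (simp add: A_carrier free_hom_space_carrier_iff)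
  note v = val[OF assms] val
  show "(\<lambda>g. g \<otimes>\<^bsub>A\<^esub> f) \<in> linear_maps R A A"
  proof (rule linear_mapsI)
    show "(x \<oplus>\<^bsub>A\<^esub> y) \<otimes>\<^bsub>A\<^esub> f = x \<otimes>\<^bsub>A\<^esub> f \<oplus>\<^bsub>A\<^esub> y \<otimes>\<^bsub>A\<^esub> f"
      if "x \<in> carrier A" "y \<in> carrier A" for x y
      by (rule ext) (use that in \<open>simp add: A_simps v l_distr split: magma.split\<close>)
    show "(c \<odot>\<^bsub>A\<^esub> x) \<otimes>\<^bsub>A\<^esub> f = c \<odot>\<^bsub>A\<^esub> (x \<otimes>\<^bsub>A\<^esub> f)"
      if "c \<in> carrier R" "x \<in> carrier A" for c x
      using that by (intro ext) (simp add: A_simps v m_assoc split: magma.split)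
  qed (rule mult_closed[OF _ assms])
  show "(\<lambda>g. f \<otimes>\<^bsub>A\<^esub> g) \<in> linear_maps R A A"
  proof (rule linear_mapsI)
    show "f \<otimes>\<^bsub>A\<^esub> (x \<oplus>\<^bsub>A\<^esub> y) = f \<otimes>\<^bsub>A\<^esub> x \<oplus>\<^bsub>A\<^esub> f \<otimes>\<^bsub>A\<^esub> y"
      if "x \<in> carrier A" "y \<in> carrier A" for x y
      by (rule ext) (use that in \<open>simp add: A_simps v r_distr split: magma.split\<close>)
    show "f \<otimes>\<^bsub>A\<^esub> (c \<odot>\<^bsub>A\<^esub> x) = c \<odot>\<^bsub>A\<^esub> (f \<otimes>\<^bsub>A\<^esub> x)"
      if "c \<in> carrier R" "x \<in> carrier A" for c x
      using that m_lcomm[OF v(1) _ v(2)] by (intro ext) (simp add: A_simps split: magma.split)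
  qed (rule mult_closed[OF assms])
qed

lemma mult_basis_vector:
  "basis_vector R u \<otimes>\<^bsub>A\<^esub> basis_vector R v = basis_vector R (Mul u v)"
  by (auto simp: A_simps basis_vector_def fun_eq_iff split: magma.split)

lemma twist_A_linear: "twist A \<in> linear_maps R A A"
proof -
  have "map_magma \<sigma> ` words \<subseteq> words"
    using hom_set by (auto simp: magma.set_map subset_iff Pi_iff)
  from free_hom_space_twist_linear[OF field this]
  show ?thesis by (simp add: free_nonassoc_algebra_def linear_maps_mult_update)
qed

lemma twist_A_basis_vector: "twist A (basis_vector R w) = basis_vector R (map_magma \<sigma> w)"
  using free_hom_space_twist_basis_vector[OF field] by (simp add: free_nonassoc_algebra_def)

lemma twist_A_closed: "f \<in> carrier A \<Longrightarrow> twist A f \<in> carrier A"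
  by (rule linear_maps_closed[OF twist_A_linear])

lemma bilinear_eqI:
  assumes W: "module R W"
    and g: "\<And>f. f \<in> carrier A \<Longrightarrow> (\<lambda>x. g x f) \<in> linear_maps R A W"
      "\<And>f. f \<in> carrier A \<Longrightarrow> (\<lambda>x. g f x) \<in> linear_maps R A W"
    and h: "\<And>f. f \<in> carrier A \<Longrightarrow> (\<lambda>x. h x f) \<in> linear_maps R A W"
      "\<And>f. f \<in> carrier A \<Longrightarrow> (\<lambda>x. h f x) \<in> linear_maps R A W"
    and eq: "\<And>u v. u \<in> words \<Longrightarrow> v \<in> words
      \<Longrightarrow> g (basis_vector R u) (basis_vector R v) = h (basis_vector R u) (basis_vector R v)"
    and xy: "x \<in> carrier A" "y \<in> carrier A"
  shows "g x y = h x y"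
proof -
  have *: "g x (basis_vector R v) = h x (basis_vector R v)" if v: "v \<in> words" for v
  proof (rule A_maps_eqI[where g = "\<lambda>x. g x (basis_vector R v)"
        and h = "\<lambda>x. h x (basis_vector R v)", OF W])
    show "(\<lambda>x. g x (basis_vector R v)) \<in> linear_maps R A W"
      by (rule g(1)[OF basis_vector_A[OF v]])
    show "(\<lambda>x. h x (basis_vector R v)) \<in> linear_maps R A W"
      by (rule h(1)[OF basis_vector_A[OF v]])
    show "g (basis_vector R w) (basis_vector R v) = h (basis_vector R w) (basis_vector R v)"
      if "w \<in> words" for w
      by (rule eq[OF that v])
    show "x \<in> carrier A" by (rule xy(1))
  qed
  show ?thesis
  proof (rule A_maps_eqI[where g = "g x" and h = "h x", OF W])
    show "g x \<in> linear_maps R A W" by (rule g(2)[OF xy(1)])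
    show "h x \<in> linear_maps R A W" by (rule h(2)[OF xy(1)])
    show "g x (basis_vector R w) = h x (basis_vector R w)" if "w \<in> words" for w
      by (rule *[OF that])
    show "y \<in> carrier A" by (rule xy(2))
  qed
qed

lemma twist_A_mult:
  assumes "x \<in> carrier A" "y \<in> carrier A"
  shows "twist A (x \<otimes>\<^bsub>A\<^esub> y) = twist A x \<otimes>\<^bsub>A\<^esub> twist A y"
proof (rule bilinear_eqI[where g = "\<lambda>x y. twist A (x \<otimes>\<^bsub>A\<^esub> y)"
      and h = "\<lambda>x y. twist A x \<otimes>\<^bsub>A\<^esub> twist A y", OF A_module _ _ _ _ _ assms])
  fix f assume f: "f \<in> carrier A"
  show "(\<lambda>x. twist A (x \<otimes>\<^bsub>A\<^esub> f)) \<in> linear_maps R A A"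
    by (rule linear_maps_comp[OF mult_linear(1)[OF f] twist_A_linear])
  show "(\<lambda>x. twist A (f \<otimes>\<^bsub>A\<^esub> x)) \<in> linear_maps R A A"
    by (rule linear_maps_comp[OF mult_linear(2)[OF f] twist_A_linear])
  show "(\<lambda>x. twist A x \<otimes>\<^bsub>A\<^esub> twist A f) \<in> linear_maps R A A"
    by (rule linear_maps_comp[OF twist_A_linear mult_linear(1)[OF twist_A_closed[OF f]]])
  show "(\<lambda>x. twist A f \<otimes>\<^bsub>A\<^esub> twist A x) \<in> linear_maps R A A"
    by (rule linear_maps_comp[OF twist_A_linear mult_linear(2)[OF twist_A_closed[OF f]]])
qed (simp add: mult_basis_vector twist_A_basis_vector)

section \<open>The ideal of Hom-Lie relations\<close>

lemma relations_A_closed: "hom_lie_relations A \<subseteq> carrier A"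
  unfolding hom_lie_relations_def
  by (auto intro!: A.M.a_closed mult_closed twist_A_closed)

lemma I_superset: "hom_lie_relations A \<subseteq> I"
  by (auto simp: generated_ideal_def)

text \<open>Induction principle for the generated ideal: \<open>J\<close> is taken to be the set of
  elements with the property to be proved.\<close>

lemma I_minimal:
  assumes "submodule J R A" "\<And>a x. a \<in> carrier A \<Longrightarrow> x \<in> J \<Longrightarrow> a \<otimes>\<^bsub>A\<^esub> x \<in> J"
    "\<And>a x. a \<in> carrier A \<Longrightarrow> x \<in> J \<Longrightarrow> x \<otimes>\<^bsub>A\<^esub> a \<in> J" "hom_lie_relations A \<subseteq> J"
  shows "I \<subseteq> J"
  using assms by (auto simp: generated_ideal_def)

lemma I_subset: "I \<subseteq> carrier A"
  using A.carrier_is_submodule mult_closed relations_A_closed by (intro I_minimal) auto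

lemma I_submodule: "submodule I R A"
proof -
  have zero: "\<zero>\<^bsub>A\<^esub> \<in> J" if "submodule J R A" for J
    using subgroup.one_closed[OF submodule.axioms(1)[OF that]] by simp
  show ?thesis
    by (rule A.submoduleI[OF I_subset])
      (simp_all add: generated_ideal_def zero A.submoduleE(3-5))
qed

lemma I_ideal:
  assumes "a \<in> carrier A" "x \<in> I"
  shows "a \<otimes>\<^bsub>A\<^esub> x \<in> I" "x \<otimes>\<^bsub>A\<^esub> a \<in> I"
  using assms by (auto simp: generated_ideal_def)

text \<open>The twist is multiplicative and sends a defining relation to the relation of the same
  shape in the twisted elements. The preimage of \<open>I\<close> is therefore an ideal that
  contains all relations.\<close>

lemma twist_I: "x \<in> I \<Longrightarrow> twist A x \<in> I"
proof -
  let ?J = "{x \<in> carrier A. twist A x \<in> I}"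
  have "I \<subseteq> ?J"
  proof (rule I_minimal[OF submodule_vimage[OF A_module A_module twist_A_linear I_submodule]])
    show "hom_lie_relations A \<subseteq> ?J"
    proof
      fix r assume r: "r \<in> hom_lie_relations A"
      have "twist A r \<in> hom_lie_relations A"
        using r unfolding hom_lie_relations_def
      proof (elim UnE CollectE exE conjE)
        fix a b assume "r = a \<otimes>\<^bsub>A\<^esub> b \<oplus>\<^bsub>A\<^esub> b \<otimes>\<^bsub>A\<^esub> a" and ab: "a \<in> carrier A" "b \<in> carrier A"
        then have "twist A r
            = twist A a \<otimes>\<^bsub>A\<^esub> twist A b \<oplus>\<^bsub>A\<^esub> twist A b \<otimes>\<^bsub>A\<^esub> twist A a"
          by (simp add: linear_maps_add[OF twist_A_linear] mult_closed twist_A_mult)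
        then show "twist A r \<in> {a \<otimes>\<^bsub>A\<^esub> b \<oplus>\<^bsub>A\<^esub> b \<otimes>\<^bsub>A\<^esub> a |a b. a \<in> carrier A \<and> b \<in> carrier A} \<union>
          {twist A a \<otimes>\<^bsub>A\<^esub> (b \<otimes>\<^bsub>A\<^esub> c) \<oplus>\<^bsub>A\<^esub> twist A b \<otimes>\<^bsub>A\<^esub> (c \<otimes>\<^bsub>A\<^esub> a) \<oplus>\<^bsub>A\<^esub> twist A c \<otimes>\<^bsub>A\<^esub> (a \<otimes>\<^bsub>A\<^esub> b)
            | a b c. a \<in> carrier A \<and> b \<in> carrier A \<and> c \<in> carrier A}"
          using ab twist_A_closed by blast
      next
        fix a b c assume "r = twist A a \<otimes>\<^bsub>A\<^esub> (b \<otimes>\<^bsub>A\<^esub> c) \<oplus>\<^bsub>A\<^esub> twist A b \<otimes>\<^bsub>A\<^esub> (c \<otimes>\<^bsub>A\<^esub> a)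
            \<oplus>\<^bsub>A\<^esub> twist A c \<otimes>\<^bsub>A\<^esub> (a \<otimes>\<^bsub>A\<^esub> b)"
          and abc: "a \<in> carrier A" "b \<in> carrier A" "c \<in> carrier A"
        then have "twist A r = twist A (twist A a) \<otimes>\<^bsub>A\<^esub> (twist A b \<otimes>\<^bsub>A\<^esub> twist A c)
            \<oplus>\<^bsub>A\<^esub> twist A (twist A b) \<otimes>\<^bsub>A\<^esub> (twist A c \<otimes>\<^bsub>A\<^esub> twist A a)
            \<oplus>\<^bsub>A\<^esub> twist A (twist A c) \<otimes>\<^bsub>A\<^esub> (twist A a \<otimes>\<^bsub>A\<^esub> twist A b)"
          by (simp add: linear_maps_add[OF twist_A_linear] mult_closed twist_A_mult twist_A_closed)
        then show "twist A r \<in> {a \<otimes>\<^bsub>A\<^esub> b \<oplus>\<^bsub>A\<^esub> b \<otimes>\<^bsub>A\<^esub> a |a b. a \<in> carrier A \<and> b \<in> carrier A} \<union>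
          {twist A a \<otimes>\<^bsub>A\<^esub> (b \<otimes>\<^bsub>A\<^esub> c) \<oplus>\<^bsub>A\<^esub> twist A b \<otimes>\<^bsub>A\<^esub> (c \<otimes>\<^bsub>A\<^esub> a) \<oplus>\<^bsub>A\<^esub> twist A c \<otimes>\<^bsub>A\<^esub> (a \<otimes>\<^bsub>A\<^esub> b)
            | a b c. a \<in> carrier A \<and> b \<in> carrier A \<and> c \<in> carrier A}"
          using abc twist_A_closed by blast
      qed
      then show "r \<in> ?J" using r relations_A_closed I_superset by blast
    qed
  qed (auto simp: mult_closed twist_A_mult I_ideal twist_A_closed)
  then show "x \<in> I \<Longrightarrow> twist A x \<in> I" by blast
qed

text \<open>The two factors are changed one after the other. Each change alters the product by a
  multiple of an element of \<open>I\<close>, once from the right and once from the left, so a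
  two-sided ideal is what is needed.\<close>

lemma rcoset_mult_I:
  assumes "a \<in> carrier A" "b \<in> carrier A"
  shows "rcoset_mult A I (I +>\<^bsub>A\<^esub> a) (I +>\<^bsub>A\<^esub> b) = I +>\<^bsub>A\<^esub> (a \<otimes>\<^bsub>A\<^esub> b)"
proof -
  interpret I: abelian_subgroup I A
    by (rule submodule_abelian_subgroup[OF A_module I_submodule])
  have "I +>\<^bsub>A\<^esub> (a' \<otimes>\<^bsub>A\<^esub> b') = I +>\<^bsub>A\<^esub> (a \<otimes>\<^bsub>A\<^esub> b)"
    if "a' \<in> I +>\<^bsub>A\<^esub> a" "b' \<in> I +>\<^bsub>A\<^esub> b" for a' b'
  proof -
    have c: "a' \<in> carrier A" "b' \<in> carrier A"
      using that assms I.a_elemrcos_carrier by blast+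
    have "I +>\<^bsub>A\<^esub> (a' \<otimes>\<^bsub>A\<^esub> b') = I +>\<^bsub>A\<^esub> (a \<otimes>\<^bsub>A\<^esub> b')"
      using that assms c I_ideal(2)[OF c(2)] I.a_rcos_module_imp[of a a']
      by (simp add: coset_eq_iff[OF A_module I_submodule] mult_closed a_minus_def[symmetric]
          linear_maps_minus[OF A_module A_module mult_linear(1), symmetric])
    also have "\<dots> = I +>\<^bsub>A\<^esub> (a \<otimes>\<^bsub>A\<^esub> b)"
      using that assms c I_ideal(1)[OF assms(1)] I.a_rcos_module_imp[of b b']
      by (simp add: coset_eq_iff[OF A_module I_submodule] mult_closed a_minus_def[symmetric]
          linear_maps_minus[OF A_module A_module mult_linear(2), symmetric])
    finally show ?thesis .
  qed
  then show ?thesis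
    unfolding rcoset_mult_def using assms I.a_rcos_self by blast
qed

section \<open>The projection onto a free Hom-Lie algebra and maps defined on brackets\<close>

lemma free_hom_lie_projection:
  assumes F: "hom_lie_algebra R F" and iso: "hom_lie_iso R F (free_hom_lie_algebra R X \<sigma>)"
  obtains q where "q \<in> linear_maps R A F" "q ` carrier A = carrier F"
    "\<And>a. a \<in> carrier A \<Longrightarrow> q a = \<zero>\<^bsub>F\<^esub> \<longleftrightarrow> a \<in> I"
    "\<And>a b. a \<in> carrier A \<Longrightarrow> b \<in> carrier A \<Longrightarrow> q (a \<otimes>\<^bsub>A\<^esub> b) = q a \<otimes>\<^bsub>F\<^esub> q b"
    "\<And>a. a \<in> carrier A \<Longrightarrow> q (twist A a) = twist F (q a)"
proof -
  interpret F: hom_lie_algebra R F by fact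
  let ?Q = "free_hom_lie_algebra R X \<sigma>" and ?\<pi> = "\<lambda>a. I +>\<^bsub>A\<^esub> a"
  obtain i where i: "i \<in> hom_lie_morphisms R F ?Q" "bij_betw i (carrier F) (carrier ?Q)"
    using iso by (auto simp: hom_lie_iso_def)
  have Q: "?Q = hom_quotient A I" by (simp add: free_hom_lie_algebra_def)
  have i_linear: "i \<in> linear_maps R F ?Q"
    using i by (simp add: hom_lie_morphisms_def hom_space_morphisms_def)
  let ?j = "inv_into (carrier F) i"
  define q where "q = (\<lambda>a. ?j (?\<pi> a))"
  have \<pi>: "?\<pi> \<in> linear_maps R A ?Q"
    unfolding Q by (rule coset_linear[OF A_module I_submodule])
  have carQ: "carrier ?Q = ?\<pi> ` carrier A"
    by (simp add: Q hom_quotient_simps)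
  have j: "?j \<in> linear_maps R ?Q F" "?j ` carrier ?Q = carrier F"
    using linear_maps_inv_into[OF F.module_L i_linear i(2)]
      bij_betw_inv_into[OF i(2)] by (auto simp: bij_betw_def)
  have q: "q \<in> linear_maps R A F"
    unfolding q_def by (rule linear_maps_comp[OF \<pi> j(1)])
  have iq: "i (q a) = ?\<pi> a" if "a \<in> carrier A" for a
    using that i(2) carQ by (auto simp: q_def bij_betw_def f_inv_into_f)
  \<comment> \<open>Since \<open>i\<close> is injective on \<open>carrier F\<close>, a value of
    \<open>q\<close> is identified by its image under \<open>i\<close>. In this way the morphism
    properties of \<open>i\<close> pass to its inverse.\<close>
  have qI: "q a = x" if "x \<in> carrier F" "i x = ?\<pi> a" for a x
    using that i(2) by (simp add: q_def bij_betw_inv_into_left flip: that(2))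
  show thesis
  proof (rule that[OF q])
    show "q ` carrier A = carrier F"
      using j(2) by (simp add: q_def carQ image_image)
  next
    fix a assume a: "a \<in> carrier A"
    have "q a = \<zero>\<^bsub>F\<^esub> \<longleftrightarrow> ?\<pi> a = I"
      using a iq[OF a] qI[of "\<zero>\<^bsub>F\<^esub>" a] linear_maps_zero[OF F.module_L _ i_linear]
        hom_quotient_module[OF A_module I_submodule]
      by (auto simp: Q hom_quotient_simps)
    then show "q a = \<zero>\<^bsub>F\<^esub> \<longleftrightarrow> a \<in> I"
      by (simp add: coset_eq_zero_iff[OF A_module I_submodule a])
  next
    fix a b assume ab: "a \<in> carrier A" "b \<in> carrier A"
    show "q (a \<otimes>\<^bsub>A\<^esub> b) = q a \<otimes>\<^bsub>F\<^esub> q b"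
      using ab i(1) linear_maps_closed[OF q]
      by (intro qI F.bracket_closed)
        (auto simp: hom_lie_morphisms_def iq Q hom_quotient_simps rcoset_mult_I)
  next
    fix a assume a: "a \<in> carrier A"
    have "i (twist F (q a)) = twist ?Q (?\<pi> a)"
      using a i(1) linear_maps_closed[OF q]
      by (simp add: hom_lie_morphisms_def hom_space_morphisms_def iq)
    also have "\<dots> = ?\<pi> (twist A a)"
      unfolding Q by (rule hom_quotient_twist[OF A_module I_submodule twist_A_linear twist_I a])
    finally show "q (twist A a) = twist F (q a)"
      using a linear_maps_closed[OF q] by (intro qI F.twist_closed)
  qed
qed

text \<open>
  The linear map \<open>u v \<mapsto> G u v\<close> on \<open>A\<close> vanishes on \<open>I\<close> because its kernel within \<open>I\<close> is an ideal,
  \<open>G\<close> being evaluated in \<open>F = A / I\<close>.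
\<close>

lemma bracket_extension:
  assumes F: "hom_lie_algebra R F" and iso: "hom_lie_iso R F (free_hom_lie_algebra R X \<sigma>)"
    and W: "module R W"
    and G1: "\<And>y. y \<in> carrier F \<Longrightarrow> (\<lambda>x. G x y) \<in> linear_maps R F W"
    and G2: "\<And>x. x \<in> carrier F \<Longrightarrow> (\<lambda>y. G x y) \<in> linear_maps R F W"
    and skew: "\<And>x y. x \<in> carrier F \<Longrightarrow> y \<in> carrier F \<Longrightarrow> G x y \<oplus>\<^bsub>W\<^esub> G y x = \<zero>\<^bsub>W\<^esub>"
    and jacobi: "\<And>x y z. x \<in> carrier F \<Longrightarrow> y \<in> carrier F \<Longrightarrow> z \<in> carrier F \<Longrightarrow>
      G (twist F x) (y \<otimes>\<^bsub>F\<^esub> z) \<oplus>\<^bsub>W\<^esub> G (twist F y) (z \<otimes>\<^bsub>F\<^esub> x) \<oplus>\<^bsub>W\<^esub> G (twist F z) (x \<otimes>\<^bsub>F\<^esub> y) = \<zero>\<^bsub>W\<^esub>"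
  obtains \<theta> where "\<theta> \<in> linear_maps R F W"
    "\<And>x y. x \<in> carrier F \<Longrightarrow> y \<in> carrier F \<Longrightarrow> \<theta> (x \<otimes>\<^bsub>F\<^esub> y) = G x y"
proof -
  interpret F: hom_lie_algebra R F by fact
  interpret W: module R W by fact
  obtain q where q: "q \<in> linear_maps R A F" and q_surj: "q ` carrier A = carrier F"
    and q_zero: "\<And>a. a \<in> carrier A \<Longrightarrow> q a = \<zero>\<^bsub>F\<^esub> \<longleftrightarrow> a \<in> I"
    and q_mult: "\<And>a b. a \<in> carrier A \<Longrightarrow> b \<in> carrier A \<Longrightarrow> q (a \<otimes>\<^bsub>A\<^esub> b) = q a \<otimes>\<^bsub>F\<^esub> q b"
    and q_twist: "\<And>a. a \<in> carrier A \<Longrightarrow> q (twist A a) = twist F (q a)"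
    using free_hom_lie_projection[OF F iso] by blast
  note q_closed = linear_maps_closed[OF q]
  let ?e = "basis_vector R"
  \<comment> \<open>A word that is not a generator has exactly one pair of factors \<open>u\<close>
    and \<open>v\<close>, so any choice of values is consistent here. Only the values on products
    are dictated by \<open>G\<close>; zero on generators is one possible choice.\<close>
  define g where "g w = (case w of Gen x \<Rightarrow> \<zero>\<^bsub>W\<^esub> | Mul u v \<Rightarrow> G (q (?e u)) (q (?e v)))" for w
  define \<psi> where "\<psi> = linear_extension R W g"
  have g: "g w \<in> carrier W" if "w \<in> words" for w
    using that by (auto simp: g_def intro!: linear_maps_closed[OF G1] q_closed basis_vector_A
        split: magma.split)
  have \<psi>: "\<psi> \<in> linear_maps R A W"
    using linear_extension_linear[OF field W, of g words "map_magma \<sigma>"] g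
    by (auto simp: \<psi>_def free_nonassoc_algebra_def linear_maps_mult_update)
  have \<psi>_mult: "\<psi> (a \<otimes>\<^bsub>A\<^esub> b) = G (q a) (q b)" if "a \<in> carrier A" "b \<in> carrier A" for a b
  proof (rule bilinear_eqI[where g = "\<lambda>a b. \<psi> (a \<otimes>\<^bsub>A\<^esub> b)" and h = "\<lambda>a b. G (q a) (q b)",
        OF W _ _ _ _ _ that])
    show "(\<lambda>x. \<psi> (x \<otimes>\<^bsub>A\<^esub> f)) \<in> linear_maps R A W" "(\<lambda>x. \<psi> (f \<otimes>\<^bsub>A\<^esub> x)) \<in> linear_maps R A W"
      "(\<lambda>x. G (q x) (q f)) \<in> linear_maps R A W" "(\<lambda>x. G (q f) (q x)) \<in> linear_maps R A W"
      if f: "f \<in> carrier A" for f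
      using linear_maps_comp[OF mult_linear(1)[OF f] \<psi>] linear_maps_comp[OF mult_linear(2)[OF f] \<psi>]
        linear_maps_comp[OF q G1[OF q_closed[OF f]]] linear_maps_comp[OF q G2[OF q_closed[OF f]]]
      by simp_all
    show "\<psi> (?e u \<otimes>\<^bsub>A\<^esub> ?e v) = G (q (?e u)) (q (?e v))" if "u \<in> words" "v \<in> words" for u v
      unfolding mult_basis_vector \<psi>_def
      using linear_extension_basis_vector[OF field W, of g "Mul u v"] g[of "Mul u v"] that
      by (simp add: g_def)
  qed
  define J where "J = I \<inter> {x \<in> carrier A. \<psi> x = \<zero>\<^bsub>W\<^esub>}"
  have "I \<subseteq> J"
  proof (rule I_minimal)
    show "submodule J R A"
      unfolding J_def by (rule submodule_Int[OF A_module I_submodule submodule_kernel[OF A_module W \<psi>]])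
    \<comment> \<open>For \<open>x\<close> in \<open>I\<close> the element \<open>q x\<close> is
      zero, so \<open>\<psi>_mult\<close> and the linearity of \<open>G\<close> in that argument
      make the product vanish.\<close>
    show "a \<otimes>\<^bsub>A\<^esub> x \<in> J" if "a \<in> carrier A" "x \<in> J" for a x
      using that linear_maps_zero[OF F.module_L W G2[OF q_closed[OF that(1)]]] q_zero[of x]
      by (auto simp: J_def I_ideal mult_closed \<psi>_mult)
    show "x \<otimes>\<^bsub>A\<^esub> a \<in> J" if "a \<in> carrier A" "x \<in> J" for a x
      using that linear_maps_zero[OF F.module_L W G1[OF q_closed[OF that(1)]]] q_zero[of x]
      by (auto simp: J_def I_ideal mult_closed \<psi>_mult)
    \<comment> \<open>Through \<open>\<psi>_mult\<close> the two families of relations turn into the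
      hypotheses \<open>skew\<close> and \<open>jacobi\<close>.\<close>
    have "\<psi> r = \<zero>\<^bsub>W\<^esub>" if "r \<in> hom_lie_relations A" for r
      using that unfolding hom_lie_relations_def
      by (auto simp: linear_maps_add[OF \<psi>] mult_closed twist_A_closed A.M.a_closed \<psi>_mult q_mult
          q_twist skew jacobi q_closed)
    then show "hom_lie_relations A \<subseteq> J"
      using I_superset relations_A_closed by (auto simp: J_def)
  qed
  then have ker: "\<psi> a = \<zero>\<^bsub>W\<^esub>" if "a \<in> carrier A" "q a = \<zero>\<^bsub>F\<^esub>" for a
    using that q_zero by (auto simp: J_def)
  obtain \<theta> where \<theta>: "\<theta> \<in> linear_maps R F W" "\<And>a. a \<in> carrier A \<Longrightarrow> \<theta> (q a) = \<psi> a"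
    using factor_through_surjection[OF A_module F.module_L W q q_surj \<psi> ker] by blast
  have "\<theta> (x \<otimes>\<^bsub>F\<^esub> y) = G x y" if "x \<in> carrier F" "y \<in> carrier F" for x y
  proof -
    obtain a b where ab: "a \<in> carrier A" "b \<in> carrier A" "x = q a" "y = q b"
      using \<open>x \<in> carrier F\<close> \<open>y \<in> carrier F\<close> unfolding q_surj[symmetric] by blast
    then show ?thesis
      using \<theta>(2)[OF mult_closed[OF ab(1,2)]] by (simp add: q_mult \<psi>_mult)
  qed
  with \<theta>(1) show thesis by (rule that)
qed

end

section \<open>Hopf's formula\<close>

context free_presentation
begin

abbreviation FF where "FF \<equiv> bracket_span R F (carrier F) (carrier F)"

abbreviation FK where "FK \<equiv> bracket_span R F (carrier F) K"

lemma p_linear: "p \<in> linear_maps R F L"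
  and p_bracket: "x \<in> carrier F \<Longrightarrow> y \<in> carrier F \<Longrightarrow> p (x \<otimes>\<^bsub>F\<^esub> y) = p x \<otimes>\<^bsub>L\<^esub> p y"
  and p_twist: "x \<in> carrier F \<Longrightarrow> p (twist F x) = twist L (p x)"
  using morphism by (auto simp: hom_lie_morphisms_def hom_space_morphisms_def)

lemmas p_closed = linear_maps_closed[OF p_linear]

lemma p_eq_zero_iff: "x \<in> carrier F \<Longrightarrow> p x = \<zero>\<^bsub>L\<^esub> \<longleftrightarrow> x \<in> K"
  unfolding exact[symmetric] a_kernel_def' by simp

lemma K_submodule: "submodule K R F" ..

lemma K_subset: "K \<subseteq> carrier F"
  by (rule F.submoduleE(1)[OF K_submodule])

lemma bracket_span_submodule:
  "H \<subseteq> carrier F \<Longrightarrow> submodule (bracket_span R F (carrier F) H) R F"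
  unfolding bracket_span_def
  by (rule submodule_linear_span[OF F.module_L]) (auto intro: F.bracket_closed)

lemma bracket_span_least:
  assumes "submodule M R F" "\<And>x h. x \<in> carrier F \<Longrightarrow> h \<in> H \<Longrightarrow> x \<otimes>\<^bsub>F\<^esub> h \<in> M"
  shows "bracket_span R F (carrier F) H \<subseteq> M"
  unfolding bracket_span_def by (rule linear_span_minimal[OF assms(1)]) (use assms(2) in blast)

lemma bracket_span_mem:
  "x \<in> carrier F \<Longrightarrow> h \<in> H \<Longrightarrow> x \<otimes>\<^bsub>F\<^esub> h \<in> bracket_span R F (carrier F) H"
  unfolding bracket_span_def by (rule linear_span_superset[THEN subsetD]) blast

lemmas FK_submodule = bracket_span_submodule[OF K_subset]
lemmas FF_submodule = bracket_span_submodule[OF order_refl]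

text \<open>Both inclusions are needed for the Schur multiplier to be a quotient by a submodule. As
  \<open>bracket_ideal\<close> multiplies by elements of F from the right, antisymmetry is used to
  turn the bracket around.\<close>

lemma FK_subset: "FK \<subseteq> K \<inter> FF"
proof -
  have "x \<otimes>\<^bsub>F\<^esub> k \<in> K" if "x \<in> carrier F" "k \<in> K" for x k
    using that K_subset F.bracket_skew[of x k] K.bracket_ideal F.submoduleE(3)[OF K_submodule] by auto
  then show ?thesis
    using K_subset by (intro Int_greatest bracket_span_least K_submodule FF_submodule)
      (auto intro: bracket_span_mem)
qed

lemma FK_mem_left:
  assumes "x \<in> carrier F" "k \<in> K" shows "k \<otimes>\<^bsub>F\<^esub> x \<in> FK"
  using assms K_subset F.bracket_skew[of k x] bracket_span_mem[of x k K]
    F.submoduleE(3)[OF FK_submodule] by auto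

text \<open>By multiplicativity the twist maps generating brackets to generating brackets.\<close>

lemma twist_bracket_span:
  assumes "H \<subseteq> carrier F" "\<And>h. h \<in> H \<Longrightarrow> twist F h \<in> H"
    and "x \<in> bracket_span R F (carrier F) H"
  shows "twist F x \<in> bracket_span R F (carrier F) H"
proof -
  have "bracket_span R F (carrier F) H
      \<subseteq> {x \<in> carrier F. twist F x \<in> bracket_span R F (carrier F) H}"
    by (rule bracket_span_least[OF submodule_vimage[OF F.module_L F.module_L F.twist_linear
            bracket_span_submodule[OF assms(1)]]])
      (use assms(1,2) in \<open>auto simp: F.bracket_closed F.twist_bracket F.twist_closed subset_iff
        intro!: bracket_span_mem\<close>)
  then show ?thesis using assms(3) by blast
qed

section \<open>Brackets modulo [F, K] and the lift of pairs\<close>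

abbreviation cls where "cls a \<equiv> FK +>\<^bsub>F\<^esub> a"

lemma cls_linear: "(\<lambda>a. cls a) \<in> linear_maps R F (hom_quotient F FK)"
  by (rule coset_linear[OF F.module_L FK_submodule])

lemma quotient_module: "module R (hom_quotient F FK)"
  by (rule hom_quotient_module[OF F.module_L FK_submodule])

lemma diff_mem_K:
  assumes "a \<in> carrier F" "a' \<in> carrier F" "p a = p a'"
  shows "a \<ominus>\<^bsub>F\<^esub> a' \<in> K"
  using assms p_closed
  by (simp add: p_eq_zero_iff[symmetric] linear_maps_minus[OF F.module_L L.module_L p_linear]
      L.M.minus_eq_zero_iff)

text \<open>Changing one factor within its fibre over L adds an element of \<open>K\<close> to it,
  hence an element of [F, K] to the bracket. The two factors are changed in turn.\<close>

lemma cls_bracket_cong: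
  assumes "a \<in> carrier F" "a' \<in> carrier F" "b \<in> carrier F" "b' \<in> carrier F"
    and "p a = p a'" "p b = p b'"
  shows "cls (a \<otimes>\<^bsub>F\<^esub> b) = cls (a' \<otimes>\<^bsub>F\<^esub> b')"
proof -
  have "cls (a \<otimes>\<^bsub>F\<^esub> b) = cls (a' \<otimes>\<^bsub>F\<^esub> b)"
    using assms FK_mem_left[of b "a \<ominus>\<^bsub>F\<^esub> a'"] diff_mem_K[of a a']
    by (simp add: coset_eq_iff[OF F.module_L FK_submodule] F.bracket_closed
        linear_maps_minus[OF F.module_L F.module_L F.bracket_linear(1)])
  also have "\<dots> = cls (a' \<otimes>\<^bsub>F\<^esub> b')"
    using assms bracket_span_mem[of a' "b \<ominus>\<^bsub>F\<^esub> b'" K] diff_mem_K[of b b']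
    by (simp add: coset_eq_iff[OF F.module_L FK_submodule] F.bracket_closed
        linear_maps_minus[OF F.module_L F.module_L F.bracket_linear(2)])
  finally show ?thesis .
qed

text \<open>A merely set-theoretic section: it need not be linear, multiplicative or compatible with
  the twists.\<close>

definition sect where "sect = inv_into (carrier F) p"

lemma sect_closed: "x \<in> carrier L \<Longrightarrow> sect x \<in> carrier F"
  and p_sect: "x \<in> carrier L \<Longrightarrow> p (sect x) = x"
  unfolding sect_def surjective[symmetric] by (auto intro: inv_into_into f_inv_into_f)

text \<open>Being defined on formal combinations of pairs, this map is linear although
  \<open>sect\<close> may fail to be. Its values depend on \<open>sect\<close>, their classes modulo
  [F, K] do not.\<close>

definition lift where
  "lift = linear_extension R F (\<lambda>xs. sect (xs ! 0) \<otimes>\<^bsub>F\<^esub> sect (xs ! 1))"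

lemma lift_linear: "lift \<in> linear_maps R (L.tuples 2) F"
  unfolding lift_def by (rule L.tuples_extension_linear[OF F.module_L])
    (auto elim!: L.length_2_cases simp: F.bracket_closed sect_closed)

lemma lift_basis_vector:
  "x \<in> carrier L \<Longrightarrow> y \<in> carrier L \<Longrightarrow> lift (basis_vector R [x, y]) = sect x \<otimes>\<^bsub>F\<^esub> sect y"
  unfolding lift_def
  by (subst linear_extension_basis_vector[OF L.field F.module_L])
    (auto intro: F.bracket_closed sect_closed)

lemma cls_lift:
  assumes "a \<in> carrier F" "b \<in> carrier F"
  shows "cls (lift (basis_vector R [p a, p b])) = cls (a \<otimes>\<^bsub>F\<^esub> b)"
  unfolding lift_basis_vector[OF p_closed[OF assms(1)] p_closed[OF assms(2)]]
  by (rule cls_bracket_cong) (use assms in \<open>simp_all add: p_closed sect_closed p_sect\<close>)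

lemma cls_lift_linear: "(\<lambda>t. cls (lift t)) \<in> linear_maps R (L.tuples 2) (hom_quotient F FK)"
  by (rule linear_maps_comp[OF lift_linear cls_linear])

text \<open>The sum of \<open>sect x\<close> and \<open>sect x'\<close> is a preimage of the sum of
  x and x', and by \<open>cls_lift\<close> every preimage gives the same class. Additivity is thus
  inherited from the bracket of F, and scalars are handled alike.\<close>

lemma cls_lift_left:
  assumes y: "y \<in> carrier L"
  shows "(\<lambda>x. cls (lift (basis_vector R [x, y]))) \<in> linear_maps R L (hom_quotient F FK)"
proof -
  have *: "cls (lift (basis_vector R [x, y])) = cls (a \<otimes>\<^bsub>F\<^esub> sect y)"
    if "a \<in> carrier F" "x = p a" for x a
    using cls_lift[OF that(1) sect_closed[OF y]] that y by (simp add: p_sect)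
  note lin = linear_maps_comp[OF F.bracket_linear(1)[OF sect_closed[OF y]] cls_linear]
  show ?thesis
  proof (rule linear_mapsI)
    fix x assume x: "x \<in> carrier L"
    show "cls (lift (basis_vector R [x, y])) \<in> carrier (hom_quotient F FK)"
      using x y by (intro linear_maps_closed[OF cls_lift_linear] L.basis_vector_tuples) auto
    { fix x' assume x': "x' \<in> carrier L"
      show "cls (lift (basis_vector R [x \<oplus>\<^bsub>L\<^esub> x', y])) = cls (lift (basis_vector R [x, y]))
          \<oplus>\<^bsub>hom_quotient F FK\<^esub> cls (lift (basis_vector R [x', y]))"
        using x x' *[of "sect x \<oplus>\<^bsub>F\<^esub> sect x'"] linear_maps_add[OF lin, of "sect x" "sect x'"]
        by (simp add: sect_closed p_sect linear_maps_add[OF p_linear] *[of "sect x" x]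
            *[of "sect x'" x']) }
    fix c assume c: "c \<in> carrier R"
    show "cls (lift (basis_vector R [c \<odot>\<^bsub>L\<^esub> x, y]))
        = c \<odot>\<^bsub>hom_quotient F FK\<^esub> cls (lift (basis_vector R [x, y]))"
      using x c *[of "c \<odot>\<^bsub>F\<^esub> sect x"] linear_maps_smult[OF lin, of c "sect x"]
      by (simp add: sect_closed p_sect linear_maps_smult[OF p_linear] *[of "sect x" x])
  qed
qed

lemma cls_lift_relations:
  assumes "t \<in> L.relations 2"
  shows "cls (lift t) = \<zero>\<^bsub>hom_quotient F FK\<^esub>"
proof (rule L.relations_vanish_2[OF quotient_module cls_lift_linear cls_lift_left _ assms])
  fix x y assume "x \<in> carrier L" "y \<in> carrier L"
  then show "cls (lift (basis_vector R [y, x]))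
      = \<ominus>\<^bsub>hom_quotient F FK\<^esub> cls (lift (basis_vector R [x, y]))"
    using F.bracket_skew[of "sect y" "sect x"]
      linear_maps_neg[OF F.module_L quotient_module cls_linear, of "sect x \<otimes>\<^bsub>F\<^esub> sect y"]
    by (simp add: lift_basis_vector sect_closed F.bracket_closed)
qed

lemma cls_lift_boundary:
  assumes "s \<in> carrier (L.tuples 3)"
  shows "cls (lift (L.boundary 3 s)) = \<zero>\<^bsub>hom_quotient F FK\<^esub>"
proof -
  interpret Q: module R "hom_quotient F FK" by (rule quotient_module)
  show ?thesis
  proof (rule L.tuples_maps_eqI[OF quotient_module
        linear_maps_comp[OF L.boundary_3_linear cls_lift_linear] _ _ assms])
    show "(\<lambda>_. \<zero>\<^bsub>hom_quotient F FK\<^esub>) \<in> linear_maps R (L.tuples 3) (hom_quotient F FK)"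
      by (rule linear_mapsI) auto
    fix xs assume "length xs = 3" "set xs \<subseteq> carrier L"
    then obtain x y z where xyz: "xs = [x, y, z]" "x \<in> carrier L" "y \<in> carrier L" "z \<in> carrier L"
      by (rule L.length_3_cases)
    \<comment> \<open>As preimages serve the bracket of \<open>sect x\<close> and
      \<open>sect y\<close>, and \<open>twist F (sect z)\<close>; with this choice the cyclic sum
      becomes an instance of the Hom-Jacobi identity in F.\<close>
    have *: "cls (lift (basis_vector R [x \<otimes>\<^bsub>L\<^esub> y, twist L z]))
        = \<ominus>\<^bsub>hom_quotient F FK\<^esub> cls (twist F (sect z) \<otimes>\<^bsub>F\<^esub> (sect x \<otimes>\<^bsub>F\<^esub> sect y))"
      if "x \<in> carrier L" "y \<in> carrier L" "z \<in> carrier L" for x y z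
      using that cls_lift[of "sect x \<otimes>\<^bsub>F\<^esub> sect y" "twist F (sect z)"]
        F.bracket_skew[of "sect x \<otimes>\<^bsub>F\<^esub> sect y" "twist F (sect z)"]
        linear_maps_neg[OF F.module_L quotient_module cls_linear,
          of "twist F (sect z) \<otimes>\<^bsub>F\<^esub> (sect x \<otimes>\<^bsub>F\<^esub> sect y)"]
      by (simp add: sect_closed F.bracket_closed F.twist_closed p_bracket p_twist p_sect)
    define j where "j a b c = twist F (sect a) \<otimes>\<^bsub>F\<^esub> (sect b \<otimes>\<^bsub>F\<^esub> sect c)" for a b c
    have j: "j a b c \<in> carrier F" if "a \<in> carrier L" "b \<in> carrier L" "c \<in> carrier L" for a b c
      using that by (simp add: j_def sect_closed F.bracket_closed F.twist_closed)
    have "cls (j x y z \<oplus>\<^bsub>F\<^esub> j y z x \<oplus>\<^bsub>F\<^esub> j z x y) = \<zero>\<^bsub>hom_quotient F FK\<^esub>"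
      using xyz linear_maps_zero[OF F.module_L quotient_module cls_linear]
      by (simp add: j_def F.hom_jacobi sect_closed)
    then have "cls (j x y z) \<oplus>\<^bsub>hom_quotient F FK\<^esub> (cls (j y z x)
        \<oplus>\<^bsub>hom_quotient F FK\<^esub> cls (j z x y)) = \<zero>\<^bsub>hom_quotient F FK\<^esub>"
      using xyz j linear_maps_closed[OF cls_linear]
      by (simp add: linear_maps_add[OF cls_linear] Q.M.a_assoc)
    then show "cls (lift (L.boundary 3 (basis_vector R xs))) = \<zero>\<^bsub>hom_quotient F FK\<^esub>"
      using xyz j linear_maps_closed[OF cls_linear]
      by (simp add: L.linear_map_boundary_3[OF quotient_module cls_lift_linear cls_lift_left] *
          j_def[symmetric] Q.M.minus_add Q.M.a_ac)
  qed
qed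

text \<open>The statement is modulo [F, K] because \<open>twist F (sect x)\<close> and
  \<open>sect (twist L x)\<close> are two possibly different preimages of the same element.\<close>

lemma lift_twist:
  assumes "t \<in> carrier (L.tuples 2)"
  shows "cls (lift (twist (L.tuples 2) t)) = cls (twist F (lift t))"
proof (rule L.tuples_maps_eqI[OF quotient_module
      linear_maps_comp[OF L.twist_tuples_linear cls_lift_linear]
      linear_maps_comp[OF linear_maps_comp[OF lift_linear F.twist_linear] cls_linear] _ assms])
  fix xs assume "length xs = 2" "set xs \<subseteq> carrier L"
  then obtain x y where xy: "xs = [x, y]" "x \<in> carrier L" "y \<in> carrier L"
    by (rule L.length_2_cases)
  then show "cls (lift (twist (L.tuples 2) (basis_vector R xs)))
      = cls (twist F (lift (basis_vector R xs)))"
    using cls_lift[of "twist F (sect x)" "twist F (sect y)"]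
    by (simp add: L.twist_tuples_basis_vector lift_basis_vector sect_closed F.twist_bracket
        F.twist_closed p_twist p_sect)
qed

text \<open>This equation holds exactly, without passing to classes. It identifies the
  representatives of cycles as the combinations whose lift lies in \<open>K\<close>.\<close>

lemma p_lift:
  assumes "t \<in> carrier (L.tuples 2)"
  shows "p (lift t) = L.bracket_map t"
  by (rule L.tuples_maps_eqI[OF L.module_L linear_maps_comp[OF lift_linear p_linear]
        L.bracket_map_linear _ assms])
    (auto elim!: L.length_2_cases simp: lift_basis_vector L.bracket_map_basis_vector p_bracket
      sect_closed p_sect)

lemma lift_mem_FF:
  assumes "t \<in> carrier (L.tuples 2)"
  shows "lift t \<in> FF"
proof -
  have "t \<in> {t \<in> carrier (L.tuples 2). lift t \<in> FF}"
    by (rule L.tuples_spanned[OF submodule_vimage[OF L.tuples_module F.module_L lift_linear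
            FF_submodule] _ assms])
      (auto elim!: L.length_2_cases simp: lift_basis_vector
        intro!: L.basis_vector_tuples bracket_span_mem sect_closed)
  then show ?thesis by simp
qed

text \<open>The bracket of a and b is reached, modulo [F, K], by the pair of p a and p b, and the
  classes reached form a submodule.\<close>

lemma lift_surj:
  assumes "r \<in> FF"
  obtains t where "t \<in> carrier (L.tuples 2)" "cls (lift t) = cls r"
proof -
  have "FF \<subseteq> {r \<in> carrier F. cls r \<in> (\<lambda>t. cls (lift t)) ` carrier (L.tuples 2)}"
  proof (rule bracket_span_least[OF submodule_vimage[OF F.module_L quotient_module cls_linear
          submodule_image[OF L.tuples_module quotient_module cls_lift_linear
            module.carrier_is_submodule[OF L.tuples_module]]]])
    fix a b assume ab: "a \<in> carrier F" "b \<in> carrier F"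
    then have "basis_vector R [p a, p b] \<in> carrier (L.tuples 2)"
      by (auto intro!: L.basis_vector_tuples p_closed)
    then show "a \<otimes>\<^bsub>F\<^esub> b \<in> {r \<in> carrier F. cls r \<in> (\<lambda>t. cls (lift t)) ` carrier (L.tuples 2)}"
      using ab by (auto simp: F.bracket_closed cls_lift[symmetric])
  qed
  then show thesis using assms that by blast
qed

section \<open>The kernel of the lift modulo [F, K]\<close>

abbreviation boundaries where "boundaries \<equiv> {t \<in> carrier (L.tuples 2).
  \<exists>s\<in>carrier (L.tuples 3). t \<ominus>\<^bsub>L.tuples 2\<^esub> L.boundary 3 s \<in> L.relations 2}"

text \<open>\<open>boundaries\<close> is the preimage, in formal combinations of pairs, of the image
  of the boundary in the exterior square. Dividing by it yields the exterior square modulo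
  boundaries in a single step.\<close>

lemma boundaries_submodule: "submodule boundaries R (L.tuples 2)"
proof -
  let ?\<pi> = "\<lambda>t. L.relations 2 +>\<^bsub>L.tuples 2\<^esub> t"
  have "submodule ((\<lambda>s. ?\<pi> (L.boundary 3 s)) ` carrier (L.tuples 3)) R (exterior_power R L 2)"
    by (rule submodule_image[OF L.tuples_module L.exterior_power_module
          linear_maps_comp[OF L.boundary_3_linear L.projection_linear]
          module.carrier_is_submodule[OF L.tuples_module]])
  from submodule_vimage[OF L.tuples_module L.exterior_power_module L.projection_linear this]
  have "submodule {t \<in> carrier (L.tuples 2).
      ?\<pi> t \<in> (\<lambda>s. ?\<pi> (L.boundary 3 s)) ` carrier (L.tuples 3)} R (L.tuples 2)" .
  also have "{t \<in> carrier (L.tuples 2). ?\<pi> t \<in> (\<lambda>s. ?\<pi> (L.boundary 3 s)) ` carrier (L.tuples 3)}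
      = boundaries"
    using linear_maps_closed[OF L.boundary_3_linear]
    by (intro Collect_cong conj_cong refl) (auto simp: L.projection_eq_iff[symmetric])
  finally show ?thesis .
qed

text \<open>This equality of kernels is the core of the formula. From right to left,
  \<open>lift\<close> kills relations and boundaries modulo [F, K]. From left to right, a linear map
  \<open>\<theta>\<close> on F is constructed that kills [F, K] and recovers from
  \<open>lift t\<close> the class of \<open>t\<close> modulo boundaries.\<close>

lemma boundaries_iff:
  assumes t: "t \<in> carrier (L.tuples 2)"
  shows "lift t \<in> FK \<longleftrightarrow> t \<in> boundaries"
proof
  interpret T: module R "L.tuples 2" by (rule L.tuples_module)
  interpret T3: module R "L.tuples 3" by (rule L.tuples_module)
  interpret S: module R "hom_quotient F FK" by (rule quotient_module)
  let ?Z = "\<zero>\<^bsub>hom_quotient F FK\<^esub>"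
  note lift_closed = linear_maps_closed[OF lift_linear]
  have cls_zero: "cls a = ?Z \<longleftrightarrow> a \<in> FK" if "a \<in> carrier F" for a
    using that by (simp add: hom_quotient_simps coset_eq_zero_iff[OF F.module_L FK_submodule])
  show "lift t \<in> FK" if "t \<in> boundaries"
  proof -
    from that obtain s where s: "s \<in> carrier (L.tuples 3)"
      "t \<ominus>\<^bsub>L.tuples 2\<^esub> L.boundary 3 s \<in> L.relations 2" by blast
    have "cls (lift t) \<ominus>\<^bsub>hom_quotient F FK\<^esub> cls (lift (L.boundary 3 s)) = ?Z"
      using cls_lift_relations[OF s(2)] t s(1) linear_maps_closed[OF L.boundary_3_linear]
      by (simp add: linear_maps_minus[OF L.tuples_module quotient_module cls_lift_linear])
    then have "cls (lift t) = ?Z"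
      using t s(1) linear_maps_closed[OF cls_lift_linear] by (simp add: cls_lift_boundary S.M.minus_eq_zero_iff)
    then show ?thesis using t lift_closed cls_zero by blast
  qed
  let ?Q = "hom_quotient (L.tuples 2) boundaries" and ?c = "\<lambda>t. boundaries +>\<^bsub>L.tuples 2\<^esub> t"
  have Q: "module R ?Q"
    by (rule hom_quotient_module[OF L.tuples_module boundaries_submodule])
  interpret Q: module R ?Q by (rule Q)
  have c: "?c \<in> linear_maps R (L.tuples 2) ?Q"
    by (rule coset_linear[OF L.tuples_module boundaries_submodule])
  have c_zero: "?c t = \<zero>\<^bsub>?Q\<^esub> \<longleftrightarrow> t \<in> boundaries" if "t \<in> carrier (L.tuples 2)" for t
    using that by (simp only: hom_quotient_simps coset_eq_zero_iff[OF L.tuples_module boundaries_submodule])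
  have c_relations: "?c t = \<zero>\<^bsub>?Q\<^esub>"
    if "t \<in> carrier (L.tuples 2)" "t \<in> L.relations 2" for t
  proof -
    \<comment> \<open>The witness zero shows that \<open>boundaries\<close> contains the exterior
      relations.\<close>
    have "t \<ominus>\<^bsub>L.tuples 2\<^esub> L.boundary 3 \<zero>\<^bsub>L.tuples 3\<^esub> = t"
      using that(1) linear_maps_zero[OF L.tuples_module L.tuples_module L.boundary_3_linear]
      by (simp add: T.M.minus_eq)
    then have "t \<in> boundaries" using that T3.M.zero_closed by force
    then show ?thesis using that(1) c_zero by blast
  qed
  have c_boundary: "?c (L.boundary 3 s) = \<zero>\<^bsub>?Q\<^esub>" if "s \<in> carrier (L.tuples 3)" for s
  proof -
    have b: "L.boundary 3 s \<in> carrier (L.tuples 2)"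
      by (rule linear_maps_closed[OF L.boundary_3_linear that])
    have "L.boundary 3 s \<ominus>\<^bsub>L.tuples 2\<^esub> L.boundary 3 s \<in> L.relations 2"
      using b subgroup.one_closed[OF submodule.axioms(1)[OF L.relations_submodule[of 2]]]
      by (simp add: T.M.minus_eq T.M.r_neg)
    then show ?thesis using b that c_zero by blast
  qed
  \<comment> \<open>Since the class map kills the exterior relations, it factors through the
    exterior square; bilinearity and antisymmetry of \<open>w\<close> are then inherited from the
    wedge product.\<close>
  obtain h where h: "h \<in> linear_maps R (exterior_power R L 2) ?Q"
    and hc: "\<And>t. t \<in> carrier (L.tuples 2) \<Longrightarrow> h (L.relations 2 +>\<^bsub>L.tuples 2\<^esub> t) = ?c t"
    using factor_through_surjection[OF L.tuples_module L.exterior_power_module Q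
        L.projection_linear L.exterior_power_carrier[symmetric] c] c_relations
      L.projection_eq_zero_iff by blast
  define w where "w x y = ?c (basis_vector R [x, y])" for x y
  have w: "w x y = h (L.wedge 2 [x, y])" if "x \<in> carrier L" "y \<in> carrier L" for x y
    using that by (auto simp: w_def intro!: hc[symmetric] L.basis_vector_tuples)
  have w_linear: "(\<lambda>x. w x y) \<in> linear_maps R L ?Q" "(\<lambda>x. w y x) \<in> linear_maps R L ?Q"
    if y: "y \<in> carrier L" for y
    using linear_maps_comp[OF L.wedge_2_linear(1)[OF y] h] linear_maps_comp[OF L.wedge_2_linear(2)[OF y] h] y
    by (auto simp: linear_maps_def hom_def w)
  note w_closed = linear_maps_closed[OF w_linear(1)]
  have w_skew: "w y x = \<ominus>\<^bsub>?Q\<^esub> w x y" if "x \<in> carrier L" "y \<in> carrier L" for x y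
    using that L.wedge_2_skew[OF that] L.wedge_closed[of "[x, y]" 2]
    by (simp add: w linear_maps_neg[OF L.exterior_power_module Q h])
  have w_jacobi: "w (twist L x) (y \<otimes>\<^bsub>L\<^esub> z) \<oplus>\<^bsub>?Q\<^esub> w (twist L y) (z \<otimes>\<^bsub>L\<^esub> x)
      \<oplus>\<^bsub>?Q\<^esub> w (twist L z) (x \<otimes>\<^bsub>L\<^esub> y) = \<zero>\<^bsub>?Q\<^esub>"
    if xyz: "x \<in> carrier L" "y \<in> carrier L" "z \<in> carrier L" for x y z
  proof -
    have b: "basis_vector R [x, y, z] \<in> carrier (L.tuples 3)"
      using xyz by (auto intro!: L.basis_vector_tuples)
    \<comment> \<open>Zero is the class of the boundary of (x, y, z). Exchanging the arguments of
      each \<open>w\<close> afterwards absorbs the sign in front of the cyclic sum.\<close>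
    have "\<zero>\<^bsub>?Q\<^esub> = \<ominus>\<^bsub>?Q\<^esub> (w (x \<otimes>\<^bsub>L\<^esub> y) (twist L z) \<oplus>\<^bsub>?Q\<^esub>
        (w (y \<otimes>\<^bsub>L\<^esub> z) (twist L x) \<oplus>\<^bsub>?Q\<^esub> w (z \<otimes>\<^bsub>L\<^esub> x) (twist L y)))"
      using L.linear_map_boundary_3[OF Q c w_linear(1)[unfolded w_def] xyz] c_boundary[OF b]
      by (simp add: w_def)
    also have "\<dots> = w (twist L x) (y \<otimes>\<^bsub>L\<^esub> z) \<oplus>\<^bsub>?Q\<^esub> w (twist L y) (z \<otimes>\<^bsub>L\<^esub> x)
      \<oplus>\<^bsub>?Q\<^esub> w (twist L z) (x \<otimes>\<^bsub>L\<^esub> y)"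
      using xyz w_skew[of "x \<otimes>\<^bsub>L\<^esub> y" "twist L z"] w_skew[of "y \<otimes>\<^bsub>L\<^esub> z" "twist L x"]
        w_skew[of "z \<otimes>\<^bsub>L\<^esub> x" "twist L y"]
      by (simp add: w_closed L.bracket_closed L.twist_closed Q.M.minus_add Q.M.a_ac)
    finally show ?thesis by simp
  qed
  interpret free_nonassoc R X \<sigma>
    by (intro free_nonassoc.intro free_nonassoc_axioms.intro hom_set L.field)
  have "hom_lie_algebra R F" ..
  \<comment> \<open>Freeness of F is used here. The form \<open>w (p a) (p b)\<close> satisfies the
    Hom-Jacobi condition because its values are taken modulo boundaries.\<close>
  then obtain \<theta> where \<theta>: "\<theta> \<in> linear_maps R F ?Q"
    and \<theta>_bracket: "\<And>a b. a \<in> carrier F \<Longrightarrow> b \<in> carrier F \<Longrightarrow> \<theta> (a \<otimes>\<^bsub>F\<^esub> b) = w (p a) (p b)"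
  proof (rule bracket_extension[OF _ free Q, where G = "\<lambda>a b. w (p a) (p b)"])
    show "(\<lambda>a. w (p a) (p b)) \<in> linear_maps R F ?Q" "(\<lambda>a. w (p b) (p a)) \<in> linear_maps R F ?Q"
      if "b \<in> carrier F" for b
      using linear_maps_comp[OF p_linear w_linear(1)[OF p_closed[OF that]]]
        linear_maps_comp[OF p_linear w_linear(2)[OF p_closed[OF that]]] .
    show "w (p a) (p b) \<oplus>\<^bsub>?Q\<^esub> w (p b) (p a) = \<zero>\<^bsub>?Q\<^esub>"
      if "a \<in> carrier F" "b \<in> carrier F" for a b
      using that w_skew[of "p a" "p b"] by (simp add: p_closed w_closed Q.M.r_neg)
  qed (simp_all add: p_twist p_bracket p_closed w_jacobi)
  have \<theta>_FK: "\<theta> r = \<zero>\<^bsub>?Q\<^esub>" if "r \<in> FK" for r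
  proof -
    have "FK \<subseteq> {r \<in> carrier F. \<theta> r = \<zero>\<^bsub>?Q\<^esub>}"
    proof (rule bracket_span_least[OF submodule_kernel[OF F.module_L Q \<theta>]])
      fix a k assume ak: "a \<in> carrier F" "k \<in> K"
      then have k: "k \<in> carrier F" "p k = \<zero>\<^bsub>L\<^esub>" using K_subset p_eq_zero_iff by auto
      then show "a \<otimes>\<^bsub>F\<^esub> k \<in> {r \<in> carrier F. \<theta> r = \<zero>\<^bsub>?Q\<^esub>}"
        using ak(1) linear_maps_zero[OF L.module_L Q w_linear(2)[OF p_closed[OF ak(1)]]]
        by (simp add: F.bracket_closed \<theta>_bracket)
    qed
    then show ?thesis using that by blast
  qed
  \<comment> \<open>On a basis pair, \<open>\<theta>\<close> returns \<open>w\<close> at the images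
    of \<open>sect x\<close> and \<open>sect y\<close>, which are x and y again.\<close>
  have \<theta>_lift: "\<theta> (lift t) = ?c t"
    by (rule L.tuples_maps_eqI[OF Q linear_maps_comp[OF lift_linear \<theta>] c _ t])
      (auto elim!: L.length_2_cases simp: lift_basis_vector \<theta>_bracket sect_closed p_sect w_def)
  show "t \<in> boundaries" if "lift t \<in> FK"
    using c_zero[OF t] \<theta>_FK[OF that] \<theta>_lift by simp
qed

section \<open>The isomorphism\<close>

lemma homology_2_iso_schur_multiplier:
  "hom_space_iso R (homology R L 2) (schur_multiplier R K F)"
proof -
  define U where "U = (L.tuples 2)\<lparr>carrier := {t \<in> carrier (L.tuples 2). L.bracket_map t = \<zero>\<^bsub>L\<^esub>}\<rparr>"
  define V where "V = F\<lparr>carrier := K \<inter> FF\<rparr>"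
  note U = L.homology_2_cover[folded U_def]
  obtain f where f: "f \<in> hom_space_morphisms R U (homology R L 2)"
    "f ` carrier U = carrier (homology R L 2)"
    and f_zero: "\<And>t. t \<in> carrier U \<Longrightarrow> f t = \<zero>\<^bsub>homology R L 2\<^esub> \<longleftrightarrow> t \<in> boundaries"
    using U(4) by (auto simp: U_def)
  have Vsub: "submodule (K \<inter> FF) R F"
    by (rule submodule_Int[OF F.module_L K_submodule FF_submodule])
  have V: "module R V"
    unfolding V_def by (rule submodule.submodule_is_module[OF Vsub F.module_L])
  have FK: "submodule FK R V"
    unfolding V_def by (rule submodule_restrict_carrier[OF F.module_L Vsub FK_submodule FK_subset])
  have M: "schur_multiplier R K F = hom_quotient V FK"
    by (simp add: schur_multiplier_def V_def)
  have cls: "FK +>\<^bsub>V\<^esub> a = cls a" for a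
    by (simp add: V_def coset_restrict_carrier)
  have U_iff: "t \<in> carrier U \<longleftrightarrow> t \<in> carrier (L.tuples 2) \<and> lift t \<in> K" for t
    using linear_maps_closed[OF lift_linear] by (auto simp: U_def p_lift[symmetric] p_eq_zero_iff)
  have lift: "lift \<in> linear_maps R U V"
    unfolding U_def V_def
    by (rule linear_maps_restrict_carrier[OF lift_linear])
      (use U_iff lift_mem_FF in \<open>auto simp: U_def\<close>)
  have twV: "twist V \<in> linear_maps R V V"
    using linear_maps_restrict_carrier[OF F.twist_linear, of "K \<inter> FF" "K \<inter> FF"]
      K_subset K.twist_ideal twist_bracket_span[of "carrier F"] F.twist_closed
    by (auto simp: V_def)
  have twFK: "twist V x \<in> FK" if "x \<in> FK" for x
    using twist_bracket_span[OF K_subset K.twist_ideal that] by (simp add: V_def)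
  let ?g = "\<lambda>t. FK +>\<^bsub>V\<^esub> lift t"
  have "?g \<in> linear_maps R U (schur_multiplier R K F)"
    unfolding M by (rule linear_maps_comp[OF lift coset_linear[OF V FK]])
  moreover have "?g (twist U t) = twist (schur_multiplier R K F) (?g t)" if "t \<in> carrier U" for t
  proof -
    have "twist (schur_multiplier R K F) (?g t) = cls (twist F (lift t))"
      using hom_quotient_twist[OF V FK twV twFK linear_maps_closed[OF lift that]]
      unfolding M cls by (simp add: V_def)
    also have "\<dots> = ?g (twist U t)"
      using lift_twist[of t] that by (simp add: cls U_iff) (simp add: U_def)
    finally show ?thesis by simp
  qed
  ultimately have g: "?g \<in> hom_space_morphisms R U (schur_multiplier R K F)"
    by (simp add: hom_space_morphisms_def)
  \<comment> \<open>The \<open>t\<close> supplied by \<open>lift_surj\<close> is only known to match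
    \<open>r\<close> modulo [F, K]. As [F, K] lies in \<open>K\<close>, the lift of \<open>t\<close>
    lies in \<open>K\<close> together with \<open>r\<close>, so \<open>t\<close> represents a
    cycle.\<close>
  have "cls r \<in> (\<lambda>t. cls (lift t)) ` carrier U" if r: "r \<in> K" "r \<in> FF" for r
  proof -
    obtain t where t: "t \<in> carrier (L.tuples 2)" "cls (lift t) = cls r"
      using lift_surj[OF r(2)] .
    have c: "lift t \<in> carrier F" "r \<in> carrier F"
      using linear_maps_closed[OF lift_linear t(1)] r(1) K_subset by auto
    then have "lift t \<ominus>\<^bsub>F\<^esub> r \<in> K"
      using t(2) coset_eq_iff[OF F.module_L FK_submodule c] FK_subset by blast
    then have "p (lift t) = p r"
      using c p_closed by (simp add: p_eq_zero_iff[symmetric]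
          linear_maps_minus[OF F.module_L L.module_L p_linear] L.M.minus_eq_zero_iff)
    then have "t \<in> carrier U"
      using t(1) c r(1) by (simp add: U_iff p_eq_zero_iff[symmetric])
    then show ?thesis using t(2) by force
  qed
  then have g_surj: "?g ` carrier U = carrier (schur_multiplier R K F)"
    using linear_maps_closed[OF lift]
    by (auto simp: M hom_quotient_simps cls) (auto simp: V_def)
  have g_zero: "?g t = \<zero>\<^bsub>schur_multiplier R K F\<^esub> \<longleftrightarrow> t \<in> boundaries" if "t \<in> carrier U" for t
    using that boundaries_iff[of t] coset_eq_zero_iff[OF V FK linear_maps_closed[OF lift that]]
    by (simp add: M hom_quotient_simps U_iff)
  show ?thesis
    by (rule hom_space_iso_of_common_cover[OF U(1,3) _ f g g_surj _ U(2)])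
      (use V FK in \<open>simp_all add: M hom_quotient_module f_zero g_zero[unfolded M]\<close>)
qed

end

theorem corollary4p5:
  fixes R :: "('k, 'r) ring_scheme"
    and L :: "('k, 'l, 'n) hom_module_scheme"
    and X :: "'x set" and \<sigma> :: "'x \<Rightarrow> 'x"
    and K :: "'f set" and F :: "('k, 'f, 'm) hom_module_scheme"
    and p :: "'f \<Rightarrow> 'l"
  assumes "field R"
    and "hom_lie_algebra R L"
    and "free_presentation R X \<sigma> K F p L"
  shows "hom_space_iso R (homology R L 2) (schur_multiplier R K F)"
  using assms(3) by (rule free_presentation.homology_2_iso_schur_multiplier)

end
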